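(* Let $H$ be a separable Hilbert space, $-\infty<a<b<\infty$, and let $A_1,A_2$ be linear selfadjoint operators in $H$ with $A_1\le 0$, $A_2\ge 0$ and $0\in\sigma_p((-A_1)^{1/2})\cap\sigma_p(A_2^{1/2})$. Let $L_0=L_{10}\oplus L_{20}$ be the minimal operator generated in $L_2=L_2(H,(-\infty,a))\oplus L_2(H,(b,\infty))$ by the differential expression $l(u)=(u_1'+A_1u_1,\;u_2'+A_2u_2)$, $u=(u_1,u_2)$. Then for the continuous spectrum of any normal extension $L_W$ of $L_0$ in $L_2$ one has $\sigma_c(L_W)=i\mathbb{R}$.
   Context: Minimal operators. $L_{10}$ (resp. $L_{20}$) is the minimal operator generated by $l_1(u_1)=u_1'+A_1u_1$ in $L_2(H,(-\infty,a))$ (resp. by $l_2(u_2)=u_2'+A_2u_2$ in $L_2(H,(b,\infty))$), that is, the closure of the differential expression restricted to finite sums $\sum_j\varphi_j(t)f_j$ with $\varphi_j\in C_0^\infty$ of the open interval and $f_j\in D(A_k)$. Normal operators. A densely defined closed operator $N$ in a Hilbert space is formally normal if $D(N)\subset D(N^* )$ and $\|Nf\|=\|N^*f\|$ for all $f\in D(N)$. A formally normal operator $N$ is normal if $D(N)=D(N^* )$. A normal extension of $L_0$ is a normal operator in $L_2$ that extends $L_0$; it is denoted $L_W$ (the subscript refers to a unitary operator $W$ in $H$ with $u_2(b)=Wu_1(a)$ on the domain of the extension). $\sigma_p$ denotes the point spectrum (set of eigenvalues). $\sigma_c(T)$ denotes the continuous spectrum: the set of $\lambda\in\mathbb{C}$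 for which $T-\lambda$ is injective with dense range but not surjective. *)

theory Defs
  imports "HOL-Analysis.Analysis"
begin

section \<open>Complex inner product spaces\<close>

text \<open>
  The complex inner product is linear in its first argument. The underlying real Hilbert space
  structure, and with it norm and topology, is the one of \<^class>\<open>real_inner\<close>.
\<close>

class complex_inner = real_inner +
  fixes scaleC :: "complex \<Rightarrow> 'a \<Rightarrow> 'a" (infixr \<open>*\<^sub>C\<close> 75)
    and cinner :: "'a \<Rightarrow> 'a \<Rightarrow> complex"
  assumes scaleC_add_right: "c *\<^sub>C (x + y) = c *\<^sub>C x + c *\<^sub>C y"
    and scaleC_add_left: "(c + d) *\<^sub>C x = c *\<^sub>C x + d *\<^sub>C x"
    and scaleC_scaleC: "c *\<^sub>C (d *\<^sub>C x) = (c * d) *\<^sub>C x"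
    and scaleR_scaleC: "scaleR r x = complex_of_real r *\<^sub>C x"
    and cinner_add_left: "cinner (x + y) z = cinner x z + cinner y z"
    and cinner_scaleC_left: "cinner (c *\<^sub>C x) y = c * cinner x y"
    and cinner_commute: "cinner x y = cnj (cinner y x)"
    and inner_eq_Re_cinner: "inner x y = Re (cinner x y)"

class chilbert_space = complex_inner + banach

lemma Im_cinner: "Im (cinner x y) = - inner (\<i> *\<^sub>C x) y"
  by (simp add: inner_eq_Re_cinner cinner_scaleC_left)

lemma cinner_scaleC_right: "cinner x (c *\<^sub>C y) = cnj c * cinner x y"
  by (metis cinner_commute cinner_scaleC_left complex_cnj_mult)

lemma norm_scaleC: "norm (c *\<^sub>C x) = cmod c * norm x"
proof -
  have "cinner (c *\<^sub>C x) (c *\<^sub>C x) = (c * cnj c) * cinner x x"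
    by (simp add: cinner_scaleC_left cinner_scaleC_right)
  also have "\<dots> = complex_of_real ((cmod c)\<^sup>2) * cinner x x"
    by (simp only: complex_norm_square)
  finally have "inner (c *\<^sub>C x) (c *\<^sub>C x) = (cmod c)\<^sup>2 * inner x x"
    by (simp add: inner_eq_Re_cinner)
  then show ?thesis
    by (simp add: norm_eq_sqrt_inner real_sqrt_mult)
qed

lemma bounded_linear_scaleC: "bounded_linear (\<lambda>x::'a::complex_inner. c *\<^sub>C x)"
proof (rule bounded_linear_intro[where K = "cmod c"])
  fix r :: real and x :: 'a
  show "c *\<^sub>C (r *\<^sub>R x) = r *\<^sub>R (c *\<^sub>C x)"
    by (simp add: scaleR_scaleC scaleC_scaleC mult.commute)
qed (auto simp: scaleC_add_right norm_scaleC)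

lemma cinner_conv_inner:
  "cinner x y = complex_of_real (inner x y) - \<i> * complex_of_real (inner (\<i> *\<^sub>C x) y)"
  by (simp add: complex_eq_iff inner_eq_Re_cinner cinner_scaleC_left)

instantiation prod :: (complex_inner, complex_inner) complex_inner
begin

definition scaleC_prod_def: "c *\<^sub>C x = (c *\<^sub>C fst x, c *\<^sub>C snd x)"
definition cinner_prod_def: "cinner x y = cinner (fst x) (fst y) + cinner (snd x) (snd y)"

instance
proof
  fix x y :: "'a \<times> 'b"
  show "cinner x y = cnj (cinner y x)"
    unfolding cinner_prod_def by (metis cinner_commute complex_cnj_add)
qed (auto simp: scaleC_prod_def cinner_prod_def prod_eq_iff scaleC_add_right scaleC_add_left
        scaleC_scaleC scaleR_scaleC cinner_add_left cinner_scaleC_left algebra_simps inner_prod_def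
        inner_eq_Re_cinner)

end

definition csubspace :: "'a::complex_inner set \<Rightarrow> bool" where
  "csubspace K \<longleftrightarrow>
     0 \<in> K \<and> (\<forall>x\<in>K. \<forall>y\<in>K. x + y \<in> K) \<and> (\<forall>c. \<forall>x\<in>K. c *\<^sub>C x \<in> K)"

section \<open>Square integrable vector-valued functions\<close>

definition square_integrable :: "(real \<Rightarrow> 'h::{real_inner, second_countable_topology}) \<Rightarrow> bool" where
  "square_integrable f \<longleftrightarrow>
     f \<in> borel_measurable lborel \<and> integrable lborel (\<lambda>t. (norm (f t))\<^sup>2)"

definition L2_rel :: "(real \<Rightarrow> 'h::{real_inner, second_countable_topology}) \<Rightarrow> (real \<Rightarrow> 'h) \<Rightarrow> bool" where
  "L2_rel f g \<longleftrightarrow> square_integrable f \<and> square_integrable g \<and> (AE t in lborel. f t = g t)"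

lemma square_integrable_0: "square_integrable (\<lambda>t. 0)"
  by (simp add: square_integrable_def)

lemma square_integrable_bounded_by:
  assumes "square_integrable f" "square_integrable g" "h \<in> borel_measurable lborel"
    and "\<And>t. norm (h t) \<le> C * (norm (f t) + norm (g t))"
  shows "square_integrable h"
proof -
  have "integrable lborel (\<lambda>t. (norm (h t))\<^sup>2)"
  proof (rule Bochner_Integration.integrable_bound)
    show "integrable lborel (\<lambda>t. C\<^sup>2 * (2 * ((norm (f t))\<^sup>2 + (norm (g t))\<^sup>2)))"
      using assms unfolding square_integrable_def
      by (intro integrable_mult_right Bochner_Integration.integrable_add) auto
    show "(\<lambda>t. (norm (h t))\<^sup>2) \<in> borel_measurable lborel"
      using assms(3) by measurable
    have "(norm (h t))\<^sup>2 \<le> C\<^sup>2 * (2 * ((norm (f t))\<^sup>2 + (norm (g t))\<^sup>2))" for t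
    proof -
      have "(norm (h t))\<^sup>2 \<le> (C * (norm (f t) + norm (g t)))\<^sup>2"
        by (rule power_mono[OF assms(4)]) simp
      also have "\<dots> = C\<^sup>2 * (norm (f t) + norm (g t))\<^sup>2"
        by (simp add: power_mult_distrib)
      also have "\<dots> \<le> C\<^sup>2 * (2 * ((norm (f t))\<^sup>2 + (norm (g t))\<^sup>2))"
        using sum_squares_bound[of "norm (f t)" "norm (g t)"]
        by (intro mult_left_mono) (auto simp: power2_sum)
      finally show ?thesis .
    qed
    then show "AE t in lborel. norm ((norm (h t))\<^sup>2)
        \<le> norm (C\<^sup>2 * (2 * ((norm (f t))\<^sup>2 + (norm (g t))\<^sup>2)))"
      by (simp add: abs_mult)
  qed
  then show ?thesis
    using assms(3) by (simp add: square_integrable_def)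
qed

lemma square_integrable_add:
  "square_integrable f \<Longrightarrow> square_integrable g \<Longrightarrow> square_integrable (\<lambda>t. f t + g t)"
  by (rule square_integrable_bounded_by[where C = 1 and f = f and g = g])
    (auto simp: square_integrable_def norm_triangle_ineq)

lemma square_integrable_bounded_linear:
  assumes "bounded_linear B" "square_integrable f"
  shows "square_integrable (\<lambda>t. B (f t))"
proof -
  obtain K where K: "\<And>x. norm (B x) \<le> norm x * K"
    using bounded_linear.bounded[OF assms(1)] by blast
  have [measurable]: "B \<in> borel_measurable borel" "f \<in> borel_measurable lborel"
    using assms linear_continuous_on borel_measurable_continuous_onI
    by (auto simp: square_integrable_def)
  show ?thesis
  proof (rule square_integrable_bounded_by[where C = "K" and f = f and g = "\<lambda>t. 0"])
    show "norm (B (f t)) \<le> K * (norm (f t) + norm (0::'a))" for t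
      using K[of "f t"] by (simp add: mult.commute)
  qed (use assms square_integrable_0 in auto)
qed

lemma integrable_inner_L2:
  assumes "square_integrable f" "square_integrable g"
  shows "integrable lborel (\<lambda>t. inner (f t) (g t))"
proof (rule Bochner_Integration.integrable_bound)
  show "integrable lborel (\<lambda>t. (norm (f t))\<^sup>2 + (norm (g t))\<^sup>2)"
    using assms by (auto simp: square_integrable_def)
  have [measurable]: "f \<in> borel_measurable lborel" "g \<in> borel_measurable lborel"
    using assms by (auto simp: square_integrable_def)
  show "(\<lambda>t. inner (f t) (g t)) \<in> borel_measurable lborel"
    by measurable
  have "\<bar>inner (f t) (g t)\<bar> \<le> (norm (f t))\<^sup>2 + (norm (g t))\<^sup>2" for t
  proof -
    have "\<bar>inner (f t) (g t)\<bar> \<le> norm (f t) * norm (g t)"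
      by (rule Cauchy_Schwarz_ineq2)
    also have "\<dots> \<le> 2 * norm (f t) * norm (g t)"
      by simp
    also have "\<dots> \<le> (norm (f t))\<^sup>2 + (norm (g t))\<^sup>2"
      by (rule sum_squares_bound)
    finally show ?thesis .
  qed
  then show "AE t in lborel. norm (inner (f t) (g t)) \<le> norm ((norm (f t))\<^sup>2 + (norm (g t))\<^sup>2)"
    by simp
qed

lemma integrable_cinner_L2:
  assumes "square_integrable f" "square_integrable g"
  shows "integrable lborel (\<lambda>t. cinner (f t) (g t))"
  unfolding cinner_conv_inner
  using assms square_integrable_bounded_linear[OF bounded_linear_scaleC assms(1)]
  by (intro Bochner_Integration.integrable_diff integrable_mult_right integrable_of_real
      integrable_inner_L2)

text \<open>
  Square integrable functions on the whole real line modulo equality almost everywhere. Since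
  \<^typ>\<open>'h\<close> is second countable, Borel measurability is strong measurability.
\<close>

quotient_type (overloaded) 'h L2 =
  "real \<Rightarrow> 'h::{real_inner, second_countable_topology}" / partial: L2_rel
proof (rule part_equivpI)
  show "\<exists>f. L2_rel f (f :: real \<Rightarrow> 'h)"
    using square_integrable_0 by (auto simp: L2_rel_def)
qed (auto simp: symp_def transp_def L2_rel_def elim: eventually_elim2)

instantiation L2 :: ("{real_inner, second_countable_topology}") real_inner
begin

lift_definition zero_L2 :: "'a L2" is "\<lambda>t. 0"
  by (simp add: L2_rel_def square_integrable_0)

lift_definition plus_L2 :: "'a L2 \<Rightarrow> 'a L2 \<Rightarrow> 'a L2" is "\<lambda>f g t. f t + g t"
  by (auto simp: L2_rel_def intro: square_integrable_add elim: eventually_elim2)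

lift_definition scaleR_L2 :: "real \<Rightarrow> 'a L2 \<Rightarrow> 'a L2" is "\<lambda>r f t. r *\<^sub>R f t"
  by (auto simp: L2_rel_def intro: square_integrable_bounded_linear[OF bounded_linear_scaleR_right]
      elim: eventually_mono)

lift_definition uminus_L2 :: "'a L2 \<Rightarrow> 'a L2" is "\<lambda>f t. - f t"
  by (auto simp: L2_rel_def elim: eventually_mono
      intro: square_integrable_bounded_linear[OF bounded_linear_minus[OF bounded_linear_ident]])

lift_definition inner_L2 :: "'a L2 \<Rightarrow> 'a L2 \<Rightarrow> real" is "\<lambda>f g. \<integral>t. inner (f t) (g t) \<partial>lborel"
proof -
  fix f f' g g' :: "real \<Rightarrow> 'a"
  assume *: "L2_rel f f'" "L2_rel g g'"
  then have [measurable]: "f \<in> borel_measurable borel" "f' \<in> borel_measurable borel"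
      "g \<in> borel_measurable borel" "g' \<in> borel_measurable borel"
    by (auto simp: L2_rel_def square_integrable_def)
  show "(\<integral>t. inner (f t) (g t) \<partial>lborel) = (\<integral>t. inner (f' t) (g' t) \<partial>lborel)"
    by (rule integral_cong_AE) (use * in \<open>auto simp: L2_rel_def elim: eventually_elim2\<close>)
qed

definition minus_L2 :: "'a L2 \<Rightarrow> 'a L2 \<Rightarrow> 'a L2" where
  "minus_L2 f g = f + (- g)"
definition norm_L2 :: "'a L2 \<Rightarrow> real" where
  "norm_L2 f = sqrt (inner f f)"
definition sgn_L2 :: "'a L2 \<Rightarrow> 'a L2" where
  "sgn_L2 f = inverse (norm f) *\<^sub>R f"
definition dist_L2 :: "'a L2 \<Rightarrow> 'a L2 \<Rightarrow> real" where
  "dist_L2 f g = norm (f - g)"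
definition uniformity_L2 :: "('a L2 \<times> 'a L2) filter" where
  "uniformity_L2 = (INF e\<in>{0<..}. principal {(x, y). dist x y < e})"
definition open_L2 :: "'a L2 set \<Rightarrow> bool" where
  "open_L2 U \<longleftrightarrow> (\<forall>x\<in>U. eventually (\<lambda>(x', y). x' = x \<longrightarrow> y \<in> U) uniformity)"

instance
proof
  fix x y z :: "'a L2" and r s :: real
  note sq = square_integrable_add square_integrable_0
    square_integrable_bounded_linear[OF bounded_linear_scaleR_right]
    square_integrable_bounded_linear[OF bounded_linear_minus[OF bounded_linear_ident]]
  show "x + y + z = x + (y + z)"
    by transfer (auto simp: L2_rel_def add.assoc intro!: sq)
  show "x + y = y + x"
    by transfer (auto simp: L2_rel_def add.commute intro!: sq)
  show "0 + x = x"
    by transfer (auto simp: L2_rel_def)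
  show "- x + x = 0"
    by transfer (auto simp: L2_rel_def intro!: sq)
  show "x - y = x + - y"
    by (simp add: minus_L2_def)
  show "r *\<^sub>R (x + y) = r *\<^sub>R x + r *\<^sub>R y"
    by transfer (auto simp: L2_rel_def scaleR_add_right intro!: sq)
  show "(r + s) *\<^sub>R x = r *\<^sub>R x + s *\<^sub>R x"
    by transfer (auto simp: L2_rel_def scaleR_add_left intro!: sq)
  show "r *\<^sub>R s *\<^sub>R x = (r * s) *\<^sub>R x"
    by transfer (auto simp: L2_rel_def intro!: sq)
  show "1 *\<^sub>R x = x"
    by transfer (auto simp: L2_rel_def)
  show "sgn x = inverse (norm x) *\<^sub>R x"
    by (rule sgn_L2_def)
  show "dist x y = norm (x - y)"
    by (rule dist_L2_def)
  show "(uniformity :: ('a L2 \<times> 'a L2) filter) = (INF e\<in>{0<..}. principal {(x, y). dist x y < e})"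
    by (rule uniformity_L2_def)
  show "inner x y = inner y x"
    by transfer (simp add: inner_commute)
  show "inner (x + y) z = inner x z + inner y z"
    by transfer (auto simp: L2_rel_def inner_add_left integrable_inner_L2
        intro!: Bochner_Integration.integral_add)
  show "inner (r *\<^sub>R x) y = r * inner x y"
    by transfer simp
  show "0 \<le> inner x x"
    by transfer (auto intro!: Bochner_Integration.integral_nonneg)
  show "inner x x = 0 \<longleftrightarrow> x = 0"
  proof transfer
    fix f :: "real \<Rightarrow> 'a"
    assume "L2_rel f f"
    then have f: "square_integrable f"
      by (simp add: L2_rel_def)
    have "(\<integral>t. inner (f t) (f t) \<partial>lborel) = 0 \<longleftrightarrow> (AE t in lborel. inner (f t) (f t) = 0)"
      by (rule integral_nonneg_eq_0_iff_AE) (auto intro: integrable_inner_L2 f)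
    then show "(\<integral>t. inner (f t) (f t) \<partial>lborel) = 0 \<longleftrightarrow> L2_rel f (\<lambda>t. 0)"
      by (simp add: L2_rel_def f square_integrable_0)
  qed
  show "norm x = sqrt (inner x x)"
    by (rule norm_L2_def)
next
  fix U :: "'a L2 set"
  show "open U \<longleftrightarrow> (\<forall>x\<in>U. eventually (\<lambda>(x', y). x' = x \<longrightarrow> y \<in> U) uniformity)"
    by (rule open_L2_def)
qed

end

instantiation L2 :: ("{complex_inner, second_countable_topology}") complex_inner
begin

lift_definition scaleC_L2 :: "complex \<Rightarrow> 'a L2 \<Rightarrow> 'a L2" is "\<lambda>c f t. c *\<^sub>C f t"
  by (auto simp: L2_rel_def intro: square_integrable_bounded_linear[OF bounded_linear_scaleC]
      elim: eventually_mono)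

lift_definition cinner_L2 :: "'a L2 \<Rightarrow> 'a L2 \<Rightarrow> complex"
  is "\<lambda>f g. \<integral>t. cinner (f t) (g t) \<partial>lborel"
proof -
  fix f f' g g' :: "real \<Rightarrow> 'a"
  assume *: "L2_rel f f'" "L2_rel g g'"
  then have "integrable lborel (\<lambda>t. cinner (f t) (g t))" "integrable lborel (\<lambda>t. cinner (f' t) (g' t))"
    by (auto simp: L2_rel_def intro: integrable_cinner_L2)
  then show "(\<integral>t. cinner (f t) (g t) \<partial>lborel) = (\<integral>t. cinner (f' t) (g' t) \<partial>lborel)"
    by (intro integral_cong_AE) (use * in \<open>auto simp: L2_rel_def elim: eventually_elim2\<close>)
qed

instance
proof
  fix x y z :: "'a L2" and c d :: complex and r :: real
  note sq = square_integrable_add square_integrable_bounded_linear[OF bounded_linear_scaleC]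
    square_integrable_bounded_linear[OF bounded_linear_scaleR_right]
  show "c *\<^sub>C (x + y) = c *\<^sub>C x + c *\<^sub>C y"
    by transfer (auto simp: L2_rel_def scaleC_add_right intro!: sq)
  show "(c + d) *\<^sub>C x = c *\<^sub>C x + d *\<^sub>C x"
    by transfer (auto simp: L2_rel_def scaleC_add_left intro!: sq)
  show "c *\<^sub>C d *\<^sub>C x = (c * d) *\<^sub>C x"
    by transfer (auto simp: L2_rel_def scaleC_scaleC intro!: sq)
  show "r *\<^sub>R x = complex_of_real r *\<^sub>C x"
    by transfer (auto simp: L2_rel_def scaleR_scaleC intro!: sq)
  show "cinner (x + y) z = cinner x z + cinner y z"
    by transfer (auto simp: L2_rel_def cinner_add_left integrable_cinner_L2
        intro!: Bochner_Integration.integral_add)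
  show "cinner (c *\<^sub>C x) y = c * cinner x y"
    by transfer (simp add: cinner_scaleC_left)
  show "cinner x y = cnj (cinner y x)"
    by transfer (subst cinner_commute, simp)
  show "inner x y = Re (cinner x y)"
    by transfer (simp add: L2_rel_def integrable_cinner_L2 inner_eq_Re_cinner)
qed

end

lift_definition vanishes_outside :: "real set \<Rightarrow> 'h::{real_inner, second_countable_topology} L2 \<Rightarrow> bool"
  is "\<lambda>S f. AE t in lborel. t \<notin> S \<longrightarrow> f t = 0"
proof -
  fix S and f g :: "real \<Rightarrow> 'h"
  assume "L2_rel f g"
  then have "AE t in lborel. f t = g t"
    by (simp add: L2_rel_def)
  then show "(AE t in lborel. t \<notin> S \<longrightarrow> f t = 0) = (AE t in lborel. t \<notin> S \<longrightarrow> g t = 0)"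
    by (intro AE_cong_simp eventually_subst) (auto elim: eventually_mono)
qed

text \<open>
  The space $L_2(H,S)$, for measurable $S$, is identified with the closed subspace of those
  elements of $L_2(H,\mathbb{R})$ that vanish almost everywhere outside $S$ (extension by zero).
\<close>

definition L2_on :: "real set \<Rightarrow> 'h::{real_inner, second_countable_topology} L2 set" where
  "L2_on S = Collect (vanishes_outside S)"

section \<open>Unbounded operators\<close>

text \<open>
  A linear operator in a Hilbert space is represented by its graph, so that
  \<^term>\<open>Domain\<close> and \<^term>\<open>Range\<close> are its domain and range, inclusion is extension of operators,
  closed operators are the topologically closed graphs, and \<^term>\<open>(O)\<close> is composition on the
  natural domain. The ambient Hilbert space is a closed subspace \<^term>\<open>K\<close> of the ambient type.
\<close>

definition linear_op :: "'a::complex_inner set \<Rightarrow> 'a rel \<Rightarrow> bool" where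
  "linear_op K T \<longleftrightarrow> T \<subseteq> K \<times> K \<and> single_valued T \<and> csubspace T"

definition densely_defined :: "'a::complex_inner set \<Rightarrow> 'a rel \<Rightarrow> bool" where
  "densely_defined K T \<longleftrightarrow> K \<subseteq> closure (Domain T)"

definition adjoint_op :: "'a::complex_inner set \<Rightarrow> 'a rel \<Rightarrow> 'a rel" where
  "adjoint_op K T = {(g, h). g \<in> K \<and> h \<in> K \<and> (\<forall>(f, Tf) \<in> T. cinner Tf g = cinner f h)}"

definition selfadjoint_op :: "'a::complex_inner set \<Rightarrow> 'a rel \<Rightarrow> bool" where
  "selfadjoint_op K T \<longleftrightarrow> linear_op K T \<and> densely_defined K T \<and> adjoint_op K T = T"

text \<open>The order is only used for selfadjoint operators, whose quadratic form is real.\<close>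

definition nonneg_op :: "'a::complex_inner rel \<Rightarrow> bool" where
  "nonneg_op T \<longleftrightarrow> (\<forall>(f, Tf) \<in> T. 0 \<le> Re (cinner Tf f))"

definition nonpos_op :: "'a::complex_inner rel \<Rightarrow> bool" where
  "nonpos_op T \<longleftrightarrow> (\<forall>(f, Tf) \<in> T. Re (cinner Tf f) \<le> 0)"

definition uminus_op :: "'a::complex_inner rel \<Rightarrow> 'a rel" where
  "uminus_op T = {(f, - Tf) | f Tf. (f, Tf) \<in> T}"

text \<open>
  A nonnegative selfadjoint operator in a Hilbert space has exactly one nonnegative selfadjoint
  square root; for other arguments the value is unspecified.
\<close>

definition sqrt_op :: "'a::complex_inner set \<Rightarrow> 'a rel \<Rightarrow> 'a rel" where
  "sqrt_op K T = (THE B. selfadjoint_op K B \<and> nonneg_op B \<and> B O B = T)"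

definition formally_normal :: "'a::complex_inner set \<Rightarrow> 'a rel \<Rightarrow> bool" where
  "formally_normal K N \<longleftrightarrow>
     linear_op K N \<and> densely_defined K N \<and> closed N \<and>
     Domain N \<subseteq> Domain (adjoint_op K N) \<and>
     (\<forall>f g h. (f, g) \<in> N \<longrightarrow> (f, h) \<in> adjoint_op K N \<longrightarrow> norm g = norm h)"

definition normal_op :: "'a::complex_inner set \<Rightarrow> 'a rel \<Rightarrow> bool" where
  "normal_op K N \<longleftrightarrow> formally_normal K N \<and> Domain N = Domain (adjoint_op K N)"

definition normal_extension :: "'a::complex_inner set \<Rightarrow> 'a rel \<Rightarrow> 'a rel \<Rightarrow> bool" where
  "normal_extension K T N \<longleftrightarrow> normal_op K N \<and> T \<subseteq> N"

definition shift_op :: "'a::complex_inner rel \<Rightarrow> complex \<Rightarrow> 'a rel" where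
  "shift_op T c = {(f, Tf - c *\<^sub>C f) | f Tf. (f, Tf) \<in> T}"

definition point_spectrum :: "'a::complex_inner rel \<Rightarrow> complex set" where
  "point_spectrum T = {c. \<exists>f. f \<noteq> 0 \<and> (f, c *\<^sub>C f) \<in> T}"

text \<open>Injectivity of an operator is single-valuedness of its inverse graph.\<close>

definition continuous_spectrum :: "'a::complex_inner set \<Rightarrow> 'a rel \<Rightarrow> complex set" where
  "continuous_spectrum K T =
     {c. single_valued ((shift_op T c)\<inverse>) \<and> K \<subseteq> closure (Range (shift_op T c)) \<and>
         Range (shift_op T c) \<noteq> K}"

definition direct_sum_op :: "'a rel \<Rightarrow> 'b rel \<Rightarrow> ('a \<times> 'b) rel" where
  "direct_sum_op S T = {((f1, f2), (g1, g2)) | f1 f2 g1 g2. (f1, g1) \<in> S \<and> (f2, g2) \<in> T}"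

section \<open>Minimal operators\<close>

definition smooth :: "(real \<Rightarrow> complex) \<Rightarrow> bool" where
  "smooth \<phi> \<longleftrightarrow> (\<forall>n t. ((\<lambda>\<psi> s. vector_derivative \<psi> (at s)) ^^ n) \<phi> differentiable (at t))"

definition test_functions :: "real set \<Rightarrow> (real \<Rightarrow> complex) set" where
  "test_functions S =
     {\<phi>. smooth \<phi> \<and> compact (closure {t. \<phi> t \<noteq> 0}) \<and> closure {t. \<phi> t \<noteq> 0} \<subseteq> S}"

definition test_sums :: "real set \<Rightarrow> 'h::complex_inner set \<Rightarrow> (real \<Rightarrow> 'h) set" where
  "test_sums S D =
     {\<lambda>t. \<Sum>j<n. \<phi> j t *\<^sub>C f j | (n::nat) \<phi> f. \<forall>j<n. \<phi> j \<in> test_functions S \<and> f j \<in> D}"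

text \<open>
  The closure of the differential expression $l(u) = u' + Au$ on the finite sums of test functions
  times vectors in the domain of $A$. Both $u$ and $l(u)$ are then square integrable, so
  \<^term>\<open>abs_L2\<close> is their class in the space of square integrable functions.
\<close>

definition minimal_op ::
  "real set \<Rightarrow> 'h::{complex_inner, second_countable_topology} rel \<Rightarrow> 'h L2 rel" where
  "minimal_op S A = closure
     {(abs_L2 u, abs_L2 v) | u v. u \<in> test_sums S (Domain A) \<and>
        (\<forall>t. \<exists>w. (u t, w) \<in> A \<and> v t = vector_derivative u (at t) + w)}"

end

theory Submission
  imports Defs "HOL-Real_Asymp.Real_Asymp"
begin

text \<open>
  Let \<open>s = 1\<close> on the right ray and \<open>s = - 1\<close> on the left ray, so that \<open>s\<close> points away from the boundary
  and \<open>B = s A\<close> is nonnegative on both rays. The proof first shows that a normal extension can exist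
  only if \<open>A\<^sub>1 = A\<^sub>2 = 0\<close>, and then computes the spectrum of a skew-adjoint extension of \<open>d/dt\<close>.

  Let \<open>N\<close> be a normal extension. Testing with the smooth functions in the domain of the minimal
  operator shows that, on the domain of \<open>N\<close>, half of \<open>N - N\<^sup>*\<close> is the derivative and half of
  \<open>N + N\<^sup>*\<close> is \<open>A\<close>, applied to the value at almost every \<open>t\<close> (\<open>N_components\<close>). Therefore
  \<open>\<parallel>N u\<parallel> = \<parallel>N\<^sup>* u\<parallel>\<close> says that the integrals of \<open>Re \<langle>B u, s u'\<rangle>\<close> over the two rays add up to zero. The
  integrand is half the derivative, in the direction away from the boundary, of the energy
  \<open>\<langle>B u, u\<rangle> \<ge> 0\<close>. Hence each integral is minus half the energy at the boundary, and both energies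
  vanish. By the Cauchy-Schwarz inequality for the form of \<open>B\<close>, the boundary value of \<open>u\<close> is then
  orthogonal to the range of \<open>B\<close> (\<open>inner_decay_deriv\<close>). So if \<open>g\<close> belongs both to the
  domain and to the range of \<open>B\<close>, then \<open>exp (- s t) g\<close> lies in the domain of \<open>N\<^sup>*\<close>. This is the domain
  of \<open>N\<close>, so this function has itself a boundary value orthogonal to the range of \<open>B\<close>, in particular
  to \<open>g\<close>, and \<open>g = 0\<close> (\<open>range_domain_trivial\<close>). Since \<open>B - \<i>\<close> is surjective, this
  forces \<open>B = 0\<close> (\<open>selfadjoint_trivial\<close>).

  To avoid traces, boundary energies are handled as limits of averages over thin strips. The form
  of \<open>B\<close> is convex, so the energy in a strip of width \<open>h\<close> is at most \<open>- 2 \<langle>B u, u(\<cdot> + s h) - u\<rangle>\<close>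
  (\<open>strip_energy_le\<close>), and it suffices that the difference quotients of \<open>u\<close> converge weakly
  to the derivative (\<open>pull_diff_weakly_tendsto\<close>).

  Now \<open>N\<^sup>* = - N\<close>. If \<open>Re c \<noteq> 0\<close>, then \<open>N - c\<close> is bounded below, so its range is closed, and \<open>c\<close> cannot
  belong to the continuous spectrum. Let \<open>c = \<i> \<omega>\<close>. The solutions of \<open>u' = \<i> \<omega> u + g\<close> are followed
  along translates of a bump function (\<open>DERIV_rotated\<close>). For \<open>g = 0\<close> the modulus is constant,
  which leaves no square integrable solution; with skew-adjointness this gives injectivity and
  dense range. For \<open>g\<close> of the form \<open>exp (\<i> \<omega> t) f / t\<close> at infinity, with \<open>f \<noteq> 0\<close>, a solution would
  grow logarithmically, so the range is not everything. The eigenvector provided by the hypothesis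
  on the point spectrum serves as \<open>f\<close>.
\<close>

section \<open>Orthogonal projection and density\<close>

lemma orthogonal_if_nearest:
  fixes x y m :: "'a::real_inner"
  assumes near: "\<And>t. norm (x - y) \<le> norm (x - (y + t *\<^sub>R m))"
  shows "inner m (x - y) = 0"
proof (rule ccontr)
  let ?c = "inner m (x - y)"
  assume c: "?c \<noteq> 0"
  then have m: "inner m m > 0"
    by auto
  define t where "t = ?c / inner m m"
  have "inner (x - y) (x - y) \<le> inner (x - (y + t *\<^sub>R m)) (x - (y + t *\<^sub>R m))"
    using near[of t] by (simp add: norm_eq_sqrt_inner)
  also have "\<dots> = inner (x - y) (x - y) - 2 * t * ?c + t\<^sup>2 * inner m m"
    by (simp add: inner_diff_left inner_diff_right inner_add_left inner_add_right inner_commute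
        algebra_simps power2_eq_square)
  also have "\<dots> = inner (x - y) (x - y) - ?c\<^sup>2 / inner m m"
    using m by (simp add: t_def power2_eq_square field_simps)
  finally show False
    using c m by (simp add: divide_le_0_iff)
qed

lemma orthogonal_decomposition:
  fixes x :: "'a::real_inner"
  assumes M: "complete M" "subspace M"
  obtains y where "y \<in> M" "\<And>m. m \<in> M \<Longrightarrow> inner m (x - y) = 0"
proof -
  have ne: "M \<noteq> {}"
    using M(2) subspace_0 by auto
  define d where "d = infdist x M"
  have d0: "d \<ge> 0"
    by (simp add: d_def infdist_nonneg)
  have d: "d \<le> norm (x - m)" if "m \<in> M" for m
    using infdist_le[OF that, of x] by (simp add: d_def dist_norm)
  have "\<exists>m\<in>M. norm (x - m) < d + 1 / (real n + 1)" for n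
  proof -
    have "(INF m\<in>M. dist x m) < d + 1 / (real n + 1)"
      using ne by (simp add: d_def infdist_notempty)
    then show ?thesis
      using ne by (subst (asm) cINF_less_iff) (auto simp: dist_norm intro!: bdd_belowI2[of _ 0])
  qed
  then obtain Y where Y: "\<And>n. Y n \<in> M" "\<And>n. norm (x - Y n) < d + 1 / (real n + 1)"
    by metis
  have lim: "(\<lambda>n. norm (x - Y n)) \<longlonglongrightarrow> d"
  proof (rule tendsto_sandwich[of "\<lambda>n. d" _ _ "\<lambda>n. d + 1 / (real n + 1)"])
    show "\<forall>\<^sub>F n in sequentially. norm (x - Y n) \<le> d + 1 / (real n + 1)"
      using Y(2) by (intro always_eventually allI less_imp_le)
    show "(\<lambda>n. d + 1 / (real n + 1)) \<longlonglongrightarrow> d"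
      by real_asymp
  qed (use d Y in auto)
  \<comment> \<open>The parallelogram law, with the midpoint in \<open>M\<close>, makes a minimizing sequence Cauchy.\<close>
  have par: "(norm (Y n - Y k))\<^sup>2 \<le> 2 * (norm (x - Y n))\<^sup>2 + 2 * (norm (x - Y k))\<^sup>2 - 4 * d\<^sup>2" for n k
  proof -
    have "(1/2) *\<^sub>R (Y n + Y k) \<in> M"
      using Y M(2) by (simp add: subspace_add subspace_scale)
    then have "d\<^sup>2 \<le> (norm (x - (1/2) *\<^sub>R (Y n + Y k)))\<^sup>2"
      using d d0 by (intro power_mono) auto
    moreover have "(norm (Y n - Y k))\<^sup>2 + 4 * (norm (x - (1/2) *\<^sub>R (Y n + Y k)))\<^sup>2
        = 2 * (norm (x - Y n))\<^sup>2 + 2 * (norm (x - Y k))\<^sup>2"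
      unfolding power2_norm_eq_inner
      by (simp add: inner_diff_left inner_diff_right inner_add_left inner_add_right inner_commute
          algebra_simps)
    ultimately show ?thesis
      by linarith
  qed
  have "Cauchy Y"
  proof (rule metric_CauchyI)
    fix e :: real
    assume e: "e > 0"
    have "(\<lambda>n. (norm (x - Y n))\<^sup>2) \<longlonglongrightarrow> d\<^sup>2"
      by (intro tendsto_intros lim)
    then have "\<forall>\<^sub>F n in sequentially. (norm (x - Y n))\<^sup>2 < d\<^sup>2 + e\<^sup>2 / 4"
      by (rule order_tendstoD) (use e in simp)
    then obtain n0 where n0: "\<And>n. n \<ge> n0 \<Longrightarrow> (norm (x - Y n))\<^sup>2 < d\<^sup>2 + e\<^sup>2 / 4"
      by (auto simp: eventually_sequentially)
    have "dist (Y m) (Y n) < e" if "m \<ge> n0" "n \<ge> n0" for m n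
    proof -
      have "(norm (Y m - Y n))\<^sup>2 < e\<^sup>2"
        using par[of m n] n0[of m] n0[of n] that by simp
      then show ?thesis
        using e by (simp add: dist_norm power2_less_imp_less)
    qed
    then show "\<exists>M. \<forall>m\<ge>M. \<forall>n\<ge>M. dist (Y m) (Y n) < e"
      by blast
  qed
  then obtain y where y: "y \<in> M" "Y \<longlonglongrightarrow> y"
    using M(1) Y(1) unfolding complete_def by blast
  have "(\<lambda>n. norm (x - Y n)) \<longlonglongrightarrow> norm (x - y)"
    by (intro tendsto_intros y)
  then have xy: "norm (x - y) = d"
    using lim LIMSEQ_unique by blast
  show thesis
  proof (rule that[OF y(1)])
    fix m
    assume "m \<in> M"
    then have "y + t *\<^sub>R m \<in> M" for t
      using y M(2) by (simp add: subspace_add subspace_scale)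
    then show "inner m (x - y) = 0"
      by (intro orthogonal_if_nearest) (simp add: xy d)
  qed
qed

lemma dense_if_total:
  fixes K X :: "'a::real_inner set"
  assumes K: "complete K" "subspace K" and X: "subspace X" "X \<subseteq> K"
    and total: "\<And>z. z \<in> K \<Longrightarrow> (\<And>x. x \<in> X \<Longrightarrow> inner x z = 0) \<Longrightarrow> z = 0"
  shows "K \<subseteq> closure X"
proof
  fix x
  assume x: "x \<in> K"
  have clK: "closure X \<subseteq> K"
    using X(2) K(1) by (simp add: closure_minimal complete_imp_closed)
  have "complete (closure X)"
    using complete_closed_subset[OF closed_closure clK K(1)] .
  moreover have "subspace (closure X)"
  proof (intro subspaceI)
    show "0 \<in> closure X"
      using X(1) subspace_0 closure_subset by blast
  next
    fix u v
    assume "u \<in> closure X" "v \<in> closure X"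
    then obtain U V where "\<And>n::nat. U n \<in> X" "U \<longlonglongrightarrow> u" "\<And>n::nat. V n \<in> X" "V \<longlonglongrightarrow> v"
      unfolding closure_sequential by blast
    then have "\<And>n. U n + V n \<in> X" "(\<lambda>n. U n + V n) \<longlonglongrightarrow> u + v"
      using X(1) by (auto intro: tendsto_add subspace_add)
    then show "u + v \<in> closure X"
      unfolding closure_sequential by (intro exI[of _ "\<lambda>n. U n + V n"]) simp
  next
    fix c u
    assume "u \<in> closure X"
    then obtain U where "\<And>n::nat. U n \<in> X" "U \<longlonglongrightarrow> u"
      unfolding closure_sequential by blast
    then have "\<And>n. c *\<^sub>R U n \<in> X" "(\<lambda>n. c *\<^sub>R U n) \<longlonglongrightarrow> c *\<^sub>R u"
      using X(1) by (auto intro: tendsto_scaleR subspace_scale)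
    then show "c *\<^sub>R u \<in> closure X"
      unfolding closure_sequential by (intro exI[of _ "\<lambda>n. c *\<^sub>R U n"]) simp
  qed
  ultimately obtain y where y: "y \<in> closure X" "\<And>m. m \<in> closure X \<Longrightarrow> inner m (x - y) = 0"
    using orthogonal_decomposition by blast
  have "x - y = 0"
  proof (rule total)
    show "x - y \<in> K"
      using x y(1) clK K(2) by (auto intro: subspace_diff)
    show "inner m (x - y) = 0" if "m \<in> X" for m
      using y(2) that closure_subset by blast
  qed
  then show "x \<in> closure X"
    using y(1) by simp
qed

section \<open>Complex inner products through real ones\<close>

lemma scaleC_minus1: "(-1) *\<^sub>C x = - (x :: 'a::complex_inner)"
  using scaleR_scaleC[of "-1" x] by simp

lemma scaleC_one [simp]: "1 *\<^sub>C x = (x :: 'a::complex_inner)"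
  using scaleR_scaleC[of 1 x] by simp

lemma scaleC_of_real: "complex_of_real r *\<^sub>C x = r *\<^sub>R x"
  by (simp add: scaleR_scaleC)

lemma scaleC_zero_right [simp]: "c *\<^sub>C (0 :: 'a::complex_inner) = 0"
  using norm_scaleC[of c "0::'a"] by simp

lemma scaleC_minus_right: "c *\<^sub>C (- x) = - (c *\<^sub>C (x :: 'a::complex_inner))"
  by (simp flip: scaleC_minus1 add: scaleC_scaleC)

lemma scaleC_minus_left: "(- c) *\<^sub>C x = - (c *\<^sub>C (x :: 'a::complex_inner))"
  by (simp flip: scaleC_minus1 add: scaleC_scaleC)

lemma scaleC_scaleR_commute: "c *\<^sub>C (r *\<^sub>R x) = r *\<^sub>R (c *\<^sub>C (x :: 'a::complex_inner))"
  by (simp add: scaleR_scaleC scaleC_scaleC mult.commute)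

lemma scaleC_diff_right: "c *\<^sub>C (x - y) = c *\<^sub>C x - c *\<^sub>C (y :: 'a::complex_inner)"
  using scaleC_add_right[of c x "- y"] by (simp add: scaleC_minus_right)

lemma inner_scaleC_left: "inner (c *\<^sub>C x) y = inner x (cnj c *\<^sub>C y)"
  by (simp add: inner_eq_Re_cinner cinner_scaleC_left cinner_scaleC_right)

lemma csubspace_imp_subspace: "csubspace K \<Longrightarrow> subspace K"
  by (auto simp: csubspace_def subspace_def scaleR_scaleC)

lemma csubspace_minus: "csubspace K \<Longrightarrow> x \<in> K \<Longrightarrow> - x \<in> K"
  using csubspace_imp_subspace subspace_neg by blast

lemma cinner_eqI:
  assumes "inner x y = inner x' y'" "inner (\<i> *\<^sub>C x) y = inner (\<i> *\<^sub>C x') y'"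
  shows "cinner x y = cinner x' y'"
  using assms by (simp add: cinner_conv_inner)

text \<open>
  Graphs of complex linear operators are invariant under multiplication by the imaginary unit,
  which recovers the imaginary part of the sesquilinear form from the real part.
\<close>

lemma adjoint_op_iff:
  assumes "csubspace T"
  shows "(g, h) \<in> adjoint_op K T \<longleftrightarrow> g \<in> K \<and> h \<in> K \<and> (\<forall>(f, Tf) \<in> T. inner Tf g = inner f h)"
proof
  assume "(g, h) \<in> adjoint_op K T"
  then show "g \<in> K \<and> h \<in> K \<and> (\<forall>(f, Tf) \<in> T. inner Tf g = inner f h)"
    by (auto simp: adjoint_op_def inner_eq_Re_cinner)
next
  assume *: "g \<in> K \<and> h \<in> K \<and> (\<forall>(f, Tf) \<in> T. inner Tf g = inner f h)"
  have "cinner Tf g = cinner f h" if "(f, Tf) \<in> T" for f Tf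
  proof (rule cinner_eqI)
    have "\<i> *\<^sub>C (f, Tf) \<in> T"
      using assms that unfolding csubspace_def by blast
    then have "(\<i> *\<^sub>C f, \<i> *\<^sub>C Tf) \<in> T"
      by (simp add: scaleC_prod_def)
    then show "inner (\<i> *\<^sub>C Tf) g = inner (\<i> *\<^sub>C f) h"
      using * by blast
  qed (use * that in blast)
  then show "(g, h) \<in> adjoint_op K T"
    using * by (auto simp: adjoint_op_def)
qed

lemma graph_add: "csubspace T \<Longrightarrow> (f, f') \<in> T \<Longrightarrow> (g, g') \<in> T \<Longrightarrow> (f + g, f' + g') \<in> T"
  unfolding csubspace_def by (metis add_Pair)

lemma graph_scaleC: "csubspace T \<Longrightarrow> (f, f') \<in> T \<Longrightarrow> (c *\<^sub>C f, c *\<^sub>C f') \<in> T"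
  unfolding csubspace_def by (metis fst_conv scaleC_prod_def snd_conv)

lemma graph_scaleR: "csubspace T \<Longrightarrow> (f, f') \<in> T \<Longrightarrow> (r *\<^sub>R f, r *\<^sub>R f') \<in> T"
  using graph_scaleC[of T f f' "complex_of_real r"] by (simp add: scaleC_of_real)

lemma graph_diff: "csubspace T \<Longrightarrow> (f, f') \<in> T \<Longrightarrow> (g, g') \<in> T \<Longrightarrow> (f - g, f' - g') \<in> T"
  using graph_add[of T f f' "- g" "- g'"] graph_scaleR[of T g g' "-1"] by simp

section \<open>Selfadjoint operators\<close>

lemma selfadjoint_csubspace: "selfadjoint_op K T \<Longrightarrow> csubspace T"
  by (simp add: selfadjoint_op_def linear_op_def)

lemma selfadjoint_symmetric:
  assumes "selfadjoint_op K T" "(f, f') \<in> T" "(g, g') \<in> T"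
  shows "inner f' g = inner f g'"
proof -
  have "(g, g') \<in> adjoint_op K T"
    using assms by (simp add: selfadjoint_op_def)
  then show ?thesis
    using assms by (auto simp: adjoint_op_iff selfadjoint_csubspace)
qed

lemma selfadjointI:
  assumes "selfadjoint_op UNIV T" "\<And>f f'. (f, f') \<in> T \<Longrightarrow> inner f' g = inner f h"
  shows "(g, h) \<in> T"
proof -
  have "(g, h) \<in> adjoint_op UNIV T"
    using assms by (auto simp: adjoint_op_iff selfadjoint_csubspace)
  then show ?thesis
    using assms by (simp add: selfadjoint_op_def)
qed

lemma selfadjoint_closed:
  assumes T: "selfadjoint_op UNIV T" and lim: "F \<longlonglongrightarrow> f" "G \<longlonglongrightarrow> g" and FG: "\<And>n. (F n, G n) \<in> T"
  shows "(f, g) \<in> T"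
proof (rule selfadjointI[OF T])
  fix u u'
  assume u: "(u, u') \<in> T"
  have "inner u' (F n) = inner u (G n)" for n
    using selfadjoint_symmetric[OF T u FG] .
  moreover have "(\<lambda>n. inner u' (F n)) \<longlonglongrightarrow> inner u' f" "(\<lambda>n. inner u (G n)) \<longlonglongrightarrow> inner u g"
    by (intro tendsto_intros lim)+
  ultimately show "inner u' f = inner u g"
    using LIMSEQ_unique by simp
qed

lemma inner_i_scaleC_self: "inner x (\<i> *\<^sub>C x) = 0"
proof -
  have "Im (cinner x x) = 0"
    using cinner_commute[of x x] by (metis Reals_cnj_iff complex_is_Real_iff)
  then show ?thesis
    by (simp add: Im_cinner inner_commute)
qed

text \<open>
  \<open>\<parallel>(T - \<i>) f\<parallel>\<^sup>2 = \<parallel>T f\<parallel>\<^sup>2 + \<parallel>f\<parallel>\<^sup>2\<close> makes the range of \<open>T - \<i>\<close> closed, and a vector orthogonal to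
  it would be an eigenvector of \<open>T\<close> for \<open>- \<i>\<close>, which the same identity excludes.
\<close>

lemma range_selfadjoint_minus_i:
  fixes T :: "'h::chilbert_space rel"
  assumes T: "selfadjoint_op UNIV T"
  shows "\<exists>f f'. (f, f') \<in> T \<and> f' - \<i> *\<^sub>C f = y"
proof -
  note cs = selfadjoint_csubspace[OF T]
  define M where "M = {f' - \<i> *\<^sub>C f | f f'. (f, f') \<in> T}"
  have nrm: "(norm (f' - \<i> *\<^sub>C f))\<^sup>2 = (norm f')\<^sup>2 + (norm f)\<^sup>2" if "(f, f') \<in> T" for f f'
  proof -
    have "inner f' (\<i> *\<^sub>C f) = inner f (\<i> *\<^sub>C f')"
      using selfadjoint_symmetric[OF T that graph_scaleC[OF cs that]] .
    moreover have "inner f (\<i> *\<^sub>C f') = - inner f' (\<i> *\<^sub>C f)"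
      by (metis complex_cnj_i inner_commute inner_minus_right inner_scaleC_left scaleC_minus_left)
    ultimately have "inner f' (\<i> *\<^sub>C f) = 0"
      by simp
    then have "(norm (f' - \<i> *\<^sub>C f))\<^sup>2 = (norm f')\<^sup>2 + (norm (\<i> *\<^sub>C f))\<^sup>2"
      by (simp add: power2_norm_eq_inner inner_diff_left inner_diff_right inner_commute)
    then show ?thesis
      by (simp add: norm_scaleC)
  qed
  have sub: "subspace M"
  proof (rule subspaceI)
    show "0 \<in> M"
      using subspace_0[OF csubspace_imp_subspace[OF cs]]
      by (auto simp: M_def zero_prod_def intro!: exI[of _ 0])
    fix x y
    assume "x \<in> M" "y \<in> M"
    then obtain f f' g g' where f: "(f, f') \<in> T" "(g, g') \<in> T" "x = f' - \<i> *\<^sub>C f" "y = g' - \<i> *\<^sub>C g"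
      by (auto simp: M_def)
    then have "x + y = (f' + g') - \<i> *\<^sub>C (f + g)"
      by (simp add: scaleC_add_right)
    then show "x + y \<in> M"
      using graph_add[OF cs f(1,2)] unfolding M_def by blast
  next
    fix c x
    assume "x \<in> M"
    then obtain f f' where f: "(f, f') \<in> T" "x = f' - \<i> *\<^sub>C f"
      by (auto simp: M_def)
    then have "c *\<^sub>R x = c *\<^sub>R f' - \<i> *\<^sub>C (c *\<^sub>R f)"
      by (simp add: scaleC_scaleR_commute scaleR_diff_right)
    then show "c *\<^sub>R x \<in> M"
      using graph_scaleR[OF cs f(1)] unfolding M_def by blast
  qed
  have "complete M"
    unfolding complete_def
  proof (intro allI impI, elim conjE)
    fix Y :: "nat \<Rightarrow> 'h"
    assume Y: "\<forall>n. Y n \<in> M" "Cauchy Y"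
    then obtain F G where FG: "\<And>n. (F n, G n) \<in> T" "\<And>n. Y n = G n - \<i> *\<^sub>C F n"
      unfolding M_def mem_Collect_eq by metis
    have le: "norm (F m - F n) \<le> norm (Y m - Y n)" for m n
    proof (rule power2_le_imp_le)
      have "Y m - Y n = (G m - G n) - \<i> *\<^sub>C (F m - F n)"
        by (simp add: FG(2) scaleC_diff_right)
      then show "(norm (F m - F n))\<^sup>2 \<le> (norm (Y m - Y n))\<^sup>2"
        using nrm[OF graph_diff[OF cs FG(1) FG(1)], of m n] by simp
    qed simp
    have "Cauchy F"
      unfolding Cauchy_def
    proof (intro allI impI)
      fix e :: real
      assume "e > 0"
      then obtain N where "\<forall>m\<ge>N. \<forall>n\<ge>N. dist (Y m) (Y n) < e"
        using Y(2) unfolding Cauchy_def by blast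
      then show "\<exists>N. \<forall>m\<ge>N. \<forall>n\<ge>N. dist (F m) (F n) < e"
        using le by (metis dist_norm le_less_trans)
    qed
    then obtain f where f: "F \<longlonglongrightarrow> f"
      using Cauchy_convergent convergent_def by blast
    obtain y where y: "Y \<longlonglongrightarrow> y"
      using Y(2) Cauchy_convergent convergent_def by blast
    have "(\<lambda>n. Y n + \<i> *\<^sub>C F n) \<longlonglongrightarrow> y + \<i> *\<^sub>C f"
      by (intro tendsto_intros y bounded_linear.tendsto[OF bounded_linear_scaleC] f)
    then have "G \<longlonglongrightarrow> y + \<i> *\<^sub>C f"
      by (simp add: FG(2))
    then have "(f, y + \<i> *\<^sub>C f) \<in> T"
      using selfadjoint_closed[OF T f _ FG(1)] by blast
    then have "y \<in> M"
      by (force simp: M_def)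
    then show "\<exists>l\<in>M. Y \<longlonglongrightarrow> l"
      using y by blast
  qed
  then obtain z where z: "z \<in> M" "\<And>m. m \<in> M \<Longrightarrow> inner m (y - z) = 0"
    using orthogonal_decomposition sub by blast
  \<comment> \<open>The part of \<open>y\<close> orthogonal to the range is an eigenvector for \<open>- \<i>\<close>.\<close>
  have "(y - z, - \<i> *\<^sub>C (y - z)) \<in> T"
  proof (rule selfadjointI[OF T])
    fix f f'
    assume "(f, f') \<in> T"
    then have "inner (f' - \<i> *\<^sub>C f) (y - z) = 0"
      using z(2) by (auto simp: M_def)
    then show "inner f' (y - z) = inner f (- \<i> *\<^sub>C (y - z))"
      by (simp add: inner_diff_left inner_scaleC_left[of \<i>])
  qed
  then have "(norm (- \<i> *\<^sub>C (y - z) - \<i> *\<^sub>C (y - z)))\<^sup>2 = 2 * (norm (y - z))\<^sup>2"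
    using nrm by (fastforce simp: norm_scaleC scaleC_minus_left)
  moreover have "- \<i> *\<^sub>C (y - z) - \<i> *\<^sub>C (y - z) = (- 2 * \<i>) *\<^sub>C (y - z)"
    using scaleC_add_left[of "- \<i>" "- \<i>" "y - z"] by (simp add: scaleC_minus_left)
  ultimately have "norm (y - z) = 0"
    by (simp add: norm_scaleC norm_mult power_mult_distrib)
  then show ?thesis
    using z(1) by (auto simp: M_def)
qed

text \<open>
  The domain of the square is large: a vector \<open>y\<close> of the domain of \<open>T\<close> has the form
  \<open>T f - \<i> f\<close>, and then \<open>T f = y + \<i> f\<close> is again in the domain, hence zero by hypothesis. So \<open>T\<close>
  vanishes on its domain, and being selfadjoint it is the zero operator on the whole space.
\<close>

lemma selfadjoint_trivial:
  fixes T :: "'h::chilbert_space rel"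
  assumes T: "selfadjoint_op UNIV T"
    and triv: "\<And>f g g'. (f, g) \<in> T \<Longrightarrow> (g, g') \<in> T \<Longrightarrow> g = 0"
  shows "(f, 0) \<in> T"
proof -
  note cs = selfadjoint_csubspace[OF T]
  have zero: "y' = 0" if y: "(y, y') \<in> T" for y y'
  proof -
    obtain f f' where f: "(f, f') \<in> T" "f' - \<i> *\<^sub>C f = y"
      using range_selfadjoint_minus_i[OF T] by blast
    have "(y + \<i> *\<^sub>C f, y' + \<i> *\<^sub>C f') \<in> T"
      using graph_add[OF cs y graph_scaleC[OF cs f(1)]] .
    moreover have "y + \<i> *\<^sub>C f = f'"
      using f(2) by auto
    ultimately have "f' = 0"
      using triv f(1) by metis
    then have "(\<i> *\<^sub>C y, 0) \<in> T" "y = - (\<i> *\<^sub>C f)"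
      using graph_scaleC[OF cs f(1), of 1] f(2) by (auto simp: scaleC_scaleC scaleC_minus_right scaleC_minus1)
    then have "(- \<i> *\<^sub>C \<i> *\<^sub>C y, 0) \<in> T"
      using graph_scaleC[OF cs, of "\<i> *\<^sub>C y" 0 "- \<i>"] by simp
    then have "(y, 0) \<in> T"
      by (simp add: scaleC_scaleC)
    then show ?thesis
      using T y unfolding selfadjoint_op_def linear_op_def single_valued_def by blast
  qed
  show ?thesis
    by (rule selfadjointI[OF T]) (use zero in fastforce)
qed

section \<open>Representatives of square integrable functions\<close>

lemma L2_rel_rep: "L2_rel (rep_L2 f) (rep_L2 f)"
  by (rule Quotient3_rep_reflp[OF Quotient3_L2])

lemma square_integrable_rep: "square_integrable (rep_L2 f)"
  using L2_rel_rep by (simp add: L2_rel_def)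

lemma borel_measurable_rep [measurable]: "rep_L2 f \<in> borel_measurable borel"
  using square_integrable_rep[of f] by (simp add: square_integrable_def)

lemma abs_rep_L2: "abs_L2 (rep_L2 f) = f"
  by (rule Quotient3_abs_rep[OF Quotient3_L2])

lemma rep_abs_L2:
  assumes "square_integrable f"
  shows "AE t in lborel. rep_L2 (abs_L2 f) t = f t"
proof -
  have "L2_rel f f"
    using assms by (simp add: L2_rel_def)
  then have "L2_rel (rep_L2 (abs_L2 f)) f"
    by (rule rep_abs_rsp_left[OF Quotient3_L2])
  then show ?thesis
    by (simp add: L2_rel_def)
qed

lemma L2_eqI:
  assumes "AE t in lborel. rep_L2 f t = rep_L2 g t"
  shows "f = g"
proof -
  have "L2_rel (rep_L2 f) (rep_L2 g)"
    using assms by (simp add: L2_rel_def square_integrable_rep)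
  then have "abs_L2 (rep_L2 f) = abs_L2 (rep_L2 g)"
    by (rule Quotient3_rel_abs[OF Quotient3_L2])
  then show ?thesis
    by (simp add: abs_rep_L2)
qed

lemma rep_zero_L2: "AE t in lborel. rep_L2 0 t = 0"
  unfolding zero_L2_def by (rule rep_abs_L2) (rule square_integrable_0)

lemma rep_add_L2: "AE t in lborel. rep_L2 (f + g) t = rep_L2 f t + rep_L2 g t"
  unfolding plus_L2_def map_fun_apply
  by (rule rep_abs_L2) (intro square_integrable_add square_integrable_rep)

lemma rep_scaleR_L2: "AE t in lborel. rep_L2 (c *\<^sub>R f) t = c *\<^sub>R rep_L2 f t"
  unfolding scaleR_L2_def map_fun_apply id_apply
  by (rule rep_abs_L2) (intro square_integrable_bounded_linear[OF bounded_linear_scaleR_right] square_integrable_rep)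

lemma rep_scaleC_L2: "AE t in lborel. rep_L2 (c *\<^sub>C f) t = c *\<^sub>C rep_L2 f t"
  unfolding scaleC_L2_def map_fun_apply id_apply
  by (rule rep_abs_L2) (intro square_integrable_bounded_linear[OF bounded_linear_scaleC] square_integrable_rep)

lemma rep_uminus_L2: "AE t in lborel. rep_L2 (- f) t = - rep_L2 f t"
  using rep_scaleR_L2[of "-1" f] by simp

lemma rep_diff_L2: "AE t in lborel. rep_L2 (f - g) t = rep_L2 f t - rep_L2 g t"
proof -
  have "AE t in lborel. rep_L2 (f + - g) t = rep_L2 f t - rep_L2 g t"
    using rep_add_L2[of f "- g"] rep_uminus_L2[of g] by eventually_elim simp
  then show ?thesis
    by simp
qed

lemma inner_L2_integral: "inner f g = (\<integral>t. inner (rep_L2 f t) (rep_L2 g t) \<partial>lborel)"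
  by (simp add: inner_L2_def)

lemma integrable_inner_rep: "integrable lborel (\<lambda>t. inner (rep_L2 f t) (rep_L2 g t))"
  by (intro integrable_inner_L2 square_integrable_rep)

lemma norm_L2_integral: "(norm f)\<^sup>2 = (\<integral>t. (norm (rep_L2 f t))\<^sup>2 \<partial>lborel)"
  by (simp add: power2_norm_eq_inner inner_L2_integral)

lemma integrable_norm_rep: "integrable lborel (\<lambda>t. (norm (rep_L2 f t))\<^sup>2)"
  using square_integrable_rep[of f] by (simp add: square_integrable_def)

lemma inner_L2_nonneg:
  assumes "AE t in lborel. 0 \<le> inner (rep_L2 f t) (rep_L2 g t)"
  shows "0 \<le> inner f g"
  unfolding inner_L2_integral by (rule integral_nonneg_AE[OF assms])

lemma inner_L2_cong:
  assumes "AE t in lborel. inner (rep_L2 f t) (rep_L2 g t) = inner (rep_L2 f' t) (rep_L2 g' t)"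
  shows "inner f g = inner f' g'"
  unfolding inner_L2_integral by (rule integral_cong_AE) (use assms in auto)

section \<open>Completeness\<close>

lemma nn_integral_norm_rep:
  "(\<integral>\<^sup>+t. ennreal ((norm (rep_L2 f t))\<^sup>2) \<partial>lborel) = ennreal ((norm f)\<^sup>2)"
  by (subst nn_integral_eq_integral) (auto simp: integrable_norm_rep norm_L2_integral)

text \<open>
  By \<open>2 d \<le> r + d\<^sup>2 / r\<close> with weights \<open>r = 2 ^ - n\<close>, quadratic convergence of the integrals
  turns into pointwise summability of the increments.
\<close>

lemma AE_convergent_if_fast:
  fixes Z :: "nat \<Rightarrow> 'a::{real_inner, banach, second_countable_topology} L2"
  assumes fast: "\<And>n. norm (Z (Suc n) - Z n) \<le> (1/2) ^ n"
  shows "AE t in lborel. convergent (\<lambda>n. rep_L2 (Z n) t)"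
proof -
  define D where "D n t = norm (rep_L2 (Z (Suc n) - Z n) t)" for n t
  have [measurable]: "D n \<in> borel_measurable borel" for n
    unfolding D_def by measurable
  have "(\<integral>\<^sup>+t. (\<Sum>n. ennreal (2 ^ n * (D n t)\<^sup>2)) \<partial>lborel)
      = (\<Sum>n. \<integral>\<^sup>+t. ennreal (2 ^ n * (D n t)\<^sup>2) \<partial>lborel)"
    by (rule nn_integral_suminf) measurable
  also have "\<dots> = (\<Sum>n. ennreal (2 ^ n) * ennreal ((norm (Z (Suc n) - Z n))\<^sup>2))"
    by (simp add: ennreal_mult nn_integral_cmult D_def nn_integral_norm_rep)
  also have "\<dots> \<le> (\<Sum>n. ennreal ((1/2) ^ n))"
  proof (rule suminf_le)
    fix n
    have "2 ^ n * (norm (Z (Suc n) - Z n))\<^sup>2 \<le> 2 ^ n * ((1/2) ^ n)\<^sup>2"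
      using fast[of n] by (intro mult_left_mono power_mono) auto
    also have "\<dots> = (1/2 :: real) ^ n"
      by (simp add: power2_eq_square power_divide)
    finally show "ennreal (2 ^ n) * ennreal ((norm (Z (Suc n) - Z n))\<^sup>2) \<le> ennreal ((1/2) ^ n)"
      by (simp add: ennreal_leI flip: ennreal_mult)
  qed auto
  also have "\<dots> = ennreal (\<Sum>n. (1/2) ^ n)"
    by (intro suminf_ennreal2) (auto intro: summable_geometric)
  also have "\<dots> < \<infinity>"
    by simp
  finally have "AE t in lborel. (\<Sum>n. ennreal (2 ^ n * (D n t)\<^sup>2)) \<noteq> \<infinity>"
    by (intro nn_integral_PInf_AE) auto
  moreover have "AE t in lborel. \<forall>n. rep_L2 (Z (Suc n) - Z n) t = rep_L2 (Z (Suc n)) t - rep_L2 (Z n) t"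
    unfolding AE_all_countable using rep_diff_L2 by blast
  ultimately show ?thesis
  proof eventually_elim
    case (elim t)
    have s: "summable (\<lambda>n. 2 ^ n * (D n t)\<^sup>2)"
      using elim(1) by (intro summable_suminf_not_top) (auto simp: infinity_ennreal_def)
    have "summable (\<lambda>n. (1/2) ^ n + 2 ^ n * (D n t)\<^sup>2)"
      by (intro summable_add s summable_geometric) auto
    then have "summable (\<lambda>n. rep_L2 (Z (Suc n)) t - rep_L2 (Z n) t)"
    proof (rule summable_comparison_test')
      fix n
      let ?d = "D n t"
      have "0 \<le> (?d * 2 ^ n - 1)\<^sup>2 * (1/2) ^ n"
        by simp
      also have "\<dots> = 2 ^ n * ?d\<^sup>2 - 2 * ?d + (1/2) ^ n"
        by (simp add: power2_eq_square power_divide field_simps)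
      finally have "?d \<le> (1/2) ^ n + 2 ^ n * ?d\<^sup>2"
        using norm_ge_zero[of "rep_L2 (Z (Suc n) - Z n) t"] unfolding D_def by linarith
      then show "norm (rep_L2 (Z (Suc n)) t - rep_L2 (Z n) t) \<le> (1/2) ^ n + 2 ^ n * ?d\<^sup>2"
        using elim(2) by (simp add: D_def)
    qed
    then have "(\<lambda>n. \<Sum>k<n. rep_L2 (Z (Suc k)) t - rep_L2 (Z k) t)
        \<longlonglongrightarrow> (\<Sum>k. rep_L2 (Z (Suc k)) t - rep_L2 (Z k) t)"
      by (rule summable_LIMSEQ)
    then have "(\<lambda>n. rep_L2 (Z n) t - rep_L2 (Z 0) t)
        \<longlonglongrightarrow> (\<Sum>k. rep_L2 (Z (Suc k)) t - rep_L2 (Z k) t)"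
      by (simp add: sum_lessThan_telescope[of "\<lambda>n. rep_L2 (Z n) t"])
    from tendsto_add[OF this tendsto_const[of "rep_L2 (Z 0) t"]] show ?case
      by (auto simp: convergent_def)
  qed
qed

instance L2 :: ("{real_inner, banach, second_countable_topology}") banach
proof
  fix X :: "nat \<Rightarrow> 'a L2"
  assume X: "Cauchy X"
  \<comment> \<open>A subsequence with rapidly decreasing increments converges almost everywhere.\<close>
  have "\<exists>N. \<forall>m\<ge>N. \<forall>n\<ge>N. dist (X m) (X n) < (1/2) ^ k" for k
    using X unfolding Cauchy_def by simp
  then obtain N where N: "\<And>k m n. m \<ge> N k \<Longrightarrow> n \<ge> N k \<Longrightarrow> dist (X m) (X n) < (1/2) ^ k"
    by metis
  define r where "r k = (\<Sum>i\<le>k. N i) + k" for k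
  have rN: "N k \<le> r k" "k \<le> r k" "r k \<le> r (Suc k)" for k
    by (auto simp: r_def intro: order_trans[OF member_le_sum[of k "{..k}" N]])
  define Z where "Z k = X (r k)" for k
  have "norm (Z (Suc k) - Z k) \<le> (1/2) ^ k" for k
    using N[of k "r (Suc k)" "r k"] rN(1,3)[of k] by (simp add: Z_def dist_norm)
  then have conv: "AE t in lborel. convergent (\<lambda>n. rep_L2 (Z n) t)"
    by (rule AE_convergent_if_fast)
  define f where "f t = lim (\<lambda>n. rep_L2 (Z n) t)" for t
  have [measurable]: "f \<in> borel_measurable borel"
    unfolding f_def by measurable
  have flim: "AE t in lborel. (\<lambda>n. rep_L2 (Z n) t) \<longlonglongrightarrow> f t"
    using conv by eventually_elim (simp add: f_def convergent_LIMSEQ_iff)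
  \<comment> \<open>Fatou's lemma gives both the integrability of the limit and the convergence.\<close>
  have fatou: "(\<integral>\<^sup>+t. ennreal ((norm (f t - rep_L2 (X m) t))\<^sup>2) \<partial>lborel) \<le> ennreal (((1/2) ^ k)\<^sup>2)"
    if m: "m \<ge> N k" for k m
  proof -
    have "(\<integral>\<^sup>+t. ennreal ((norm (f t - rep_L2 (X m) t))\<^sup>2) \<partial>lborel)
        = (\<integral>\<^sup>+t. liminf (\<lambda>n. ennreal ((norm (rep_L2 (Z n - X m) t))\<^sup>2)) \<partial>lborel)"
    proof (rule nn_integral_cong_AE)
      have "AE t in lborel. \<forall>n. rep_L2 (Z n - X m) t = rep_L2 (Z n) t - rep_L2 (X m) t"
        unfolding AE_all_countable using rep_diff_L2 by blast
      then show "AE t in lborel. ennreal ((norm (f t - rep_L2 (X m) t))\<^sup>2)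
          = liminf (\<lambda>n. ennreal ((norm (rep_L2 (Z n - X m) t))\<^sup>2))"
        using flim
      proof eventually_elim
        case (elim t)
        then have "(\<lambda>n. ennreal ((norm (rep_L2 (Z n - X m) t))\<^sup>2))
            \<longlonglongrightarrow> ennreal ((norm (f t - rep_L2 (X m) t))\<^sup>2)"
          by (auto intro!: tendsto_intros)
        then show ?case
          by (intro lim_imp_Liminf[symmetric]) auto
      qed
    qed
    also have "\<dots> \<le> liminf (\<lambda>n. \<integral>\<^sup>+t. ennreal ((norm (rep_L2 (Z n - X m) t))\<^sup>2) \<partial>lborel)"
      by (rule nn_integral_liminf) measurable
    also have "\<dots> = liminf (\<lambda>n. ennreal ((norm (Z n - X m))\<^sup>2))"
      by (simp add: nn_integral_norm_rep)
    also have "\<dots> \<le> ennreal (((1/2) ^ k)\<^sup>2)"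
    proof (rule Liminf_le)
      show "\<forall>\<^sub>F n in sequentially. ennreal ((norm (Z n - X m))\<^sup>2) \<le> ennreal (((1/2) ^ k)\<^sup>2)"
        using eventually_ge_at_top[of "N k"]
      proof eventually_elim
        case (elim n)
        then have "norm (Z n - X m) \<le> (1/2) ^ k"
          using N[of k "r n" m] rN(2)[of n] m by (simp add: Z_def dist_norm)
        then show ?case
          by (intro ennreal_leI power_mono) auto
      qed
    qed simp
    finally show ?thesis .
  qed
  have sq: "square_integrable (\<lambda>t. f t - rep_L2 (X m) t)" if "m \<ge> N k" for k m
    unfolding square_integrable_def
    using le_less_trans[OF fatou[OF that]] by (auto intro!: integrableI_bounded)
  have sqf: "square_integrable f"
    using square_integrable_add[OF sq[OF order_refl, of 0] square_integrable_rep[of "X (N 0)"]] by simp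
  have "X \<longlonglongrightarrow> abs_L2 f"
  proof (rule LIMSEQ_I)
    fix e :: real
    assume "e > 0"
    then obtain k where k: "(1/2) ^ k < e"
      using real_arch_pow_inv[of e "1/2"] by auto
    have "norm (X m - abs_L2 f) < e" if m: "m \<ge> N k" for m
    proof -
      have "ennreal ((norm (abs_L2 f - X m))\<^sup>2)
          = (\<integral>\<^sup>+t. ennreal ((norm (rep_L2 (abs_L2 f - X m) t))\<^sup>2) \<partial>lborel)"
        by (simp add: nn_integral_norm_rep)
      also have "\<dots> = (\<integral>\<^sup>+t. ennreal ((norm (f t - rep_L2 (X m) t))\<^sup>2) \<partial>lborel)"
        by (rule nn_integral_cong_AE)
          (use rep_diff_L2[of "abs_L2 f" "X m"] rep_abs_L2[OF sqf] in eventually_elim, simp)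
      also have "\<dots> \<le> ennreal (((1/2) ^ k)\<^sup>2)"
        by (rule fatou[OF m])
      finally have "(norm (abs_L2 f - X m))\<^sup>2 \<le> ((1/2) ^ k)\<^sup>2"
        by (simp add: ennreal_le_iff)
      then have "norm (abs_L2 f - X m) \<le> (1/2) ^ k"
        by (rule power2_le_imp_le) simp
      then show ?thesis
        using k by (simp add: norm_minus_commute)
    qed
    then show "\<exists>n0. \<forall>n\<ge>n0. norm (X n - abs_L2 f) < e"
      by blast
  qed
  then show "convergent X"
    by (rule convergentI)
qed

section \<open>Restriction, translation and elementary tensors\<close>

definition restrict_L2 :: "real set \<Rightarrow> 'h::{real_inner, second_countable_topology} L2 \<Rightarrow> 'h L2" where
  "restrict_L2 S f = abs_L2 (\<lambda>t. indicator S t *\<^sub>R rep_L2 f t)"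

definition shift_L2 :: "real \<Rightarrow> 'h::{real_inner, second_countable_topology} L2 \<Rightarrow> 'h L2" where
  "shift_L2 h f = abs_L2 (\<lambda>t. rep_L2 f (t + h))"

definition tensor_L2 :: "(real \<Rightarrow> real) \<Rightarrow> 'h \<Rightarrow> 'h::{real_inner, second_countable_topology} L2" where
  "tensor_L2 \<psi> g = abs_L2 (\<lambda>t. \<psi> t *\<^sub>R g)"

lemma mem_L2_on: "f \<in> L2_on S \<longleftrightarrow> (AE t in lborel. t \<notin> S \<longrightarrow> rep_L2 f t = 0)"
  by (simp add: L2_on_def vanishes_outside_def)

lemma AE_translate:
  assumes "AE t in lborel. P (t::real)"
  shows "AE t in lborel. P (t + h)"
proof -
  obtain N where N: "N \<in> null_sets lborel" "{t. \<not> P t} \<subseteq> N"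
    using assms by (auto simp: eventually_ae_filter)
  have "AE t in lborel. t \<notin> N"
    using N(1) by (rule AE_not_in)
  then have "AE t in lborel. h + 1 * t \<notin> N"
    by (intro AE_borel_affine[where P = "\<lambda>t. t \<notin> N" and c = 1 and t = h]) (use N(1) in auto)
  then show ?thesis
    by eventually_elim (use N(2) in \<open>auto simp: add.commute\<close>)
qed

lemma integral_translate:
  fixes f :: "real \<Rightarrow> 'a::{banach, second_countable_topology}"
  shows "(\<integral>t. f (t + h) \<partial>lborel) = (\<integral>t. f t \<partial>lborel)"
  using lborel_integral_real_affine[of 1 f h] by (simp add: add.commute)

lemma square_integrable_translate:
  fixes f :: "real \<Rightarrow> 'h::{real_inner, second_countable_topology}"
  assumes "square_integrable f"
  shows "square_integrable (\<lambda>t. f (t + h))"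
proof -
  have "integrable lborel (\<lambda>t. (norm (f (h + 1 * t)))\<^sup>2)"
    using assms by (intro lborel_integrable_real_affine) (auto simp: square_integrable_def)
  moreover have [measurable]: "f \<in> borel_measurable borel"
    using assms by (simp add: square_integrable_def)
  have "(\<lambda>t. f (t + h)) \<in> borel_measurable borel"
    by measurable
  ultimately show ?thesis
    by (simp add: square_integrable_def add.commute)
qed

lemma rep_restrict_L2:
  assumes [measurable]: "S \<in> sets borel"
  shows "AE t in lborel. rep_L2 (restrict_L2 S f) t = indicator S t *\<^sub>R rep_L2 f t"
  unfolding restrict_L2_def
  by (rule rep_abs_L2, rule square_integrable_bounded_by[where C = 1 and f = "rep_L2 f" and g = "rep_L2 f"])
    (auto simp: square_integrable_rep indicator_def)

lemma rep_shift_L2: "AE t in lborel. rep_L2 (shift_L2 h f) t = rep_L2 f (t + h)"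
  unfolding shift_L2_def by (intro rep_abs_L2 square_integrable_translate square_integrable_rep)

lemma rep_tensor_L2:
  assumes "square_integrable \<psi>"
  shows "AE t in lborel. rep_L2 (tensor_L2 \<psi> g) t = \<psi> t *\<^sub>R g"
  unfolding tensor_L2_def
  by (intro rep_abs_L2 square_integrable_bounded_linear[OF bounded_linear_scaleR_left] assms)

lemma inner_tensor_L2:
  assumes "square_integrable \<psi>"
  shows "inner (tensor_L2 \<psi> g) u = (\<integral>t. \<psi> t * inner g (rep_L2 u t) \<partial>lborel)"
  unfolding inner_L2_integral
proof (rule integral_cong_AE)
  show "AE t in lborel. inner (rep_L2 (tensor_L2 \<psi> g) t) (rep_L2 u t) = \<psi> t * inner g (rep_L2 u t)"
    using rep_tensor_L2[OF assms, of g] by eventually_elim simp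
qed (use assms in \<open>auto simp: square_integrable_def\<close>)

lemma inner_tensor_tensor_L2:
  assumes "square_integrable \<psi>" "square_integrable \<phi>"
  shows "inner (tensor_L2 \<psi> g) (tensor_L2 \<phi> f) = (\<integral>t. \<psi> t * \<phi> t \<partial>lborel) * inner g f"
proof -
  have "inner (tensor_L2 \<psi> g) (tensor_L2 \<phi> f) = (\<integral>t. (\<psi> t * \<phi> t) * inner g f \<partial>lborel)"
    unfolding inner_tensor_L2[OF assms(1)]
  proof (rule integral_cong_AE)
    show "AE t in lborel. \<psi> t * inner g (rep_L2 (tensor_L2 \<phi> f) t) = (\<psi> t * \<phi> t) * inner g f"
      using rep_tensor_L2[OF assms(2), of f] by eventually_elim simp
  qed (use assms in \<open>auto simp: square_integrable_def\<close>)
  then show ?thesis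
    by simp
qed

lemma integrable_mult_square_integrable:
  "square_integrable f \<Longrightarrow> square_integrable g \<Longrightarrow> integrable lborel (\<lambda>t. f t * (g t :: real))"
  using integrable_inner_L2[of f g] by simp

lemma square_integrable_inner_rep: "square_integrable (\<lambda>t. inner g (rep_L2 u t))"
  by (rule square_integrable_bounded_linear[OF bounded_linear_inner_right square_integrable_rep])

lemma scaleR_tensor_L2:
  assumes "square_integrable \<psi>"
  shows "r *\<^sub>R tensor_L2 \<psi> g = tensor_L2 \<psi> (r *\<^sub>R g)"
  by (rule L2_eqI, use rep_scaleR_L2[of r "tensor_L2 \<psi> g"] rep_tensor_L2[OF assms, of g]
      rep_tensor_L2[OF assms, of "r *\<^sub>R g"] in eventually_elim) (simp add: mult.commute)

lemma scaleC_tensor_L2: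
  assumes "square_integrable \<psi>"
  shows "c *\<^sub>C tensor_L2 \<psi> g = tensor_L2 \<psi> (c *\<^sub>C g)"
  by (rule L2_eqI, use rep_scaleC_L2[of c "tensor_L2 \<psi> g"] rep_tensor_L2[OF assms, of g]
      rep_tensor_L2[OF assms, of "c *\<^sub>C g"] in eventually_elim) (simp add: scaleC_scaleR_commute)

lemma shift_tensor_L2:
  assumes "square_integrable \<psi>"
  shows "shift_L2 h (tensor_L2 \<psi> g) = tensor_L2 (\<lambda>t. \<psi> (t + h)) g"
  by (rule L2_eqI, use rep_shift_L2[of h "tensor_L2 \<psi> g"] AE_translate[OF rep_tensor_L2[OF assms, of g], of h]
      rep_tensor_L2[OF square_integrable_translate[OF assms, of h], of g] in eventually_elim) simp

lemma inner_shift_L2: "inner (shift_L2 h f) g = inner f (shift_L2 (- h) g)"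
proof -
  have "inner (shift_L2 h f) g = (\<integral>t. inner (rep_L2 f (t + h)) (rep_L2 g t) \<partial>lborel)"
    unfolding inner_L2_integral
  proof (rule integral_cong_AE)
    show "AE t in lborel. inner (rep_L2 (shift_L2 h f) t) (rep_L2 g t) = inner (rep_L2 f (t + h)) (rep_L2 g t)"
      using rep_shift_L2[of h f] by eventually_elim simp
  qed auto
  also have "\<dots> = (\<integral>t. inner (rep_L2 f t) (rep_L2 g (t - h)) \<partial>lborel)"
    using integral_translate[of "\<lambda>t. inner (rep_L2 f t) (rep_L2 g (t - h))" h] by simp
  also have "\<dots> = inner f (shift_L2 (- h) g)"
    unfolding inner_L2_integral
  proof (rule integral_cong_AE)
    show "AE t in lborel. inner (rep_L2 f t) (rep_L2 g (t - h)) = inner (rep_L2 f t) (rep_L2 (shift_L2 (- h) g) t)"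
      using rep_shift_L2[of "- h" g] by eventually_elim simp
  qed auto
  finally show ?thesis .
qed

lemma shift_shift_L2: "shift_L2 h (shift_L2 k f) = shift_L2 (h + k) f"
  by (rule L2_eqI, use rep_shift_L2[of h "shift_L2 k f"] AE_translate[OF rep_shift_L2[of k f], of h]
      rep_shift_L2[of "h + k" f] in eventually_elim) (simp add: add.assoc)

lemma shift_0_L2 [simp]: "shift_L2 0 f = f"
  by (rule L2_eqI, use rep_shift_L2[of 0 f] in eventually_elim) simp

lemma norm_shift_L2 [simp]: "norm (shift_L2 h f) = norm f"
  by (simp add: norm_eq_sqrt_inner inner_shift_L2 shift_shift_L2)

lemma shift_add_L2: "shift_L2 h (f + g) = shift_L2 h f + shift_L2 h g"
  by (rule L2_eqI, use rep_shift_L2[of h "f + g"] AE_translate[OF rep_add_L2[of f g], of h]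
      rep_add_L2[of "shift_L2 h f" "shift_L2 h g"] rep_shift_L2[of h f] rep_shift_L2[of h g]
      in eventually_elim) simp

lemma shift_scaleR_L2: "shift_L2 h (r *\<^sub>R f) = r *\<^sub>R shift_L2 h f"
  by (rule L2_eqI, use rep_shift_L2[of h "r *\<^sub>R f"] AE_translate[OF rep_scaleR_L2[of r f], of h]
      rep_scaleR_L2[of r "shift_L2 h f"] rep_shift_L2[of h f] in eventually_elim) simp

lemma restrict_in_L2_on: "S \<in> sets borel \<Longrightarrow> restrict_L2 S f \<in> L2_on S"
  unfolding mem_L2_on by (drule rep_restrict_L2[of S f], erule eventually_mono) simp

lemma restrict_id_L2:
  assumes S: "S \<in> sets borel" and f: "f \<in> L2_on S"
  shows "restrict_L2 S f = f"
proof (rule L2_eqI)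
  show "AE t in lborel. rep_L2 (restrict_L2 S f) t = rep_L2 f t"
    using rep_restrict_L2[OF S, of f] f[unfolded mem_L2_on]
    by eventually_elim (auto simp: indicator_def)
qed

lemma inner_restrict_L2:
  assumes "S \<in> sets borel"
  shows "inner (restrict_L2 S f) g = inner f (restrict_L2 S g)"
  by (rule inner_L2_cong, use rep_restrict_L2[OF assms, of f] rep_restrict_L2[OF assms, of g] in eventually_elim) simp

lemma norm_restrict_L2:
  assumes [measurable]: "S \<in> sets borel"
  shows "(norm (restrict_L2 S f))\<^sup>2 = (\<integral>t. indicator S t * (norm (rep_L2 f t))\<^sup>2 \<partial>lborel)"
  unfolding norm_L2_integral
proof (rule integral_cong_AE)
  show "AE t in lborel. (norm (rep_L2 (restrict_L2 S f) t))\<^sup>2 = indicator S t * (norm (rep_L2 f t))\<^sup>2"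
    using rep_restrict_L2[OF assms, of f] by eventually_elim (simp add: indicator_def)
qed auto

lemma subspace_L2_on: "subspace (L2_on S :: 'h::{real_inner, second_countable_topology} L2 set)"
proof (rule subspaceI)
  fix f g :: "'h L2" and r
  assume f: "f \<in> L2_on S" and g: "g \<in> L2_on S"
  show "f + g \<in> L2_on S"
    unfolding mem_L2_on
    using rep_add_L2[of f g] f[unfolded mem_L2_on] g[unfolded mem_L2_on] by eventually_elim simp
next
  fix f :: "'h L2" and r
  assume f: "f \<in> L2_on S"
  show "r *\<^sub>R f \<in> L2_on S"
    unfolding mem_L2_on
    using rep_scaleR_L2[of r f] f[unfolded mem_L2_on] by eventually_elim simp
next
  show "(0 :: 'h L2) \<in> L2_on S"
    unfolding mem_L2_on using rep_zero_L2[where 'a = 'h] by eventually_elim simp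
qed

lemma csubspace_L2_on:
  "csubspace (L2_on S :: 'h::{complex_inner, second_countable_topology} L2 set)"
proof -
  have "c *\<^sub>C f \<in> L2_on S" if "f \<in> L2_on S" for c and f :: "'h L2"
    unfolding mem_L2_on
    using rep_scaleC_L2[of c f] that[unfolded mem_L2_on] by eventually_elim simp
  then show ?thesis
    using subspace_L2_on[of S, where 'h = 'h] by (simp add: csubspace_def subspace_def)
qed

lemma closed_L2_on:
  assumes [measurable]: "S \<in> sets borel"
  shows "closed (L2_on S :: 'h::{real_inner, second_countable_topology} L2 set)"
proof -
  have "f \<in> L2_on S \<longleftrightarrow> (\<forall>g. inner f (restrict_L2 (- S) g) = 0)" for f :: "'h L2"
  proof (intro iffI allI)
    fix g :: "'h L2"
    assume f: "f \<in> L2_on S"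
    have "AE t in lborel. inner (rep_L2 f t) (rep_L2 (restrict_L2 (- S) g) t) = 0"
      using rep_restrict_L2[OF borel_comp[OF assms], of g] f[unfolded mem_L2_on]
      by eventually_elim (auto simp: indicator_def)
    then show "inner f (restrict_L2 (- S) g) = 0"
      unfolding inner_L2_integral by (rule integral_eq_zero_AE)
  next
    assume "\<forall>g. inner f (restrict_L2 (- S) g) = 0"
    moreover have "inner (restrict_L2 (- S) f) (restrict_L2 (- S) f) = inner f (restrict_L2 (- S) f)"
      using inner_restrict_L2[of "- S" f "restrict_L2 (- S) f"]
        restrict_id_L2[OF _ restrict_in_L2_on, of "- S" f] by simp
    ultimately have zero: "restrict_L2 (- S) f = 0"
      by simp
    show "f \<in> L2_on S"
      unfolding mem_L2_on
      using rep_restrict_L2[OF borel_comp[OF assms], of f, unfolded zero] rep_zero_L2[where 'a = 'h]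
      by eventually_elim (auto simp: indicator_def)
  qed
  then have "L2_on S = (\<Inter>g. {f :: 'h L2. inner f (restrict_L2 (- S) g) = 0})"
    by blast
  moreover have "closed (\<Inter>g. {f :: 'h L2. inner f (restrict_L2 (- S) g) = 0})"
    by (intro closed_INT ballI closed_Collect_eq continuous_intros)
  ultimately show ?thesis
    by simp
qed

section \<open>Bump functions\<close>

text \<open>
  The functions \<open>exp (- e / x) / x ^ k\<close>, continued by zero to \<open>x \<le> 0\<close>. The powers of \<open>x\<close> are needed
  because they arise in the derivatives, and the parameter \<open>e\<close> because \<open>e \<rightarrow> 0\<close> turns the
  function with \<open>k = 0\<close> into the indicator of the positive half-line.
\<close>

definition flat :: "real \<Rightarrow> nat \<Rightarrow> real \<Rightarrow> real" where
  "flat e k x = (if x > 0 then exp (- e / x) / x ^ k else 0)"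

lemma flat_nonneg: "0 \<le> flat e k x"
  by (simp add: flat_def)

lemma tendsto_flat_at_right_0:
  assumes "e > 0"
  shows "(flat e k \<longlongrightarrow> 0) (at_right 0)"
proof -
  have "((\<lambda>y::real. y ^ k / exp y) \<longlongrightarrow> 0) at_top"
    by (rule tendsto_power_div_exp_0)
  moreover have "filterlim (\<lambda>x. e / x) at_top (at_right 0)"
    using assms by real_asymp
  ultimately have "((\<lambda>x. (e / x) ^ k / exp (e / x)) \<longlongrightarrow> 0) (at_right 0)"
    by (rule filterlim_compose)
  from tendsto_mult[OF tendsto_const[of "1 / e ^ k"] this]
  have "((\<lambda>x. 1 / e ^ k * ((e / x) ^ k / exp (e / x))) \<longlongrightarrow> 0) (at_right 0)"
    by simp
  then show ?thesis
  proof (rule Lim_transform_eventually)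
    show "\<forall>\<^sub>F x in at_right 0. 1 / e ^ k * ((e / x) ^ k / exp (e / x)) = flat e k x"
      using eventually_at_right_less[of 0]
      by eventually_elim (use assms in \<open>simp add: flat_def exp_minus field_simps\<close>)
  qed
qed

lemma DERIV_flat:
  assumes "e > 0"
  shows "(flat e k has_real_derivative (e * flat e (k + 2) x - real k * flat e (k + 1) x)) (at x)"
proof (cases x "0 :: real" rule: linorder_cases)
  case less
  have "((\<lambda>x. 0) has_real_derivative 0) (at x)"
    by simp
  then have "(flat e k has_real_derivative 0) (at x)"
    by (rule has_field_derivative_transform_within_open[of _ _ _ "{..<0}"]) (use less in \<open>auto simp: flat_def\<close>)
  then show ?thesis
    using less by (simp add: flat_def)
next
  case equal
  have "((\<lambda>y. flat e k y / y) \<longlongrightarrow> 0) (at 0)"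
    unfolding filterlim_at_split
  proof
    show "((\<lambda>y. flat e k y / y) \<longlongrightarrow> 0) (at_left 0)"
      by (rule tendsto_eventually) (auto simp: eventually_at_filter flat_def)
    have "\<forall>\<^sub>F y in at_right 0. flat e (k + 1) y = flat e k y / y"
      by (auto simp: eventually_at_filter flat_def)
    then show "((\<lambda>y. flat e k y / y) \<longlongrightarrow> 0) (at_right 0)"
      by (rule Lim_transform_eventually[OF tendsto_flat_at_right_0[OF assms, of "k + 1"]])
  qed
  then show ?thesis
    using equal by (simp add: has_field_derivative_iff flat_def)
next
  case greater
  have "((\<lambda>x. exp (- e / x) / x ^ k) has_real_derivative
      (e * flat e (k + 2) x - real k * flat e (k + 1) x)) (at x)"
  proof -
    have "x ^ (k - 1) = x * x ^ (k - 1 - 1) \<or> k - 1 = 0"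
      by (simp add: power_eq_if)
    then show ?thesis
      using greater
      by (cases k) (auto intro!: derivative_eq_intros simp: flat_def field_simps power2_eq_square)
  qed
  then show ?thesis
    by (rule has_field_derivative_transform_within_open[of _ _ _ "{0<..}"]) (use greater in \<open>auto simp: flat_def\<close>)
qed

definition bump :: "real \<Rightarrow> real \<Rightarrow> real \<Rightarrow> real \<Rightarrow> real" where
  "bump e c d t = flat e 0 (t - c) * flat e 0 (d - t)"

definition bump' :: "real \<Rightarrow> real \<Rightarrow> real \<Rightarrow> real \<Rightarrow> real" where
  "bump' e c d t = e * flat e 2 (t - c) * flat e 0 (d - t) - flat e 0 (t - c) * (e * flat e 2 (d - t))"

lemma DERIV_flat_shifted:
  assumes "e > 0"
  shows "((\<lambda>t. flat e k (t - c)) has_real_derivative (e * flat e (k + 2) (t - c) - real k * flat e (k + 1) (t - c))) (at t)"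
    and "((\<lambda>t. flat e k (d - t)) has_real_derivative - (e * flat e (k + 2) (d - t) - real k * flat e (k + 1) (d - t))) (at t)"
proof -
  have "((\<lambda>t. t - c) has_real_derivative 1) (at t)"
    by (auto intro!: derivative_eq_intros)
  from DERIV_chain'[OF this DERIV_flat[OF assms]]
  show "((\<lambda>t. flat e k (t - c)) has_real_derivative (e * flat e (k + 2) (t - c) - real k * flat e (k + 1) (t - c))) (at t)"
    by simp
  have "((\<lambda>t. d - t) has_real_derivative - 1) (at t)"
    by (auto intro!: derivative_eq_intros)
  from DERIV_chain'[OF this DERIV_flat[OF assms]]
  show "((\<lambda>t. flat e k (d - t)) has_real_derivative - (e * flat e (k + 2) (d - t) - real k * flat e (k + 1) (d - t))) (at t)"
    by simp
qed

lemma DERIV_bump: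
  assumes "e > 0"
  shows "(bump e c d has_real_derivative bump' e c d t) (at t)"
  unfolding bump_def[abs_def]
  by (rule DERIV_cong[OF DERIV_mult[OF DERIV_flat_shifted[OF assms]]])
    (simp add: bump'_def numeral_2_eq_2)

text \<open>
  Finite combinations of products of \<^const>\<open>flat\<close> functions are closed under differentiation;
  they contain the bump, which is therefore smooth.
\<close>

inductive_set bump_algebra :: "real \<Rightarrow> real \<Rightarrow> real \<Rightarrow> (real \<Rightarrow> complex) set" for e c d where
  base: "(\<lambda>t. complex_of_real (r * (flat e k (t - c) * flat e l (d - t)))) \<in> bump_algebra e c d"
| add: "f \<in> bump_algebra e c d \<Longrightarrow> g \<in> bump_algebra e c d \<Longrightarrow> (\<lambda>t. f t + g t) \<in> bump_algebra e c d"

lemma bump_algebra_derivative: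
  assumes "e > 0" "f \<in> bump_algebra e c d"
  shows "\<exists>f'\<in>bump_algebra e c d. \<forall>t. (f has_vector_derivative f' t) (at t)"
  using assms(2)
proof induction
  case (base r k l)
  let ?b = "\<lambda>r k l t. complex_of_real (r * (flat e k (t - c) * flat e l (d - t)))"
  let ?f' = "\<lambda>t. (?b (r * e) (k + 2) l t + ?b (- r * real k) (k + 1) l t)
      + (?b (- r * e) k (l + 2) t + ?b (r * real l) k (l + 1) t)"
  have "((\<lambda>t. r * (flat e k (t - c) * flat e l (d - t))) has_real_derivative Re (?f' t)) (at t)" for t
    by (rule DERIV_cong[OF DERIV_cmult[OF DERIV_mult[OF DERIV_flat_shifted[OF assms(1)]]]])
      (simp add: algebra_simps)
  then have "(?b r k l has_vector_derivative of_real (Re (?f' t))) (at t)" for t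
    by (intro has_vector_derivative_of_real) (simp add: has_real_derivative_iff_has_vector_derivative)
  then have "\<forall>t. (?b r k l has_vector_derivative ?f' t) (at t)"
    by (simp add: complex_eq_iff)
  moreover have "?f' \<in> bump_algebra e c d"
    by (intro bump_algebra.intros)
  ultimately show ?case
    by (intro bexI[of _ ?f'])
next
  case (add f g)
  then obtain f' g' where "f' \<in> bump_algebra e c d" "\<forall>t. (f has_vector_derivative f' t) (at t)"
      "g' \<in> bump_algebra e c d" "\<forall>t. (g has_vector_derivative g' t) (at t)"
    by blast
  then show ?case
    by (intro bexI[of _ "\<lambda>t. f' t + g' t"] allI has_vector_derivative_add bump_algebra.add) auto
qed

lemma smooth_bump:
  assumes "e > 0"
  shows "smooth (\<lambda>t. complex_of_real (bump e c d t))"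
proof -
  let ?D = "\<lambda>\<psi> s. vector_derivative \<psi> (at s) :: complex"
  have D: "?D f \<in> bump_algebra e c d" "f differentiable (at t)" if f: "f \<in> bump_algebra e c d" for f t
  proof -
    obtain f' where f': "f' \<in> bump_algebra e c d" "\<forall>t. (f has_vector_derivative f' t) (at t)"
      using bump_algebra_derivative[OF assms f] by blast
    then have "?D f = f'"
      by (auto intro: vector_derivative_at)
    then show "?D f \<in> bump_algebra e c d"
      using f' by simp
    show "f differentiable (at t)"
      using f' by (auto intro: differentiableI_vector)
  qed
  have "(?D ^^ n) (\<lambda>t. complex_of_real (bump e c d t)) \<in> bump_algebra e c d" for n
  proof (induction n)
    case 0
    show ?case
      using bump_algebra.base[where r = 1 and e = e and k = 0 and c = c and l = 0 and d = d]
      by (simp add: bump_def)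
  next
    case (Suc n)
    then show ?case
      using D(1) by simp
  qed
  then show ?thesis
    unfolding smooth_def using D by blast
qed

lemma bump_eq_0: "t \<notin> {c<..<d} \<Longrightarrow> bump e c d t = 0" "t \<notin> {c<..<d} \<Longrightarrow> bump' e c d t = 0"
  by (auto simp: bump_def bump'_def flat_def)

lemma bump_nonneg: "0 \<le> bump e c d t"
  by (simp add: bump_def flat_nonneg)

lemma bump_pos: "t \<in> {c<..<d} \<Longrightarrow> 0 < bump e c d t"
  by (simp add: bump_def flat_def)

lemma bump_le_1: "e > 0 \<Longrightarrow> bump e c d t \<le> 1"
  by (auto simp: bump_def flat_def intro!: mult_le_one)

lemma bump_test_function:
  assumes "e > 0" "{c..d} \<subseteq> S"
  shows "(\<lambda>t. complex_of_real (bump e c d t)) \<in> test_functions S"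
proof -
  have "closure {t. complex_of_real (bump e c d t) \<noteq> 0} \<subseteq> {c..d}"
  proof (rule closure_minimal)
    show "{t. complex_of_real (bump e c d t) \<noteq> 0} \<subseteq> {c..d}"
    proof
      fix t
      assume "t \<in> {t. complex_of_real (bump e c d t) \<noteq> 0}"
      then have "t \<in> {c<..<d}"
        using bump_eq_0(1)[of t c d e] by auto
      then show "t \<in> {c..d}"
        by simp
    qed
  qed simp
  then have "closure {t. complex_of_real (bump e c d t) \<noteq> 0} \<subseteq> S"
      "compact ({c..d} \<inter> closure {t. complex_of_real (bump e c d t) \<noteq> 0})"
      "{c..d} \<inter> closure {t. complex_of_real (bump e c d t) \<noteq> 0} = closure {t. complex_of_real (bump e c d t) \<noteq> 0}"
    using assms(2) by (auto intro: compact_Int_closed)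
  then show ?thesis
    using assms smooth_bump[OF assms(1)] by (auto simp: test_functions_def)
qed

lemma continuous_flat: "e > 0 \<Longrightarrow> continuous_on UNIV (flat e k)"
  using DERIV_flat by (intro DERIV_continuous_on) (auto intro: has_field_derivative_at_within)

lemma continuous_bump:
  assumes "e > 0"
  shows "continuous_on UNIV (bump e c d)" "continuous_on UNIV (bump' e c d)"
proof -
  have "continuous_on UNIV (\<lambda>t. flat e k (t - c))" "continuous_on UNIV (\<lambda>t. flat e k (d - t))" for k
    by (rule continuous_on_compose2[OF continuous_flat[OF assms]]; auto intro!: continuous_intros)+
  then show "continuous_on UNIV (bump e c d)" "continuous_on UNIV (bump' e c d)"
    unfolding bump_def[abs_def] bump'_def[abs_def] by (intro continuous_intros; simp)+
qed

lemma square_integrable_if_compact_support: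
  fixes f :: "real \<Rightarrow> real"
  assumes "continuous_on UNIV f" "\<And>t. t \<notin> {c..d} \<Longrightarrow> f t = 0"
  shows "square_integrable f"
proof -
  have "integrable lborel (\<lambda>t. indicator {c..d} t *\<^sub>R (f t)\<^sup>2)"
    by (intro borel_integrable_compact continuous_intros continuous_on_subset[OF assms(1)]) auto
  moreover have "(\<lambda>t. indicator {c..d} t *\<^sub>R (f t)\<^sup>2) = (\<lambda>t. (norm (f t))\<^sup>2)"
    using assms(2) by (auto simp: indicator_def fun_eq_iff)
  ultimately have "integrable lborel (\<lambda>t. (norm (f t))\<^sup>2)"
    by (simp only:)
  then show ?thesis
    using borel_measurable_continuous_onI[OF assms(1)] by (simp add: square_integrable_def)
qed

lemma square_integrable_bump:
  assumes "e > 0"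
  shows "square_integrable (bump e c d)" "square_integrable (bump' e c d)"
proof -
  have "t \<notin> {c<..<d}" if "t \<notin> {c..d}" for t
    using that by auto
  then show "square_integrable (bump e c d)" "square_integrable (bump' e c d)"
    by (blast intro: square_integrable_if_compact_support[of _ c d] continuous_bump[OF assms] bump_eq_0)+
qed

lemma bump'_bounded:
  assumes "e > 0"
  obtains C where "\<And>t. \<bar>bump' e c d t\<bar> \<le> C"
proof -
  have "bounded (bump' e c d ` {c..d})"
    by (intro compact_imp_bounded compact_continuous_image continuous_on_subset[OF continuous_bump(2)[OF assms]]) auto
  then obtain C where C: "\<forall>t\<in>{c..d}. \<bar>bump' e c d t\<bar> \<le> C"
    by (auto simp: bounded_iff)
  have "\<bar>bump' e c d t\<bar> \<le> \<bar>C\<bar>" for t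
  proof (cases "t \<in> {c<..<d}")
    case True
    then have "t \<in> {c..d}"
      by simp
    then have "\<bar>bump' e c d t\<bar> \<le> C"
      using C by blast
    then show ?thesis
      by linarith
  qed (simp add: bump_eq_0)
  then show thesis
    using that by blast
qed

lemma bump_translate: "bump e c d (t + h) = bump e (c - h) (d - h) t"
  by (simp add: bump_def algebra_simps)

section \<open>Bumps are total on a ray\<close>

text \<open>
  With \<open>s = 1\<close> this is the ray to the right of \<open>b\<close>, with \<open>s = - 1\<close> the ray to the left of \<open>- b\<close>. In both
  cases \<open>s\<close> is the direction pointing away from the boundary, so one argument serves both rays.
\<close>

definition ray :: "real \<Rightarrow> real \<Rightarrow> real set" where
  "ray s b = {t. b < s * t}"

lemma ray_borel [measurable]: "ray s b \<in> sets borel"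
  unfolding ray_def by measurable

lemma Icc_subset_ray_translate:
  assumes "s * s = 1" "{c..d} \<subseteq> ray s b" "0 \<le> h"
  shows "{c + s * h..d + s * h} \<subseteq> ray s b"
proof
  fix t
  assume "t \<in> {c + s * h..d + s * h}"
  then have "t - s * h \<in> {c..d}"
    by auto
  then have "b < s * (t - s * h)"
    using assms(2) by (auto simp: ray_def)
  also have "\<dots> = s * t - h"
    using assms(1) by (simp add: right_diff_distrib flip: mult.assoc)
  finally show "t \<in> ray s b"
    using assms(3) by (simp add: ray_def)
qed

text \<open>
  The open intervals generate the Borel sets and are stable under intersection, so the integral
  vanishes over every Borel set.
\<close>

lemma AE_zero_if_interval_integrals_zero:
  fixes f :: "real \<Rightarrow> real"
  assumes f: "integrable lborel f"
    and supp: "\<And>t. t \<notin> {\<alpha>..\<beta>} \<Longrightarrow> f t = 0"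
    and zero: "\<And>c d. (\<integral>t. indicator {c<..<d} t * f t \<partial>lborel) = 0"
  shows "AE t in lborel. f t = 0"
proof (rule sigma_finite_measure.density_zero[OF lborel.sigma_finite_measure_axioms f])
  let ?G = "range (\<lambda>(c, d). {c<..<d::real})"
  have total: "integral\<^sup>L lborel f = 0"
  proof -
    have "f = (\<lambda>t. indicator {\<alpha> - 1<..<\<beta> + 1} t * f t)"
    proof
      fix t
      show "f t = indicator {\<alpha> - 1<..<\<beta> + 1} t * f t"
        using supp[of t] by (cases "t \<in> {\<alpha>..\<beta>}") (auto simp: indicator_def)
    qed
    then show ?thesis
      using zero[of "\<alpha> - 1" "\<beta> + 1"] by simp
  qed
  have borelG: "sets borel = sigma_sets UNIV ?G"
    by (simp add: borel_eq_box[where 'a = real])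
  fix A :: "real set"
  assume "A \<in> sets lborel"
  then have A: "A \<in> sigma_sets UNIV ?G"
    by (simp add: borelG)
  have "{a<..<b} \<inter> {c<..<d} \<in> ?G" for a b c d :: real
    by (simp add: image_iff split_paired_Ex) blast
  then have "Int_stable ?G"
    by (auto simp: Int_stable_def)
  moreover have "?G \<subseteq> Pow UNIV"
    by simp
  moreover note A
  ultimately show "set_lebesgue_integral lborel A f = 0"
  proof (induction rule: sigma_sets_induct_disjoint)
    case (basic A)
    then show ?case
      using zero by (auto simp: set_lebesgue_integral_def)
  next
    case empty
    show ?case
      by (simp add: set_lebesgue_integral_def)
  next
    case (compl A)
    then have [measurable]: "A \<in> sets borel"
      by (simp add: borelG)
    have "integral\<^sup>L lborel f = (\<integral>t\<in>A. f t \<partial>lborel) + (\<integral>t\<in>- A. f t \<partial>lborel)"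
    proof -
      have "integrable lborel (\<lambda>t. indicator A t *\<^sub>R f t)" "integrable lborel (\<lambda>t. indicator (- A) t *\<^sub>R f t)"
        by (intro integrable_mult_indicator f; simp)+
      then have "(\<integral>t. indicator A t *\<^sub>R f t + indicator (- A) t *\<^sub>R f t \<partial>lborel)
          = (\<integral>t\<in>A. f t \<partial>lborel) + (\<integral>t\<in>- A. f t \<partial>lborel)"
        unfolding set_lebesgue_integral_def by (rule Bochner_Integration.integral_add)
      moreover have "(\<lambda>t. indicator A t *\<^sub>R f t + indicator (- A) t *\<^sub>R f t) = f"
        by (auto simp: indicator_def fun_eq_iff)
      ultimately show ?thesis
        by simp
    qed
    then show ?case
      using total compl by (simp add: Compl_eq_Diff_UNIV)
  next
    case (union A)
    then have [measurable]: "A i \<in> sets borel" for i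
      using union(2) by (auto simp: borelG)
    have "set_integrable lborel (\<Union>i. A i) f"
      unfolding set_integrable_def by (rule integrable_mult_indicator) (auto intro: f)
    then have "(\<integral>t\<in>(\<Union>i. A i). f t \<partial>lborel) = (\<Sum>i. \<integral>t\<in>A i. f t \<partial>lborel)"
      using union(1) by (intro lebesgue_integral_countable_add) (auto simp: disjoint_family_on_def)
    then show ?case
      using union by simp
  qed
qed

lemma square_integrable_indicator_Icc: "square_integrable (indicator {c..d} :: real \<Rightarrow> real)"
proof -
  have "(\<lambda>t. (norm (indicator {c..d} t :: real))\<^sup>2) = indicator {c..d}"
    by (auto simp: indicator_def fun_eq_iff)
  moreover have "integrable lborel (indicator {c..d} :: real \<Rightarrow> real)"
    by (rule integrable_real_indicator) (auto simp: emeasure_lborel_Icc_eq)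
  ultimately show ?thesis
    by (simp add: square_integrable_def)
qed

text \<open>
  As the parameter \<open>e\<close> tends to zero, the bump tends boundedly to the indicator of \<open>{c<..<d}\<close>.
\<close>

lemma integral_indicator_Ioo_zero:
  fixes k :: "real \<Rightarrow> real"
  assumes k: "square_integrable k"
    and zero: "\<And>e. 0 < e \<Longrightarrow> (\<integral>t. bump e c d t * k t \<partial>lborel) = 0"
  shows "(\<integral>t. indicator {c<..<d} t * k t \<partial>lborel) = 0"
proof -
  have [measurable]: "k \<in> borel_measurable borel"
    using k by (simp add: square_integrable_def)
  have "square_integrable (indicator {c..d} :: real \<Rightarrow> real)"
    by (rule square_integrable_indicator_Icc)
  then have ind: "integrable lborel (\<lambda>t. \<bar>indicator {c..d} t * k t\<bar>)"
    by (intro integrable_abs integrable_mult_square_integrable k)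
  have "(\<lambda>n. \<integral>t. bump (1 / real (Suc n)) c d t * k t \<partial>lborel) \<longlonglongrightarrow> (\<integral>t. indicator {c<..<d} t * k t \<partial>lborel)"
  proof (rule integral_dominated_convergence[OF _ _ ind])
    show "(\<lambda>t. bump (1 / real (Suc n)) c d t * k t) \<in> borel_measurable lborel" for n
    proof -
      have [measurable]: "bump (1 / real (Suc n)) c d \<in> borel_measurable borel"
        by (intro borel_measurable_continuous_onI continuous_bump) simp
      show ?thesis
        by measurable
    qed
    show "AE t in lborel. (\<lambda>n. bump (1 / real (Suc n)) c d t * k t) \<longlonglongrightarrow> indicator {c<..<d} t * k t"
    proof (intro AE_I2 tendsto_mult tendsto_const)
      fix t
      show "(\<lambda>n. bump (1 / real (Suc n)) c d t) \<longlonglongrightarrow> indicator {c<..<d} t"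
      proof (cases "t \<in> {c<..<d}")
        case True
        have "(\<lambda>n. exp (- (1 / real (Suc n)) / (t - c)) * exp (- (1 / real (Suc n)) / (d - t))) \<longlonglongrightarrow> exp 0 * exp 0"
          by (intro tendsto_mult tendsto_exp) (use True in real_asymp)+
        then show ?thesis
          using True by (simp add: bump_def flat_def)
      qed (simp add: bump_eq_0)
    qed
    show "AE t in lborel. norm (bump (1 / real (Suc n)) c d t * k t) \<le> \<bar>indicator {c..d} t * k t\<bar>" for n
    proof (rule AE_I2)
      fix t
      show "norm (bump (1 / real (Suc n)) c d t * k t) \<le> \<bar>indicator {c..d} t * k t\<bar>"
      proof (cases "t \<in> {c<..<d}")
        case True
        then show ?thesis
          using bump_le_1[of "1 / real (Suc n)" c d t] bump_nonneg[of "1 / real (Suc n)" c d t]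
          by (auto simp: abs_mult intro!: mult_left_le_one_le)
      qed (simp add: bump_eq_0)
    qed
  qed auto
  moreover have "(\<lambda>n. \<integral>t. bump (1 / real (Suc n)) c d t * k t \<partial>lborel) = (\<lambda>n. 0)"
    using zero by simp
  ultimately show ?thesis
    using LIMSEQ_unique tendsto_const by metis
qed

lemma AE_zero_on_Icc_if_bump_integrals_zero:
  fixes k :: "real \<Rightarrow> real"
  assumes k: "square_integrable k"
    and zero: "\<And>e c d. 0 < e \<Longrightarrow> c < d \<Longrightarrow> {c..d} \<subseteq> {\<alpha>..\<beta>} \<Longrightarrow> (\<integral>t. bump e c d t * k t \<partial>lborel) = 0"
  shows "AE t in lborel. t \<in> {\<alpha>..\<beta>} \<longrightarrow> k t = 0"
proof -
  have [measurable]: "k \<in> borel_measurable borel"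
    using k by (simp add: square_integrable_def)
  have "square_integrable (indicator {\<alpha>..\<beta>} :: real \<Rightarrow> real)"
    by (rule square_integrable_indicator_Icc)
  then have int: "integrable lborel (\<lambda>t. indicator {\<alpha>..\<beta>} t * k t)"
    by (rule integrable_mult_square_integrable[OF _ k])
  have "AE t in lborel. indicator {\<alpha>..\<beta>} t * k t = 0"
  proof (rule AE_zero_if_interval_integrals_zero[OF int, of \<alpha> \<beta>])
    fix c d
    let ?c = "max c \<alpha>" and ?d = "min d \<beta>"
    have "(\<integral>t. indicator {c<..<d} t * (indicator {\<alpha>..\<beta>} t * k t) \<partial>lborel)
        = (\<integral>t. indicator {?c<..<?d} t * k t \<partial>lborel)"
    proof (rule integral_cong_AE)
      show "AE t in lborel. indicator {c<..<d} t * (indicator {\<alpha>..\<beta>} t * k t) = indicator {?c<..<?d} t * k t"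
        using AE_lborel_singleton[of \<alpha>] AE_lborel_singleton[of \<beta>]
        by eventually_elim (auto simp: indicator_def)
    qed auto
    also have "\<dots> = 0"
    proof (cases "?c < ?d")
      case True
      then show ?thesis
        by (intro integral_indicator_Ioo_zero[OF k] zero) auto
    next
      case False
      then have "{?c<..<?d} = {}"
        by auto
      then show ?thesis
        by simp
    qed
    finally show "(\<integral>t. indicator {c<..<d} t * (indicator {\<alpha>..\<beta>} t * k t) \<partial>lborel) = 0" .
  qed auto
  then show ?thesis
    by eventually_elim (auto simp: indicator_def)
qed

lemma AE_zero_on_ray_if_bump_integrals_zero:
  fixes k :: "real \<Rightarrow> real"
  assumes s: "s = 1 \<or> s = - 1" and k: "square_integrable k"
    and zero: "\<And>e c d. 0 < e \<Longrightarrow> c < d \<Longrightarrow> {c..d} \<subseteq> ray s b \<Longrightarrow> (\<integral>t. bump e c d t * k t \<partial>lborel) = 0"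
  shows "AE t in lborel. t \<in> ray s b \<longrightarrow> k t = 0"
proof -
  define I where "I n = (if s = 1 then {b + 1 / real (Suc n)..b + real (Suc n)}
      else {- (b + real (Suc n))..- (b + 1 / real (Suc n))})" for n
  have sub: "I n \<subseteq> ray s b" for n
    using s by (auto simp: I_def ray_def intro: less_le_trans[of b "b + 1 / real (Suc n)"]
        dest!: order_trans[of _ _ "- (b + 1 / real (Suc n))"] split: if_splits
        simp: field_simps add_pos_nonneg)
  have cover: "\<exists>n. t \<in> I n" if "t \<in> ray s b" for t
  proof -
    have p: "0 < s * t - b"
      using that by (simp add: ray_def)
    obtain n1 where n1: "1 / real (Suc n1) < s * t - b"
      using reals_Archimedean[OF p] by (auto simp: inverse_eq_divide)
    obtain n2 where n2: "s * t - b < real n2"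
      using reals_Archimedean2 by blast
    have "1 / real (Suc (max n1 n2)) \<le> 1 / real (Suc n1)"
      by (intro divide_left_mono) auto
    then have "b + 1 / real (Suc (max n1 n2)) \<le> s * t" "s * t \<le> b + real (Suc (max n1 n2))"
      using n1 n2 by auto
    then have "t \<in> I (max n1 n2)"
      using s unfolding I_def by auto
    then show ?thesis
      by blast
  qed
  have "AE t in lborel. t \<in> I n \<longrightarrow> k t = 0" for n
  proof -
    obtain \<alpha> \<beta> where ab: "I n = {\<alpha>..\<beta>}"
      by (cases "s = 1") (auto simp: I_def)
    show ?thesis
      unfolding ab
      by (intro AE_zero_on_Icc_if_bump_integrals_zero[OF k] zero) (use ab sub[of n] in auto)
  qed
  then have "AE t in lborel. \<forall>n. t \<in> I n \<longrightarrow> k t = 0"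
    unfolding AE_all_countable by blast
  then show ?thesis
    by eventually_elim (use cover in blast)
qed

definition bump_tensors :: "real set \<Rightarrow> 'h set \<Rightarrow> 'h::{real_inner, second_countable_topology} L2 set" where
  "bump_tensors S D = {tensor_L2 (bump e c d) g | e c d g. 0 < e \<and> c < d \<and> {c..d} \<subseteq> S \<and> g \<in> D}"

lemma bump_tensorsI:
  "0 < e \<Longrightarrow> c < d \<Longrightarrow> {c..d} \<subseteq> S \<Longrightarrow> g \<in> D \<Longrightarrow> tensor_L2 (bump e c d) g \<in> bump_tensors S D"
  unfolding bump_tensors_def by blast

lemma bump_tensors_subset: "bump_tensors S D \<subseteq> L2_on S"
proof
  fix x
  assume "x \<in> bump_tensors S D"
  then obtain e c d g where x: "x = tensor_L2 (bump e c d) g" "0 < e" "{c..d} \<subseteq> S"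
    by (auto simp: bump_tensors_def)
  have "AE t in lborel. rep_L2 x t = bump e c d t *\<^sub>R g"
    unfolding x(1) by (rule rep_tensor_L2[OF square_integrable_bump(1)[OF x(2)]])
  then show "x \<in> L2_on S"
    unfolding mem_L2_on
  proof eventually_elim
    case (elim t)
    have "bump e c d t = 0" if "t \<notin> S"
    proof (rule bump_eq_0(1))
      have "t \<notin> {c..d}"
        using that x(3) by blast
      then show "t \<notin> {c<..<d}"
        by auto
    qed
    then show ?case
      using elim by simp
  qed
qed

text \<open>
  A countable dense set of vectors \<open>g\<close> reduces the claim to the scalar functions \<open>\<langle>g, z(t)\<rangle>\<close>, with one
  exceptional null set for all of them.
\<close>

lemma bump_tensors_total:
  fixes z :: "'h::{real_inner, second_countable_topology} L2"
  assumes s: "s = 1 \<or> s = - 1" and D: "closure D = UNIV"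
    and z: "z \<in> L2_on (ray s b)" and orth: "\<And>x. x \<in> bump_tensors (ray s b) D \<Longrightarrow> inner x z = 0"
  shows "z = 0"
proof -
  obtain T where T: "countable T" "T \<subseteq> D" "D \<subseteq> closure T"
    using separable[of D] by blast
  have Tdense: "closure T = UNIV"
    using T(3) D closure_minimal[OF T(3) closed_closure] by auto
  have "AE t in lborel. t \<in> ray s b \<longrightarrow> inner g (rep_L2 z t) = 0" if "g \<in> T" for g
  proof (rule AE_zero_on_ray_if_bump_integrals_zero[OF s square_integrable_inner_rep])
    fix e c d :: real
    assume *: "0 < e" "c < d" "{c..d} \<subseteq> ray s b"
    then have "tensor_L2 (bump e c d) g \<in> bump_tensors (ray s b) D"
      using that T(2) by (intro bump_tensorsI) auto
    then show "(\<integral>t. bump e c d t * inner g (rep_L2 z t) \<partial>lborel) = 0"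
      using orth inner_tensor_L2[OF square_integrable_bump(1)[OF *(1)]] by metis
  qed
  then have "AE t in lborel. \<forall>g\<in>T. t \<in> ray s b \<longrightarrow> inner g (rep_L2 z t) = 0"
    unfolding AE_ball_countable[OF T(1)] by blast
  then have "AE t in lborel. rep_L2 z t = rep_L2 0 t"
    using z[unfolded mem_L2_on] rep_zero_L2[where 'a = 'h]
  proof eventually_elim
    case (elim t)
    have "rep_L2 z t = 0"
    proof (cases "t \<in> ray s b")
      case True
      have "closed {g. inner g (rep_L2 z t) = 0}"
        by (intro closed_Collect_eq continuous_intros)
      then have "closure T \<subseteq> {g. inner g (rep_L2 z t) = 0}"
        using elim(1) True by (intro closure_minimal) auto
      then have "inner (rep_L2 z t) (rep_L2 z t) = 0"
        using Tdense by blast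
      then show ?thesis
        by simp
    qed (use elim in auto)
    then show ?case
      using elim by simp
  qed
  then show ?thesis
    by (rule L2_eqI)
qed

lemma bump_tensors_dense:
  fixes D :: "'h::{real_inner, banach, second_countable_topology} set"
  assumes "s = 1 \<or> s = - 1" "closure D = UNIV"
  shows "L2_on (ray s b) \<subseteq> closure (span (bump_tensors (ray s b) D))"
proof (rule dense_if_total)
  show "complete (L2_on (ray s b) :: 'h L2 set)"
    by (simp add: complete_eq_closed closed_L2_on)
  show "subspace (L2_on (ray s b) :: 'h L2 set)"
    by (rule subspace_L2_on)
  show "span (bump_tensors (ray s b) D) \<subseteq> L2_on (ray s b)"
    by (intro span_minimal bump_tensors_subset subspace_L2_on)
  show "z = 0" if "z \<in> L2_on (ray s b)" "\<And>x. x \<in> span (bump_tensors (ray s b) D) \<Longrightarrow> inner x z = 0" for z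
    using that by (intro bump_tensors_total[OF assms]) (auto intro: span_base)
qed (rule subspace_span)

section \<open>Weak derivatives and difference quotients\<close>

lemma bump_lipschitz:
  assumes "0 < e" "\<And>t. \<bar>bump' e c d t\<bar> \<le> C"
  shows "\<bar>bump e c d x - bump e c d y\<bar> \<le> C * \<bar>x - y\<bar>"
  using field_differentiable_bound[of UNIV "bump e c d" "bump' e c d" C x y]
    DERIV_bump[OF assms(1)] assms(2) by simp

lemma inner_shift_tensor_L2:
  assumes "square_integrable \<psi>"
  shows "inner (shift_L2 (- h) (tensor_L2 \<psi> g)) u = (\<integral>t. \<psi> (t - h) * inner g (rep_L2 u t) \<partial>lborel)"
  using inner_tensor_L2[OF square_integrable_translate[OF assms, of "- h"], of g u]
  by (simp add: shift_tensor_L2[OF assms])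

text \<open>
  Translating a test function differentiates it: the difference quotients of a bump are bounded
  by its Lipschitz constant and supported in a fixed interval, so dominated convergence applies.
\<close>

lemma DERIV_inner_shift_bump:
  assumes e: "0 < e"
  shows "((\<lambda>h. inner (shift_L2 (- h) (tensor_L2 (bump e c d) g)) u) has_real_derivative
    - inner (shift_L2 (- h) (tensor_L2 (bump' e c d) g)) u) (at h)"
proof -
  define k where "k t = inner g (rep_L2 u t)" for t
  have k: "square_integrable k"
    unfolding k_def[abs_def] by (rule square_integrable_inner_rep)
  then have [measurable]: "k \<in> borel_measurable borel"
    by (simp add: square_integrable_def)
  have [measurable]: "bump e c d \<in> borel_measurable borel" "bump' e c d \<in> borel_measurable borel"
    by (intro borel_measurable_continuous_onI continuous_bump e)+
  obtain C where C: "\<And>t. \<bar>bump' e c d t\<bar> \<le> C"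
    using bump'_bounded[OF e] by blast
  then have C0: "0 \<le> C"
    using abs_ge_zero order_trans by blast
  note sq = square_integrable_bump[OF e, of c d]
  have int: "integrable lborel (\<lambda>t. bump e c d (t - y) * k t)" for y
    using integrable_mult_square_integrable[OF square_integrable_translate[OF sq(1), of "- y"] k] by simp
  let ?m = "\<lambda>h. \<integral>t. bump e c d (t - h) * k t \<partial>lborel"
  have "((\<lambda>y. (?m y - ?m h) / (y - h)) \<longlongrightarrow> - (\<integral>t. bump' e c d (t - h) * k t \<partial>lborel)) (at h)"
    unfolding tendsto_at_iff_sequentially comp_def
  proof (intro allI impI)
    fix X :: "nat \<Rightarrow> real"
    assume X: "\<forall>i. X i \<in> UNIV - {h}" "X \<longlonglongrightarrow> h"
    then obtain R where R: "\<And>i. \<bar>X i\<bar> \<le> R"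
      using convergent_imp_Bseq[OF convergentI, of X h] unfolding Bseq_def by auto
    define R' where "R' = max R \<bar>h\<bar>"
    let ?q = "\<lambda>i t. (bump e c d (t - X i) - bump e c d (t - h)) / (X i - h)"
    let ?w = "\<lambda>t. C * \<bar>indicator {c - R'..d + R'} t * k t\<bar>"
    have "(\<lambda>i. \<integral>t. ?q i t * k t \<partial>lborel) \<longlonglongrightarrow> (\<integral>t. - bump' e c d (t - h) * k t \<partial>lborel)"
    proof (rule integral_dominated_convergence[where w = ?w])
      show "integrable lborel ?w"
        by (intro integrable_mult_right integrable_abs integrable_mult_square_integrable k
            square_integrable_indicator_Icc)
      show "AE t in lborel. (\<lambda>i. ?q i t * k t) \<longlonglongrightarrow> - bump' e c d (t - h) * k t"
      proof (intro AE_I2 tendsto_mult tendsto_const)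
        fix t
        have "((\<lambda>y. bump e c d (t - y)) has_real_derivative bump' e c d (t - h) * - 1) (at h)"
          by (rule DERIV_chain2[OF DERIV_bump[OF e]]) (auto intro!: derivative_eq_intros)
        then have "((\<lambda>y. (bump e c d (t - y) - bump e c d (t - h)) / (y - h)) \<longlongrightarrow> - bump' e c d (t - h)) (at h)"
          by (simp add: has_field_derivative_iff)
        then show "(\<lambda>i. ?q i t) \<longlonglongrightarrow> - bump' e c d (t - h)"
          using X unfolding tendsto_at_iff_sequentially comp_def by blast
      qed
      show "AE t in lborel. norm (?q i t * k t) \<le> ?w t" for i
      proof (rule AE_I2)
        fix t
        have ne: "X i \<noteq> h"
          using X(1) by auto
        show "norm (?q i t * k t) \<le> ?w t"
        proof (cases "t \<in> {c - R'..d + R'}")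
          case True
          have "\<bar>?q i t\<bar> \<le> C"
            using bump_lipschitz[OF e C, of "t - X i" "t - h"] ne
            by (simp add: abs_divide divide_le_eq abs_minus_commute)
          then have "\<bar>?q i t\<bar> * \<bar>k t\<bar> \<le> C * \<bar>k t\<bar>"
            by (rule mult_right_mono) simp
          moreover have "norm (?q i t * k t) = \<bar>?q i t\<bar> * \<bar>k t\<bar>"
            unfolding real_norm_def by (rule abs_mult)
          moreover have "?w t = C * \<bar>k t\<bar>"
            using True by simp
          ultimately show ?thesis
            by (simp only:)
        next
          case False
          have "\<bar>X i\<bar> \<le> R'" "\<bar>h\<bar> \<le> R'"
            using R[of i] by (auto simp: R'_def)
          then have "bump e c d (t - X i) = 0" "bump e c d (t - h) = 0"
            using False by (intro bump_eq_0(1); force)+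
          then show ?thesis
            using C0 by simp
        qed
      qed
    qed measurable
    moreover have "(\<integral>t. ?q i t * k t \<partial>lborel) = (?m (X i) - ?m h) / (X i - h)" for i
    proof -
      have "(\<integral>t. ?q i t * k t \<partial>lborel)
          = (\<integral>t. (bump e c d (t - X i) * k t - bump e c d (t - h) * k t) / (X i - h) \<partial>lborel)"
        by (simp add: left_diff_distrib)
      also have "\<dots> = (?m (X i) - ?m h) / (X i - h)"
        by (simp add: Bochner_Integration.integral_diff int)
      finally show ?thesis .
    qed
    moreover have "(\<integral>t. - bump' e c d (t - h) * k t \<partial>lborel) = - (\<integral>t. bump' e c d (t - h) * k t \<partial>lborel)"
      by simp
    ultimately show "(\<lambda>i. (?m (X i) - ?m h) / (X i - h)) \<longlonglongrightarrow> - (\<integral>t. bump' e c d (t - h) * k t \<partial>lborel)"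
      by (simp only:)
  qed
  then show ?thesis
    unfolding has_field_derivative_iff inner_shift_tensor_L2[OF sq(1)] inner_shift_tensor_L2[OF sq(2)]
    by (simp add: k_def)
qed

text \<open>
  The derivative is taken in the direction \<open>s\<close> away from the boundary: for smooth \<open>u\<close> the relation
  says \<open>p = s u'\<close>. It is tested only against vectors of \<open>D\<close>, for which the domain of an unbounded
  operator will be used.
\<close>

definition weak_deriv ::
  "real \<Rightarrow> real \<Rightarrow> 'h set \<Rightarrow> 'h::{real_inner, second_countable_topology} L2 \<Rightarrow> 'h L2 \<Rightarrow> bool" where
  "weak_deriv s b D u p \<longleftrightarrow> (\<forall>e c d g. 0 < e \<longrightarrow> c < d \<longrightarrow> {c..d} \<subseteq> ray s b \<longrightarrow> g \<in> D \<longrightarrow>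
     - (s * inner (tensor_L2 (bump' e c d) g) u) = inner (tensor_L2 (bump e c d) g) p)"

lemma bump'_translate: "bump' e c d (t + h) = bump' e (c - h) (d - h) t"
  by (simp add: bump'_def algebra_simps)

lemma shift_bump_tensor:
  assumes "0 < e"
  shows "shift_L2 (- h) (tensor_L2 (bump e c d) g) = tensor_L2 (bump e (c + h) (d + h)) g"
    and "shift_L2 (- h) (tensor_L2 (bump' e c d) g) = tensor_L2 (bump' e (c + h) (d + h)) g"
  using bump_translate[of e c d _ "- h"] bump'_translate[of e c d _ "- h"]
  by (simp_all add: shift_tensor_L2[OF square_integrable_bump(1)[OF assms]]
      shift_tensor_L2[OF square_integrable_bump(2)[OF assms]])

text \<open>
  Translating a bump away from the boundary keeps its support in the ray, so the weak derivative
  can be inserted at every later time \<open>h\<close>.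
\<close>

lemma DERIV_inner_shift:
  assumes s: "s * s = 1" and p: "weak_deriv s b D u p" and h: "0 \<le> h"
    and x: "x \<in> span (bump_tensors (ray s b) D)"
  shows "((\<lambda>h. inner (shift_L2 (- (s * h)) x) u) has_real_derivative inner (shift_L2 (- (s * h)) x) p) (at h)"
  using x
proof (induction rule: span_induct)
  case base
  show ?case
  proof (rule subspaceI)
    have "shift_L2 k (0 :: 'a L2) = 0" for k
      using shift_scaleR_L2[of k 0 "0 :: 'a L2"] by simp
    then show "0 \<in> {x. ((\<lambda>h. inner (shift_L2 (- (s * h)) x) u) has_real_derivative inner (shift_L2 (- (s * h)) x) p) (at h)}"
      by simp
  qed (auto simp: shift_add_L2 shift_scaleR_L2 inner_add_left intro: DERIV_add DERIV_cmult)
next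
  case (step x)
  then obtain e c d g where *: "x = tensor_L2 (bump e c d) g" "0 < e" "c < d" "{c..d} \<subseteq> ray s b" "g \<in> D"
    unfolding bump_tensors_def by blast
  have "((\<lambda>h. inner (shift_L2 (- (s * h)) x) u) has_real_derivative
      - inner (shift_L2 (- (s * h)) (tensor_L2 (bump' e c d) g)) u * s) (at h)"
    unfolding *(1) by (rule DERIV_chain2[OF DERIV_inner_shift_bump[OF *(2)]]) (auto intro!: derivative_eq_intros)
  moreover have "- inner (shift_L2 (- (s * h)) (tensor_L2 (bump' e c d) g)) u * s = inner (shift_L2 (- (s * h)) x) p"
  proof -
    have "{c + s * h..d + s * h} \<subseteq> ray s b" "c + s * h < d + s * h"
      using Icc_subset_ray_translate[OF s *(4) h] *(3) by auto
    then show ?thesis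
      using p *(2,5) unfolding *(1) weak_deriv_def shift_bump_tensor[OF *(2)] by (simp add: mult.commute)
  qed
  ultimately show ?case
    by simp
qed

lemma inner_shift_increment:
  assumes "s * s = 1" "weak_deriv s b D u p" "0 < h" "x \<in> span (bump_tensors (ray s b) D)"
  shows "\<bar>inner (shift_L2 (- (s * h)) x) u - inner x u\<bar> \<le> h * norm x * norm p"
proof -
  let ?m = "\<lambda>h. inner (shift_L2 (- (s * h)) x) u"
  have "\<exists>z. 0 < z \<and> z < h \<and> ?m h - ?m 0 = (h - 0) * inner (shift_L2 (- (s * z)) x) p"
    using assms by (intro MVT2 DERIV_inner_shift) auto
  then obtain z where z: "?m h - ?m 0 = h * inner (shift_L2 (- (s * z)) x) p"
    by auto
  have "\<bar>inner (shift_L2 (- (s * z)) x) p\<bar> \<le> norm x * norm p"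
    using Cauchy_Schwarz_ineq2[of "shift_L2 (- (s * z)) x" p] by simp
  then have "\<bar>?m h - ?m 0\<bar> \<le> h * (norm x * norm p)"
    unfolding z abs_mult using assms(3) by (simp add: mult_left_mono)
  then show ?thesis
    by (simp add: mult.assoc)
qed

text \<open>
  The adjoint of the isometric translation away from the boundary: the part of \<open>u\<close> within distance
  \<open>h\<close> of the boundary is lost.
\<close>

definition pull_L2 :: "real \<Rightarrow> real \<Rightarrow> real \<Rightarrow> 'h::{real_inner, second_countable_topology} L2 \<Rightarrow> 'h L2" where
  "pull_L2 s b h u = restrict_L2 (ray s b) (shift_L2 (s * h) u)"

lemma inner_pull_L2:
  assumes "y \<in> L2_on (ray s b)"
  shows "inner y (pull_L2 s b h u) = inner (shift_L2 (- (s * h)) y) u"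
  unfolding pull_L2_def
  by (simp add: inner_shift_L2 restrict_id_L2[OF ray_borel assms] flip: inner_restrict_L2[OF ray_borel])

lemma pull_in_L2_on: "pull_L2 s b h u \<in> L2_on (ray s b)"
  unfolding pull_L2_def by (rule restrict_in_L2_on[OF ray_borel])

context
  fixes s b :: real and D :: "'h::{real_inner, banach, second_countable_topology} set" and u p :: "'h L2"
  assumes s: "s = 1 \<or> s = - 1" and D: "closure D = UNIV"
    and u: "u \<in> L2_on (ray s b)" and p: "weak_deriv s b D u p"
begin

text \<open>
  By duality with the bumps, against which the increment over the time \<open>h\<close> is controlled by the
  mean value theorem.
\<close>

lemma norm_pull_diff:
  assumes h: "0 < h"
  shows "norm (pull_L2 s b h u - u) \<le> h * norm p"
proof -
  let ?d = "pull_L2 s b h u - u"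
  have "\<bar>inner x ?d\<bar> \<le> h * norm x * norm p" if "x \<in> span (bump_tensors (ray s b) D)" for x
  proof -
    have "x \<in> L2_on (ray s b)"
      using that span_minimal[OF bump_tensors_subset subspace_L2_on] by blast
    then show ?thesis
      using inner_shift_increment[OF _ p h that] s by (auto simp: inner_diff_right inner_pull_L2)
  qed
  moreover have "closed {x. \<bar>inner x ?d\<bar> \<le> h * norm x * norm p}"
    by (intro closed_Collect_le continuous_intros)
  ultimately have "closure (span (bump_tensors (ray s b) D)) \<subseteq> {x. \<bar>inner x ?d\<bar> \<le> h * norm x * norm p}"
    by (intro closure_minimal) auto
  moreover have "?d \<in> L2_on (ray s b)"
    by (intro subspace_diff[OF subspace_L2_on] pull_in_L2_on u)
  ultimately have "\<bar>inner ?d ?d\<bar> \<le> h * norm ?d * norm p"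
    using bump_tensors_dense[OF s D] by blast
  then have "norm ?d * norm ?d \<le> (h * norm p) * norm ?d"
    by (simp add: mult.commute mult.left_commute flip: power2_norm_eq_inner power2_eq_square)
  then show ?thesis
    using h by (cases "norm ?d = 0") auto
qed

text \<open>
  The quotients are bounded by \<open>\<parallel>p\<parallel>\<close> and converge against translates of bumps by differentiation in the
  translation parameter; density does the rest.
\<close>

lemma pull_diff_weakly_tendsto:
  assumes y: "y \<in> L2_on (ray s b)"
  shows "((\<lambda>h. inner y (pull_L2 s b h u - u) / h) \<longlongrightarrow> inner y p) (at_right 0)"
proof (rule tendstoI)
  fix \<epsilon> :: real
  assume eps: "0 < \<epsilon>"
  define \<delta> where "\<delta> = \<epsilon> / (3 * (norm p + 1))"
  have \<delta>: "0 < \<delta>" "\<delta> * norm p \<le> \<epsilon> / 3"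
    using eps by (auto simp: \<delta>_def field_simps add_pos_nonneg add_nonneg_pos)
  have "y \<in> closure (span (bump_tensors (ray s b) D))"
    using bump_tensors_dense[OF s D] y by blast
  then obtain x where x: "x \<in> span (bump_tensors (ray s b) D)" "dist x y < \<delta>"
    using \<delta>(1) unfolding closure_approachable by blast
  have xL: "x \<in> L2_on (ray s b)"
    using x(1) span_minimal[OF bump_tensors_subset subspace_L2_on] by blast
  have "((\<lambda>h. inner (shift_L2 (- (s * h)) x) u) has_real_derivative inner (shift_L2 (- (s * 0)) x) p) (at 0)"
    using s by (intro DERIV_inner_shift[OF _ p _ x(1)]) auto
  then have "((\<lambda>h. inner x (pull_L2 s b h u - u) / h) \<longlongrightarrow> inner x p) (at 0)"
    by (simp add: has_field_derivative_iff inner_diff_right inner_pull_L2[OF xL])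
  then have "((\<lambda>h. inner x (pull_L2 s b h u - u) / h) \<longlongrightarrow> inner x p) (at_right 0)"
    by (simp add: filterlim_at_split)
  then have "\<forall>\<^sub>F h in at_right 0. dist (inner x (pull_L2 s b h u - u) / h) (inner x p) < \<epsilon> / 3"
    using eps by (intro tendstoD) auto
  then show "\<forall>\<^sub>F h in at_right 0. dist (inner y (pull_L2 s b h u - u) / h) (inner y p) < \<epsilon>"
    using eventually_at_right_less[of 0]
  proof eventually_elim
    case (elim h)
    let ?q = "pull_L2 s b h u - u"
    have "\<bar>inner (y - x) ?q\<bar> \<le> norm (y - x) * (h * norm p)"
      using Cauchy_Schwarz_ineq2[of "y - x" ?q] norm_pull_diff[OF elim(2)]
      by (meson mult_left_mono norm_ge_zero order_trans)
    then have "\<bar>inner (y - x) ?q\<bar> / h \<le> norm (y - x) * norm p"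
      using elim(2) by (simp add: field_simps)
    then have "\<bar>inner (y - x) ?q / h\<bar> \<le> norm (y - x) * norm p"
      using elim(2) by simp
    moreover have "\<bar>inner (y - x) p\<bar> \<le> norm (y - x) * norm p"
      by (rule Cauchy_Schwarz_ineq2)
    moreover have "norm (y - x) * norm p \<le> \<delta> * norm p"
      using x(2) by (intro mult_right_mono) (auto simp: dist_norm norm_minus_commute)
    moreover have "inner y ?q / h - inner y p
        = inner (y - x) ?q / h + (inner x ?q / h - inner x p) - inner (y - x) p"
      by (simp add: inner_diff_left diff_divide_distrib)
    ultimately show ?case
      using elim(1) \<delta>(2) unfolding dist_real_def by linarith
  qed
qed

end

section \<open>Operators acting fibrewise\<close>

definition fibrewise :: "'h::{real_inner, second_countable_topology} rel \<Rightarrow> 'h L2 \<Rightarrow> 'h L2 \<Rightarrow> bool" where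
  "fibrewise B u q \<longleftrightarrow> (AE t in lborel. (rep_L2 u t, rep_L2 q t) \<in> B)"

text \<open>
  Selfadjointness turns the weak identity, once it holds for almost every \<open>t\<close> and for all \<open>g\<close> in the
  domain, into membership in the graph. A countable dense subset of the graph provides a common
  null set.
\<close>

lemma fibrewise_if_weakly:
  fixes B :: "'h::{chilbert_space, second_countable_topology} rel"
  assumes s: "s = 1 \<or> s = - 1" and B: "selfadjoint_op UNIV B"
    and u: "u \<in> L2_on (ray s b)" and q: "q \<in> L2_on (ray s b)"
    and weak: "\<And>e c d g g'. 0 < e \<Longrightarrow> c < d \<Longrightarrow> {c..d} \<subseteq> ray s b \<Longrightarrow> (g, g') \<in> B \<Longrightarrow>
      inner (tensor_L2 (bump e c d) g') u = inner (tensor_L2 (bump e c d) g) q"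
  shows "fibrewise B u q"
proof -
  obtain T where T: "countable T" "T \<subseteq> B" "B \<subseteq> closure T"
    using separable[of B] by blast
  have "AE t in lborel. t \<in> ray s b \<longrightarrow> inner (snd x) (rep_L2 u t) = inner (fst x) (rep_L2 q t)" if "x \<in> T" for x
  proof -
    define k where "k t = inner (snd x) (rep_L2 u t) + inner (- fst x) (rep_L2 q t)" for t
    have k: "square_integrable k"
      unfolding k_def[abs_def] by (intro square_integrable_add square_integrable_inner_rep)
    have "AE t in lborel. t \<in> ray s b \<longrightarrow> k t = 0"
    proof (rule AE_zero_on_ray_if_bump_integrals_zero[OF s k])
      fix e c d :: real
      assume *: "0 < e" "c < d" "{c..d} \<subseteq> ray s b"
      note sq = square_integrable_bump(1)[OF *(1), of c d]
      have "inner (tensor_L2 (bump e c d) (snd x)) u = inner (tensor_L2 (bump e c d) (fst x)) q"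
        using weak[OF *] that T(2) by (metis prod.collapse subsetD)
      then have "(\<integral>t. bump e c d t * inner (snd x) (rep_L2 u t) \<partial>lborel)
          = (\<integral>t. bump e c d t * inner (fst x) (rep_L2 q t) \<partial>lborel)"
        by (simp only: inner_tensor_L2[OF sq])
      moreover have "(\<integral>t. bump e c d t * inner (snd x) (rep_L2 u t) - bump e c d t * inner (fst x) (rep_L2 q t) \<partial>lborel)
          = (\<integral>t. bump e c d t * inner (snd x) (rep_L2 u t) \<partial>lborel)
            - (\<integral>t. bump e c d t * inner (fst x) (rep_L2 q t) \<partial>lborel)"
        by (intro Bochner_Integration.integral_diff integrable_mult_square_integrable sq square_integrable_inner_rep)
      ultimately show "(\<integral>t. bump e c d t * k t \<partial>lborel) = 0"
        by (simp add: k_def right_diff_distrib)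
    qed
    then show ?thesis
      by eventually_elim (simp add: k_def)
  qed
  then have "AE t in lborel. \<forall>x\<in>T. t \<in> ray s b \<longrightarrow> inner (snd x) (rep_L2 u t) = inner (fst x) (rep_L2 q t)"
    unfolding AE_ball_countable[OF T(1)] by blast
  then show ?thesis
    unfolding fibrewise_def using u[unfolded mem_L2_on] q[unfolded mem_L2_on]
  proof eventually_elim
    case (elim t)
    show ?case
    proof (rule selfadjointI[OF B])
      fix g g'
      assume g: "(g, g') \<in> B"
      show "inner g' (rep_L2 u t) = inner g (rep_L2 q t)"
      proof (cases "t \<in> ray s b")
        case True
        have "closed {x. inner (snd x) (rep_L2 u t) = inner (fst x) (rep_L2 q t)}"
          by (intro closed_Collect_eq continuous_intros)
        then have "closure T \<subseteq> {x. inner (snd x) (rep_L2 u t) = inner (fst x) (rep_L2 q t)}"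
          using elim(1) True by (intro closure_minimal) auto
        then show ?thesis
          using g T(3) by fastforce
      qed (use elim in simp)
    qed
  qed
qed

lemma fibrewise_tensor:
  fixes B :: "'h::{chilbert_space, second_countable_topology} rel"
  assumes B: "csubspace B" and g: "(g, g') \<in> B" and \<psi>: "square_integrable \<psi>"
  shows "fibrewise B (tensor_L2 \<psi> g) (tensor_L2 \<psi> g')"
  unfolding fibrewise_def
  using rep_tensor_L2[OF \<psi>, of g] rep_tensor_L2[OF \<psi>, of g']
  by eventually_elim (simp add: graph_scaleR[OF B g])

lemma fibrewise_symmetric:
  assumes B: "selfadjoint_op UNIV B" and "fibrewise B u q" "fibrewise B v r"
  shows "inner q v = inner u r"
proof (rule inner_L2_cong)
  show "AE t in lborel. inner (rep_L2 q t) (rep_L2 v t) = inner (rep_L2 u t) (rep_L2 r t)"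
    using assms(2,3)[unfolded fibrewise_def] by eventually_elim (rule selfadjoint_symmetric[OF B])
qed

lemma fibrewise_unique:
  assumes B: "selfadjoint_op UNIV B" and "fibrewise B u q" "fibrewise B u r"
  shows "q = r"
proof (rule L2_eqI)
  have sv: "single_valued B"
    using B by (simp add: selfadjoint_op_def linear_op_def)
  show "AE t in lborel. rep_L2 q t = rep_L2 r t"
    using assms(2,3)[unfolded fibrewise_def]
    by eventually_elim (rule single_valuedD[OF sv])
qed

section \<open>Energy in a thin strip\<close>

definition strip :: "real \<Rightarrow> real \<Rightarrow> real \<Rightarrow> real set" where
  "strip s b h = {t. b < s * t \<and> s * t \<le> b + h}"

lemma strip_borel [measurable]: "strip s b h \<in> sets borel"
  unfolding strip_def by measurable

lemma strip_eq: "s = 1 \<or> s = - 1 \<Longrightarrow> strip s b h = (if s = 1 then {b<..b + h} else {- b - h..<- b})"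
  by (auto simp: strip_def)

lemma integral_strip:
  assumes "s = 1 \<or> s = - 1" "0 \<le> h"
  shows "integrable lborel (indicator (strip s b h) :: real \<Rightarrow> real)"
    and "measure lborel (strip s b h) = h"
  using assms by (auto simp: strip_eq intro!: integrable_real_indicator)

lemma restrict_ray_shifted:
  assumes q: "q \<in> L2_on (ray s b)" and h: "0 \<le> h"
  shows "restrict_L2 (ray s (b + h)) q = q - restrict_L2 (strip s b h) q"
proof (rule L2_eqI)
  show "AE t in lborel. rep_L2 (restrict_L2 (ray s (b + h)) q) t = rep_L2 (q - restrict_L2 (strip s b h) q) t"
    using rep_restrict_L2[OF ray_borel, of s "b + h" q] rep_restrict_L2[OF strip_borel, of s b h q]
      rep_diff_L2[of q "restrict_L2 (strip s b h) q"] q[unfolded mem_L2_on]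
    by eventually_elim (use h in \<open>auto simp: indicator_def ray_def strip_def\<close>)
qed

lemma shift_pull_L2:
  assumes s: "s * s = 1"
  shows "shift_L2 (- (s * h)) (pull_L2 s b h q) = restrict_L2 (ray s (b + h)) q"
proof (rule L2_eqI)
  have ray: "t - s * h \<in> ray s b \<longleftrightarrow> t \<in> ray s (b + h)" for t
  proof -
    have "s * (t - s * h) = s * t - h"
      using s by (simp add: right_diff_distrib flip: mult.assoc)
    then show ?thesis
      by (auto simp: ray_def)
  qed
  show "AE t in lborel. rep_L2 (shift_L2 (- (s * h)) (pull_L2 s b h q)) t = rep_L2 (restrict_L2 (ray s (b + h)) q) t"
    using rep_restrict_L2[OF ray_borel, of s "b + h" q] rep_shift_L2[of "- (s * h)" "pull_L2 s b h q"]
      AE_translate[OF rep_restrict_L2[OF ray_borel, of s b "shift_L2 (s * h) q"], of "- (s * h)"]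
      AE_translate[OF rep_shift_L2[of "s * h" q], of "- (s * h)"]
    by eventually_elim (simp add: pull_L2_def indicator_def ray)
qed

context
  fixes s b :: real and B :: "'h::{chilbert_space, second_countable_topology} rel" and u q :: "'h L2"
  assumes s: "s = 1 \<or> s = - 1" and B: "selfadjoint_op UNIV B" and nonneg: "nonneg_op B"
    and u: "u \<in> L2_on (ray s b)" and q: "q \<in> L2_on (ray s b)" and uq: "fibrewise B u q"
begin

lemma inner_nonneg_B: "(f, f') \<in> B \<Longrightarrow> 0 \<le> inner f' f"
  using nonneg by (auto simp: nonneg_op_def inner_eq_Re_cinner)

lemma strip_energy_nonneg: "0 \<le> inner (restrict_L2 (strip s b h) q) u"
proof (rule inner_L2_nonneg)
  show "AE t in lborel. 0 \<le> inner (rep_L2 (restrict_L2 (strip s b h) q) t) (rep_L2 u t)"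
    using rep_restrict_L2[OF strip_borel, of s b h q] uq[unfolded fibrewise_def]
    by eventually_elim (simp add: inner_nonneg_B)
qed

text \<open>
  Convexity of the quadratic form gives the energy of the translate a linear lower bound, and the
  energy lost by translating is exactly the energy in the strip.
\<close>

lemma strip_energy_le:
  assumes h: "0 \<le> h"
  shows "inner (restrict_L2 (strip s b h) q) u \<le> - 2 * inner q (pull_L2 s b h u - u)"
proof -
  let ?u = "pull_L2 s b h u" and ?q = "pull_L2 s b h q"
  note cs = selfadjoint_csubspace[OF B]
  have fib: "fibrewise B ?u ?q"
    unfolding fibrewise_def
    using rep_restrict_L2[OF ray_borel, of s b "shift_L2 (s * h) q"] rep_restrict_L2[OF ray_borel, of s b "shift_L2 (s * h) u"]
      rep_shift_L2[of "s * h" q] rep_shift_L2[of "s * h" u] AE_translate[OF uq[unfolded fibrewise_def], of "s * h"]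
    by eventually_elim (simp add: pull_L2_def graph_scaleR[OF cs])
  have "0 \<le> inner (?q - q) (?u - u)"
  proof (rule inner_L2_nonneg)
    show "AE t in lborel. 0 \<le> inner (rep_L2 (?q - q) t) (rep_L2 (?u - u) t)"
      using rep_diff_L2[of ?q q] rep_diff_L2[of ?u u] fib[unfolded fibrewise_def] uq[unfolded fibrewise_def]
      by eventually_elim (simp add: inner_nonneg_B graph_diff[OF cs])
  qed
  moreover have "inner ?q u = inner q ?u"
    using fibrewise_symmetric[OF B fib uq] by (simp add: inner_commute)
  moreover have "inner ?q ?u = inner q u - inner (restrict_L2 (strip s b h) q) u"
  proof -
    have "inner ?q ?u = inner (restrict_L2 (ray s (b + h)) q) u"
    proof -
      have "s * s = 1"
        using s by auto
      then show ?thesis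
        by (simp only: inner_pull_L2[OF pull_in_L2_on] shift_pull_L2)
    qed
    then show ?thesis
      by (simp add: restrict_ray_shifted[OF q h] inner_diff_left)
  qed
  ultimately show ?thesis
    by (simp add: inner_diff_left inner_diff_right)
qed

text \<open>
  Expanding \<open>\<langle>B (x \<plusminus> r k), x \<plusminus> r k\<rangle> \<ge> 0\<close> gives \<open>2 r \<bar>\<langle>B k, x\<rangle>\<bar> \<le> \<langle>B x, x\<rangle> + r\<^sup>2 \<langle>B k, k\<rangle>\<close>, which is the
  Cauchy-Schwarz inequality for the form of \<open>B\<close> in a shape that can be integrated over the strip.
\<close>

lemma strip_inner_le:
  assumes h: "0 \<le> h" and r: "0 < r" and k: "(k, g) \<in> B"
    and \<psi>: "square_integrable \<psi>" "\<And>t. t \<in> ray s b \<Longrightarrow> \<bar>\<psi> t\<bar> \<le> M"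
  shows "\<bar>inner (restrict_L2 (strip s b h) (tensor_L2 \<psi> g)) u\<bar>
    \<le> M / (2 * r) * (inner (restrict_L2 (strip s b h) q) u + r\<^sup>2 * inner g k * h)"
proof -
  note cs = selfadjoint_csubspace[OF B]
  let ?R = "restrict_L2 (strip s b h)"
  let ?f = "\<lambda>t. inner (rep_L2 (?R (tensor_L2 \<psi> g)) t) (rep_L2 u t)"
  let ?w = "\<lambda>t. M / (2 * r) * (inner (rep_L2 (?R q) t) (rep_L2 u t) + r\<^sup>2 * inner g k * indicator (strip s b h) t)"
  have pw: "2 * r * \<bar>inner g x\<bar> \<le> inner y x + r\<^sup>2 * inner g k" if x: "(x, y) \<in> B" for x y
  proof -
    have sym: "inner y k = inner g x"
      using selfadjoint_symmetric[OF B x k] by (simp add: inner_commute)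
    have "0 \<le> inner (y + r *\<^sub>R g) (x + r *\<^sub>R k)" "0 \<le> inner (y - r *\<^sub>R g) (x - r *\<^sub>R k)"
      by (intro inner_nonneg_B graph_add[OF cs] graph_diff[OF cs] graph_scaleR[OF cs] x k)+
    then have "0 \<le> inner y x + 2 * r * inner g x + r\<^sup>2 * inner g k"
        "0 \<le> inner y x - 2 * r * inner g x + r\<^sup>2 * inner g k"
      by (simp_all add: inner_add_left inner_add_right inner_diff_left inner_diff_right sym
          power2_eq_square algebra_simps)
    then show ?thesis
      using r by (auto simp: abs_if)
  qed
  have iw: "integrable lborel ?w"
    by (intro integrable_mult_right Bochner_Integration.integrable_add integrable_inner_rep integral_strip s h)
  have le: "AE t in lborel. \<bar>?f t\<bar> \<le> ?w t"
    using rep_restrict_L2[OF strip_borel, of s b h "tensor_L2 \<psi> g"] rep_tensor_L2[OF \<psi>(1), of g]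
      rep_restrict_L2[OF strip_borel, of s b h q] uq[unfolded fibrewise_def]
  proof eventually_elim
    case (elim t)
    show ?case
    proof (cases "t \<in> strip s b h")
      case True
      then have M: "\<bar>\<psi> t\<bar> \<le> M"
        by (intro \<psi>(2)) (simp add: strip_def ray_def)
      have "\<bar>\<psi> t\<bar> * (2 * r * \<bar>inner g (rep_L2 u t)\<bar>) \<le> M * (inner (rep_L2 q t) (rep_L2 u t) + r\<^sup>2 * inner g k)"
        using M pw[OF elim(4)] r by (intro mult_mono) auto
      then show ?thesis
        using True elim r by (simp add: abs_mult field_simps)
    qed (use elim in simp)
  qed
  have "\<bar>inner (?R (tensor_L2 \<psi> g)) u\<bar> \<le> (\<integral>t. \<bar>?f t\<bar> \<partial>lborel)"
    unfolding inner_L2_integral by (rule integral_abs_bound)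
  also have "\<dots> \<le> integral\<^sup>L lborel ?w"
    by (intro integral_mono_AE iw integrable_abs integrable_inner_rep) (use le in simp)
  also have "\<dots> = M / (2 * r) * (inner (?R q) u + r\<^sup>2 * inner g k * h)"
    by (simp add: Bochner_Integration.integral_add integrable_inner_rep integral_strip[OF s h] inner_L2_integral)
  finally show ?thesis .
qed

section \<open>Boundary values of functions without boundary energy\<close>

context
  fixes p :: "'h L2" and D :: "'h set"
  assumes D: "closure D = UNIV" and p: "weak_deriv s b D u p"
begin

text \<open>
  The inner product is, formally, minus half of the energy \<open>\<langle>B u, u\<rangle>\<close> at the boundary.
\<close>

lemma energy_deriv_nonpos: "inner q p \<le> 0"
proof (rule tendsto_upperbound)
  show "((\<lambda>h. inner q (pull_L2 s b h u - u) / h) \<longlongrightarrow> inner q p) (at_right 0)"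
    by (rule pull_diff_weakly_tendsto[OF s D u p q])
  show "\<forall>\<^sub>F h in at_right 0. inner q (pull_L2 s b h u - u) / h \<le> 0"
    using eventually_at_right_less[of 0]
  proof eventually_elim
    case (elim h)
    then show ?case
      using strip_energy_le[of h] strip_energy_nonneg[of h] by (simp add: divide_le_0_iff)
  qed
qed simp

lemma strip_energy_small:
  assumes zero: "inner q p = 0"
  shows "((\<lambda>h. inner (restrict_L2 (strip s b h) q) u / h) \<longlongrightarrow> 0) (at_right 0)"
proof (rule tendsto_sandwich)
  show "\<forall>\<^sub>F h in at_right 0. 0 \<le> inner (restrict_L2 (strip s b h) q) u / h"
    using eventually_at_right_less[of 0] by eventually_elim (simp add: strip_energy_nonneg)
  show "\<forall>\<^sub>F h in at_right 0. inner (restrict_L2 (strip s b h) q) u / h \<le> - 2 * (inner q (pull_L2 s b h u - u) / h)"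
    using eventually_at_right_less[of 0]
  proof eventually_elim
    case (elim h)
    then show ?case
      using divide_right_mono[OF strip_energy_le[of h], of h] by simp
  qed
  show "((\<lambda>h. - 2 * (inner q (pull_L2 s b h u - u) / h)) \<longlongrightarrow> 0) (at_right 0)"
    using tendsto_mult[OF tendsto_const[of "- 2"] pull_diff_weakly_tendsto[OF s D u p q]] zero by simp
qed simp

text \<open>
  The parameter \<open>r\<close> of the integrated Cauchy-Schwarz inequality is free: a small \<open>r\<close> absorbs the
  term from the fixed vector, and then a small \<open>h\<close> absorbs the energy.
\<close>

lemma strip_inner_small:
  assumes zero: "inner q p = 0" and k: "(k, g) \<in> B"
    and \<psi>: "square_integrable \<psi>" "\<And>t. t \<in> ray s b \<Longrightarrow> \<bar>\<psi> t\<bar> \<le> M"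
  shows "((\<lambda>h. inner (restrict_L2 (strip s b h) (tensor_L2 \<psi> g)) u / h) \<longlongrightarrow> 0) (at_right 0)"
proof (rule tendstoI)
  fix \<epsilon> :: real
  assume eps: "0 < \<epsilon>"
  let ?E = "\<lambda>h. inner (restrict_L2 (strip s b h) q) u"
  have gk: "0 \<le> inner g k"
    by (rule inner_nonneg_B[OF k])
  have M: "0 \<le> M"
  proof -
    have "\<bar>\<psi> (s * (b + 1))\<bar> \<le> M"
      using s by (intro \<psi>(2)) (auto simp: ray_def)
    then show ?thesis
      by linarith
  qed
  define r where "r = \<epsilon> / (M * inner g k + 1)"
  have r: "0 < r" "M * inner g k * r \<le> \<epsilon>"
  proof -
    have pos: "0 < M * inner g k + 1"
      using M gk by (intro add_nonneg_pos mult_nonneg_nonneg) auto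
    then show "0 < r"
      using eps by (simp add: r_def)
    show "M * inner g k * r \<le> \<epsilon>"
      using eps pos by (simp add: r_def pos_divide_le_eq algebra_simps)
  qed
  have "((\<lambda>h. M / (2 * r) * (?E h / h)) \<longlongrightarrow> M / (2 * r) * 0) (at_right 0)"
    by (intro tendsto_intros strip_energy_small zero)
  then have "\<forall>\<^sub>F h in at_right 0. M / (2 * r) * (?E h / h) < \<epsilon> / 2"
    by (rule order_tendstoD) (use eps in simp)
  then show "\<forall>\<^sub>F h in at_right 0. dist (inner (restrict_L2 (strip s b h) (tensor_L2 \<psi> g)) u / h) 0 < \<epsilon>"
    using eventually_at_right_less[of 0]
  proof eventually_elim
    case (elim h)
    have "\<bar>inner (restrict_L2 (strip s b h) (tensor_L2 \<psi> g)) u\<bar> / h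
        \<le> M / (2 * r) * (?E h + r\<^sup>2 * inner g k * h) / h"
      using elim(2) by (intro divide_right_mono strip_inner_le[OF _ r(1) k \<psi>]) auto
    also have "\<dots> = M / (2 * r) * (?E h / h) + M * inner g k * r / 2"
      using elim(2) r(1) by (simp add: field_simps power2_eq_square)
    also have "\<dots> < \<epsilon>"
      using elim(1) r(2) by linarith
    finally show ?case
      using elim(2) by (simp add: dist_real_def)
  qed
qed

end

end

text \<open>
  Up to a constant factor, \<open>exp (- s t)\<close> is invariant under translation along the ray, so the
  boundary term of an integration by parts appears as the integral over a strip.
\<close>

definition decay :: "real \<Rightarrow> real \<Rightarrow> real \<Rightarrow> real" where
  "decay s b t = indicator (ray s b) t * exp (- (s * t))"

lemma decay_bounded: "\<bar>decay s b t\<bar> \<le> exp (- b)"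
  by (auto simp: decay_def ray_def indicator_def)

lemma square_integrable_decay:
  assumes "s = 1 \<or> s = - 1"
  shows "square_integrable (decay s b)"
proof -
  have "(\<integral>\<^sup>+t. ennreal (exp (- 2 * t)) * indicator {b..} t \<partial>lborel) = ennreal (0 - (- exp (- 2 * b) / 2))"
  proof (rule nn_integral_FTC_atLeast)
    show "((\<lambda>t::real. - exp (- 2 * t) / 2) \<longlongrightarrow> 0) at_top"
      by real_asymp
    show "((\<lambda>t. - exp (- 2 * t) / 2) has_real_derivative exp (- 2 * t)) (at t)" for t :: real
      by (auto intro!: derivative_eq_intros)
  qed auto
  then have "(\<integral>\<^sup>+t. ennreal (exp (- 2 * t)) * indicator {b..} t \<partial>lborel) < \<infinity>"
    by simp
  moreover have "(\<integral>\<^sup>+t. ennreal ((decay 1 b t)\<^sup>2) \<partial>lborel) \<le> (\<integral>\<^sup>+t. ennreal (exp (- 2 * t)) * indicator {b..} t \<partial>lborel)"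
    by (intro nn_integral_mono)
      (auto simp: decay_def ray_def indicator_def power2_eq_square simp flip: exp_add)
  moreover have [measurable]: "decay 1 b \<in> borel_measurable borel"
    unfolding decay_def[abs_def] by measurable
  ultimately have "integrable lborel (\<lambda>t. (decay 1 b t)\<^sup>2)"
    by (intro integrableI_bounded) (auto intro: le_less_trans)
  then have "integrable lborel (\<lambda>t. (decay 1 b (0 + s * t))\<^sup>2)"
    using assms by (intro lborel_integrable_real_affine) auto
  moreover have "(\<lambda>t. decay 1 b (0 + s * t)) = decay s b"
    by (auto simp: decay_def ray_def indicator_def fun_eq_iff)
  moreover have "decay s b \<in> borel_measurable borel"
    unfolding decay_def[abs_def] by measurable
  ultimately show ?thesis
    by (simp add: square_integrable_def fun_eq_iff)
qed

lemma tensor_decay_in_L2_on: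
  assumes "s = 1 \<or> s = - 1"
  shows "tensor_L2 (decay s b) g \<in> L2_on (ray s b)"
  unfolding mem_L2_on using rep_tensor_L2[OF square_integrable_decay[OF assms], of b g]
  by eventually_elim (simp add: decay_def)

lemma shift_tensor_decay:
  assumes s: "s = 1 \<or> s = - 1" and h: "0 \<le> h"
  shows "shift_L2 (- (s * h)) (tensor_L2 (decay s b) g) = exp h *\<^sub>R restrict_L2 (ray s (b + h)) (tensor_L2 (decay s b) g)"
    (is "_ = exp h *\<^sub>R restrict_L2 ?R ?y")
proof (rule L2_eqI)
  note sq = square_integrable_decay[OF s, of b]
  have eq: "decay s b (t - s * h) = exp h * (indicator ?R t * decay s b t)" for t
  proof -
    have "s * (t - s * h) = s * t - h"
      using s by (auto simp: algebra_simps)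
    then show ?thesis
      using h by (auto simp: decay_def indicator_def ray_def simp flip: exp_add)
  qed
  show "AE t in lborel. rep_L2 (shift_L2 (- (s * h)) ?y) t = rep_L2 (exp h *\<^sub>R restrict_L2 ?R ?y) t"
    using rep_shift_L2[of "- (s * h)" ?y] AE_translate[OF rep_tensor_L2[OF sq, of g], of "- (s * h)"]
      rep_tensor_L2[OF sq, of g] rep_restrict_L2[OF ray_borel, of s "b + h" ?y]
      rep_scaleR_L2[of "exp h" "restrict_L2 ?R ?y"]
    by eventually_elim (simp add: eq mult.assoc)
qed

text \<open>
  If \<open>u\<close> carries no energy at the boundary, then its boundary value is orthogonal to the range of
  \<open>B\<close>, so that integrating \<open>p\<close> by parts against \<open>exp (- s t) g\<close> leaves no boundary term.
\<close>

lemma inner_decay_deriv: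
  fixes B :: "'h::{chilbert_space, second_countable_topology} rel"
  assumes s: "s = 1 \<or> s = - 1" and B: "selfadjoint_op UNIV B" and nonneg: "nonneg_op B"
    and u: "u \<in> L2_on (ray s b)" and q: "q \<in> L2_on (ray s b)" and uq: "fibrewise B u q"
    and D: "closure D = UNIV" and p: "weak_deriv s b D u p"
    and zero: "inner q p = 0" and k: "(k, g) \<in> B"
  shows "inner (tensor_L2 (decay s b) g) p = inner (tensor_L2 (decay s b) g) u"
proof -
  let ?y = "tensor_L2 (decay s b) g"
  have y: "?y \<in> L2_on (ray s b)"
    by (rule tensor_decay_in_L2_on[OF s])
  have "((\<lambda>h. (exp h - 1) / h * inner ?y u - exp h * (inner (restrict_L2 (strip s b h) ?y) u / h))
      \<longlongrightarrow> 1 * inner ?y u - 1 * 0) (at_right 0)"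
  proof (intro tendsto_diff tendsto_mult tendsto_const)
    show "((\<lambda>h::real. (exp h - 1) / h) \<longlongrightarrow> 1) (at_right 0)" "((\<lambda>h::real. exp h) \<longlongrightarrow> 1) (at_right 0)"
      by real_asymp+
    show "((\<lambda>h. inner (restrict_L2 (strip s b h) ?y) u / h) \<longlongrightarrow> 0) (at_right 0)"
      by (rule strip_inner_small[OF s B nonneg u q uq D p zero k square_integrable_decay[OF s] decay_bounded])
  qed
  moreover have "\<forall>\<^sub>F h in at_right 0. (exp h - 1) / h * inner ?y u - exp h * (inner (restrict_L2 (strip s b h) ?y) u / h)
      = inner ?y (pull_L2 s b h u - u) / h"
    using eventually_at_right_less[of 0]
  proof eventually_elim
    case (elim h)
    have "inner ?y (pull_L2 s b h u) = exp h * (inner ?y u - inner (restrict_L2 (strip s b h) ?y) u)"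
      using elim by (simp only: inner_pull_L2[OF y] shift_tensor_decay[OF s] restrict_ray_shifted[OF y]
          inner_diff_left inner_scaleR_left less_imp_le)
    then show ?case
      by (simp add: inner_diff_right diff_divide_distrib left_diff_distrib right_diff_distrib)
  qed
  ultimately have "((\<lambda>h. inner ?y (pull_L2 s b h u - u) / h) \<longlongrightarrow> inner ?y u) (at_right 0)"
    by (simp add: filterlim_cong[OF refl refl])
  moreover have "((\<lambda>h. inner ?y (pull_L2 s b h u - u) / h) \<longlongrightarrow> inner ?y p) (at_right 0)"
    by (rule pull_diff_weakly_tendsto[OF s D u p y])
  ultimately show ?thesis
    using tendsto_unique trivial_limit_at_right_real by blast
qed

section \<open>Normal extensions\<close>

text \<open>
  The two rays are indexed by truth values, \<open>True\<close> for the first component, so that every statement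
  about one component is made once.
\<close>

definition insert_component :: "bool \<Rightarrow> 'h \<Rightarrow> 'h \<times> 'h::zero" where
  "insert_component j x = (if j then (x, 0) else (0, x))"

definition component :: "bool \<Rightarrow> 'h \<times> 'h \<Rightarrow> 'h" where
  "component j z = (if j then fst z else snd z)"

lemma component_insert: "component i (insert_component j x) = (if i = j then x else 0)"
  by (auto simp: component_def insert_component_def)

lemma component_simps [simp]:
  "component j (x + y) = component j x + component j (y :: 'h::real_vector \<times> 'h)"
  "component j (x - y) = component j x - component j y"
  "component j (- x) = - component j x"
  "component j 0 = (0 :: 'h)"
  "component j (r *\<^sub>R x) = r *\<^sub>R component j x"
  by (auto simp: component_def)

lemma component_scaleC [simp]: "component j (c *\<^sub>C x) = c *\<^sub>C component j (x :: 'h::complex_inner \<times> 'h)"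
  by (simp add: component_def scaleC_prod_def)

lemma component_eqI: "(\<And>j. component j x = component j y) \<Longrightarrow> x = y"
  by (metis component_def prod_eq_iff)

lemma inner_insert_component_left: "inner (insert_component j x) z = inner x (component j (z :: 'h::real_inner \<times> 'h))"
  by (cases z) (simp add: insert_component_def component_def inner_prod_def)

lemma inner_insert_component_right: "inner z (insert_component j x) = inner (component j (z :: 'h::real_inner \<times> 'h)) x"
  by (metis inner_commute inner_insert_component_left)

lemma inner_components:
  "inner x y = inner (component True x) (component True y) + inner (component False x) (component False (y :: 'h::real_inner \<times> 'h))"
  by (simp add: component_def inner_prod_def)

lemma integral_bump_product_rule:
  assumes "0 < e" "0 < e'"
  shows "(\<integral>t. bump' e c d t * bump e' c' d' t \<partial>lborel) = - (\<integral>t. bump e c d t * bump' e' c' d' t \<partial>lborel)"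
proof -
  let ?F = "\<lambda>t. bump e c d t * bump e' c' d' t"
  let ?f = "\<lambda>t. bump' e c d t * bump e' c' d' t + bump e c d t * bump' e' c' d' t"
  have F: "(?F has_real_derivative ?f t) (at t)" for t
    by (rule DERIV_cong[OF DERIV_mult[OF DERIV_bump[OF assms(1)] DERIV_bump[OF assms(2)]]]) simp
  have supp: "?f t = ?f t * indicator {c..max c d} t" for t
    by (cases "t \<in> {c<..<d}") (auto simp: bump_eq_0)
  have "integral\<^sup>L lborel ?f = (\<integral>t. ?f t * indicator {c..max c d} t \<partial>lborel)"
    by (subst supp) simp
  also have "\<dots> = ?F (max c d) - ?F c"
  proof (rule integral_FTC_Icc_real)
    have "continuous_on UNIV ?f"
      by (intro continuous_intros continuous_bump assms)
    then show "isCont ?f t" for t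
      by (simp add: continuous_on_eq_continuous_at)
  qed (use F in auto)
  also have "\<dots> = 0"
    by (simp add: bump_eq_0)
  finally show ?thesis
    by (simp add: Bochner_Integration.integral_add integrable_mult_square_integrable square_integrable_bump assms)
qed

text \<open>
  A normal operator that extends the minimal operator of \<open>u' + s B u\<close> on two rays with outward
  directions \<open>s\<close>. On the left ray \<open>s = - 1\<close>, so that \<open>B = - A\<^sub>1\<close> is nonnegative as well. The minimal
  operator enters through the bumps with values in the domain of \<open>B\<close>.
\<close>

locale two_ray_normal =
  fixes B :: "bool \<Rightarrow> 'h::{chilbert_space, second_countable_topology} rel"
    and s b :: "bool \<Rightarrow> real"
    and K :: "('h L2 \<times> 'h L2) set" and N :: "('h L2 \<times> 'h L2) rel"
  assumes s: "\<And>j. s j = 1 \<or> s j = - 1"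
    and B: "\<And>j. selfadjoint_op UNIV (B j)" and nonneg: "\<And>j. nonneg_op (B j)"
    and K_def: "K = {z. \<forall>j. component j z \<in> L2_on (ray (s j) (b j))}"
    and N: "normal_op K N"
    and minimal: "\<And>j e c d g g'. 0 < e \<Longrightarrow> c < d \<Longrightarrow> {c..d} \<subseteq> ray (s j) (b j) \<Longrightarrow> (g, g') \<in> B j \<Longrightarrow>
      (insert_component j (tensor_L2 (bump e c d) g),
       insert_component j (tensor_L2 (bump' e c d) g + s j *\<^sub>R tensor_L2 (bump e c d) g')) \<in> N"
begin

abbreviation "adj \<equiv> adjoint_op K N"

lemma s_sq [simp]: "s j * s j = 1" "s j * (s j * x) = x"
  using s[of j] by auto

lemma component_in_L2_on: "z \<in> K \<Longrightarrow> component j z \<in> L2_on (ray (s j) (b j))"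
  by (simp add: K_def)

lemma csubspace_K: "csubspace K"
proof -
  have "c *\<^sub>C f \<in> L2_on S" if "f \<in> L2_on S" for c S and f :: "'h L2"
    using csubspace_L2_on[of S, where 'h = 'h] that unfolding csubspace_def by blast
  then show ?thesis
    by (auto simp: csubspace_def K_def simp del: split_paired_All
        intro: subspace_0[OF subspace_L2_on] subspace_add[OF subspace_L2_on])
qed

lemma insert_component_in_K: "x \<in> L2_on (ray (s j) (b j)) \<Longrightarrow> insert_component j x \<in> K"
  using subspace_0[OF subspace_L2_on] by (simp add: K_def component_insert)

lemma complete_K: "complete K"
proof -
  have "K = (\<Inter>j. component j -` L2_on (ray (s j) (b j)))"
    by (auto simp: K_def)
  moreover have "continuous_on UNIV (component j :: 'h L2 \<times> 'h L2 \<Rightarrow> 'h L2)" for j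
    unfolding component_def[abs_def] by (cases j) (auto intro: continuous_intros)
  ultimately have "closed K"
    by (auto intro!: closed_INT closed_vimage closed_L2_on)
  then show ?thesis
    by (simp add: complete_eq_closed)
qed

lemma N_facts: "csubspace N" "N \<subseteq> K \<times> K" "closed N" "single_valued N" "Domain N = Domain adj"
  using N by (auto simp: normal_op_def formally_normal_def linear_op_def)

lemma norm_eq: "(u, v) \<in> N \<Longrightarrow> (u, w) \<in> adj \<Longrightarrow> norm v = norm w"
  using N unfolding normal_op_def formally_normal_def by blast

lemma adj_iff: "(u, w) \<in> adj \<longleftrightarrow> u \<in> K \<and> w \<in> K \<and> (\<forall>(x, y) \<in> N. inner y u = inner x w)"
  by (rule adjoint_op_iff[OF N_facts(1)])

lemma domain_dense: "closure (Domain (B j)) = UNIV"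
  using B[of j] by (auto simp: selfadjoint_op_def densely_defined_def)

lemma total_K:
  assumes "z \<in> K"
    and "\<And>j e c d g g'. 0 < e \<Longrightarrow> c < d \<Longrightarrow> {c..d} \<subseteq> ray (s j) (b j) \<Longrightarrow> (g, g') \<in> B j \<Longrightarrow>
      inner (tensor_L2 (bump e c d) g) (component j z) = 0"
  shows "z = 0"
proof (rule component_eqI)
  fix j
  have "component j z = 0"
  proof (rule bump_tensors_total[OF s domain_dense component_in_L2_on[OF assms(1)]])
    fix x
    assume "x \<in> bump_tensors (ray (s j) (b j)) (Domain (B j))"
    then show "inner x (component j z) = 0"
      unfolding bump_tensors_def using assms(2) by blast
  qed
  then show "component j z = component j 0"
    by simp
qed

text \<open>
  A bump lies in the domain of \<open>N\<close>, hence in that of the adjoint. The value of the adjoint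
  there is identified by testing with all other bumps.
\<close>

lemma adj_minimal:
  assumes e: "0 < e" and cd: "c < d" "{c..d} \<subseteq> ray (s j) (b j)" and g: "(g, g') \<in> B j"
  shows "(insert_component j (tensor_L2 (bump e c d) g),
     insert_component j (s j *\<^sub>R tensor_L2 (bump e c d) g' - tensor_L2 (bump' e c d) g)) \<in> adj" (is "(?x, ?z) \<in> _")
proof -
  note sq = square_integrable_bump
  obtain z where z: "(?x, z) \<in> adj"
    using minimal[OF e cd g] N_facts(5) by blast
  have xK: "?x \<in> K" and zK: "z \<in> K"
    using z by (auto simp: adj_iff)
  have "tensor_L2 (bump' e c d) g \<in> L2_on (ray (s j) (b j))"
    unfolding mem_L2_on using rep_tensor_L2[OF sq(2)[OF e], of c d g]
  proof eventually_elim
    case (elim t)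
    have "bump' e c d t = 0" if "t \<notin> ray (s j) (b j)"
    proof (rule bump_eq_0(2))
      have "t \<notin> {c..d}"
        using that cd(2) by blast
      then show "t \<notin> {c<..<d}"
        by auto
    qed
    then show ?case
      using elim by simp
  qed
  moreover have "tensor_L2 (bump e c d) g' \<in> L2_on (ray (s j) (b j))"
    using bump_tensorsI[OF e cd UNIV_I] bump_tensors_subset by blast
  ultimately have z'K: "?z \<in> K"
    by (intro insert_component_in_K subspace_diff subspace_scale subspace_L2_on)
  have "z - ?z = 0"
  proof (rule total_K)
    show "z - ?z \<in> K"
      using csubspace_imp_subspace[OF csubspace_K] zK z'K by (rule subspace_diff)
    fix i and e' c' d' :: real and f f'
    assume *: "0 < e'" "c' < d'" "{c'..d'} \<subseteq> ray (s i) (b i)" and f: "(f, f') \<in> B i"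
    let ?y = "tensor_L2 (bump e' c' d') f"
    have "inner (tensor_L2 (bump' e' c' d') f + s i *\<^sub>R tensor_L2 (bump e' c' d') f') (component i ?x)
        = inner ?y (component i z)"
      using z minimal[OF * f] by (auto simp: adj_iff inner_insert_component_left)
    moreover have "inner (tensor_L2 (bump' e' c' d') f + s i *\<^sub>R tensor_L2 (bump e' c' d') f') (component i ?x)
        = inner ?y (component i ?z)"
    proof (cases "i = j")
      case True
      have "inner f' g = inner f g'"
        using selfadjoint_symmetric[OF B f] g True by blast
      then show ?thesis
        using integral_bump_product_rule[OF *(1) e, of c' d' c d] True
        by (simp add: component_insert inner_add_left inner_diff_right inner_tensor_tensor_L2 sq e *(1))
    qed (simp add: component_insert)
    ultimately show "inner ?y (component i (z - ?z)) = 0"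
      by (simp add: inner_diff_right)
  qed
  then show ?thesis
    using z by simp
qed

text \<open>
  The symmetric part \<open>(N + N\<^sup>*) / 2\<close> of the normal operator is fibrewise \<open>s B\<close>, and its
  antisymmetric part \<open>(N - N\<^sup>*) / 2\<close> is the derivative.
\<close>

lemma N_components:
  assumes v: "(u, v) \<in> N" and w: "(u, w) \<in> adj"
  shows "fibrewise (B j) (component j u) ((s j / 2) *\<^sub>R component j (v + w))" (is "fibrewise _ ?u ?q")
    and "weak_deriv (s j) (b j) (Domain (B j)) (component j u) ((s j / 2) *\<^sub>R component j (v - w))"
proof -
  have K: "u \<in> K" "v \<in> K" "w \<in> K"
    using v w N_facts(2) by (auto simp: adj_iff)
  have *: "inner (tensor_L2 (bump' e c d) g) ?u + s j * inner (tensor_L2 (bump e c d) g') ?u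
        = inner (tensor_L2 (bump e c d) g) (component j w)"
      "s j * inner (tensor_L2 (bump e c d) g') ?u - inner (tensor_L2 (bump' e c d) g) ?u
        = inner (tensor_L2 (bump e c d) g) (component j v)"
    if "0 < e" "c < d" "{c..d} \<subseteq> ray (s j) (b j)" "(g, g') \<in> B j" for e c d :: real and g g'
  proof -
    show "inner (tensor_L2 (bump' e c d) g) ?u + s j * inner (tensor_L2 (bump e c d) g') ?u
        = inner (tensor_L2 (bump e c d) g) (component j w)"
      using w minimal[OF that] by (auto simp: adj_iff inner_insert_component_left inner_add_left)
    have "inner v (insert_component j (tensor_L2 (bump e c d) g))
        = inner u (insert_component j (s j *\<^sub>R tensor_L2 (bump e c d) g' - tensor_L2 (bump' e c d) g))"
      using v adj_minimal[OF that] by (auto simp: adj_iff)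
    then show "s j * inner (tensor_L2 (bump e c d) g') ?u - inner (tensor_L2 (bump' e c d) g) ?u
        = inner (tensor_L2 (bump e c d) g) (component j v)"
      by (simp add: inner_insert_component_right inner_diff_right inner_commute)
  qed
  show "fibrewise (B j) ?u ?q"
  proof (rule fibrewise_if_weakly[OF s B])
    show "?u \<in> L2_on (ray (s j) (b j))" "?q \<in> L2_on (ray (s j) (b j))"
      using K by (auto intro!: component_in_L2_on subspace_scale subspace_add subspace_L2_on simp del: scaleR_right_distrib)
    fix e c d :: real and g g'
    assume **: "0 < e" "c < d" "{c..d} \<subseteq> ray (s j) (b j)" "(g, g') \<in> B j"
    have "inner (tensor_L2 (bump e c d) g) (component j (v + w)) = 2 * s j * inner (tensor_L2 (bump e c d) g') ?u"
      using *[OF **] by (simp add: inner_add_right)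
    then show "inner (tensor_L2 (bump e c d) g') ?u = inner (tensor_L2 (bump e c d) g) ?q"
      by (simp del: component_simps)
  qed
  show "weak_deriv (s j) (b j) (Domain (B j)) ?u ((s j / 2) *\<^sub>R component j (v - w))"
    unfolding weak_deriv_def
  proof (intro allI impI)
    fix e c d :: real and g
    assume **: "0 < e" "c < d" "{c..d} \<subseteq> ray (s j) (b j)" "g \<in> Domain (B j)"
    then obtain g' where g': "(g, g') \<in> B j"
      by blast
    have "inner (tensor_L2 (bump e c d) g) (component j (v - w)) = - 2 * inner (tensor_L2 (bump' e c d) g) ?u"
      using *[OF **(1-3) g'] by (simp add: inner_diff_right)
    then show "- (s j * inner (tensor_L2 (bump' e c d) g) ?u)
        = inner (tensor_L2 (bump e c d) g) ((s j / 2) *\<^sub>R component j (v - w))"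
      by (simp del: component_simps)
  qed
qed

text \<open>
  Normality, \<open>\<parallel>N u\<parallel> = \<parallel>N\<^sup>* u\<parallel>\<close>, says that the symmetric and the antisymmetric part are
  orthogonal in total. On each ray their inner product is minus half of the energy at the boundary,
  which is nonnegative on both rays, so both inner products vanish.
\<close>

lemma energy_deriv_zero:
  assumes v: "(u, v) \<in> N" and w: "(u, w) \<in> adj"
  shows "inner ((s j / 2) *\<^sub>R component j (v + w)) ((s j / 2) *\<^sub>R component j (v - w)) = 0"
proof -
  let ?q = "\<lambda>j. (s j / 2) *\<^sub>R component j (v + w)" and ?p = "\<lambda>j. (s j / 2) *\<^sub>R component j (v - w)"
  have K: "u \<in> K" "v \<in> K" "w \<in> K"
    using v w N_facts(2) by (auto simp: adj_iff)
  have qK: "?q j \<in> L2_on (ray (s j) (b j))" for j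
    using K by (auto intro!: component_in_L2_on subspace_scale subspace_add subspace_L2_on simp del: scaleR_right_distrib)
  have le: "inner (?q j) (?p j) \<le> 0" for j
    by (rule energy_deriv_nonpos[OF s B nonneg component_in_L2_on[OF K(1)] qK
          N_components(1)[OF v w] domain_dense N_components(2)[OF v w]])
  have eq: "inner (?q j) (?p j) = (inner (component j v) (component j v) - inner (component j w) (component j w)) / 4" for j
  proof -
    have "inner (x + y) (x - y) = inner x x - inner y y" for x y :: "'h L2"
      by (simp add: inner_add_left inner_diff_right inner_commute algebra_simps)
    then show ?thesis
      by (simp only: component_simps(1,2) inner_scaleR_left inner_scaleR_right) simp
  qed
  have "inner (?q True) (?p True) + inner (?q False) (?p False) = (inner v v - inner w w) / 4"
    unfolding eq inner_components[of v v] inner_components[of w w] by argo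
  also have "\<dots> = 0"
    using norm_eq[OF v w] by (simp flip: power2_norm_eq_inner)
  finally have "inner (?q True) (?p True) + inner (?q False) (?p False) = 0" .
  then have "inner (?q True) (?p True) = 0 \<and> inner (?q False) (?p False) = 0"
    using le[of True] le[of False] by argo
  then show ?thesis
    by (metis (full_types))
qed

lemma no_boundary_term:
  assumes v: "(u, v) \<in> N" and w: "(u, w) \<in> adj" and k: "(k, g) \<in> B j"
  shows "inner (tensor_L2 (decay (s j) (b j)) g) ((s j / 2) *\<^sub>R component j (v - w))
    = inner (tensor_L2 (decay (s j) (b j)) g) (component j u)"
proof (rule inner_decay_deriv[OF s B nonneg _ _ N_components(1)[OF v w] domain_dense N_components(2)[OF v w]
      energy_deriv_zero[OF v w] k])
  have K: "u \<in> K" "v \<in> K" "w \<in> K"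
    using v w N_facts(2) by (auto simp: adj_iff)
  show "component j u \<in> L2_on (ray (s j) (b j))"
      "(s j / 2) *\<^sub>R component j (v + w) \<in> L2_on (ray (s j) (b j))"
    using K by (auto intro!: component_in_L2_on subspace_scale subspace_add subspace_L2_on simp del: scaleR_right_distrib)
qed

lemma tensor_decay_eq_0:
  fixes g :: 'h
  assumes "tensor_L2 (decay (s j) (b j)) g = 0"
  shows "g = 0"
proof (rule ccontr)
  assume g: "g \<noteq> 0"
  have "AE t in lborel. t \<notin> strip (s j) (b j) 1"
    using rep_tensor_L2[OF square_integrable_decay[OF s], of j "b j" g] rep_zero_L2[where 'a = 'h]
    unfolding assms
  proof eventually_elim
    case (elim t)
    have "decay (s j) (b j) t *\<^sub>R g = 0"
      using elim(1) unfolding elim(2) by (rule sym)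
    then have "decay (s j) (b j) t = 0"
      using g by simp
    then show ?case
      by (auto simp: decay_def strip_def ray_def)
  qed
  then have "strip (s j) (b j) 1 \<in> null_sets lborel"
    by (subst AE_iff_null_sets) auto
  then show False
    using integral_strip(2)[OF s, of 1 j "b j", OF zero_le_one] by (simp add: measure_def null_sets_def)
qed

text \<open>
  For \<open>g\<close> in the domain and in the range of \<open>B\<close> the function \<open>y(t) = exp (- s t) g\<close> lies in the domain of
  the adjoint, because no boundary term arises. Hence it lies in the domain of \<open>N\<close> as well, and
  there its outward derivative is \<open>- y\<close>, so that \<open>no_boundary_term\<close> reads \<open>- \<parallel>y\<parallel>\<^sup>2 = \<parallel>y\<parallel>\<^sup>2\<close>.
\<close>

lemma range_domain_trivial:
  assumes k: "(k, g) \<in> B j" and g: "(g, g') \<in> B j"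
  shows "g = 0"
proof -
  let ?y = "tensor_L2 (decay (s j) (b j)) g" and ?y' = "tensor_L2 (decay (s j) (b j)) g'"
  define z where "z = insert_component j (s j *\<^sub>R (?y + ?y'))"
  have fy: "fibrewise (B j) ?y ?y'"
    by (rule fibrewise_tensor[OF selfadjoint_csubspace[OF B] g square_integrable_decay[OF s]])
  have adj: "(insert_component j ?y, z) \<in> adj"
    unfolding adj_iff
  proof (intro conjI ballI, safe)
    show "insert_component j ?y \<in> K" "z \<in> K"
      unfolding z_def
      by (intro insert_component_in_K subspace_scale subspace_add subspace_L2_on tensor_decay_in_L2_on s)+
    fix u1 u2 v1 v2 :: "'h L2"
    let ?u = "(u1, u2)" and ?v = "(v1, v2)"
    assume v: "(?u, ?v) \<in> N"
    then obtain w where w: "(?u, w) \<in> adj"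
      using N_facts(5) by blast
    have "inner ((s j / 2) *\<^sub>R component j (?v + w)) ?y = inner (component j ?u) ?y'"
      by (rule fibrewise_symmetric[OF B N_components(1)[OF v w] fy])
    moreover have "component j ?v = s j *\<^sub>R ((s j / 2) *\<^sub>R component j (?v - w) + (s j / 2) *\<^sub>R component j (?v + w))"
    proof -
      have "(1 / 2) *\<^sub>R x + (1 / 2) *\<^sub>R x = x" for x :: "'h L2"
        by (simp flip: scaleR_add_left)
      then show ?thesis
        by (simp add: scaleR_add_right scaleR_diff_right del: component_simps(1,2))
          (simp add: scaleR_add_right scaleR_diff_right)
    qed
    ultimately show "inner ?v (insert_component j ?y) = inner ?u z"
      using no_boundary_term[OF v w k]
      by (simp add: z_def inner_insert_component_right inner_add_left inner_add_right inner_commute del: component_simps)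
  qed
  then obtain v where v: "(insert_component j ?y, v) \<in> N"
    using N_facts(5) by blast
  have "(s j / 2) *\<^sub>R component j (v + z) = ?y'"
    using N_components(1)[OF v adj, of j] fy
    by (intro fibrewise_unique[OF B]) (simp_all add: component_insert del: component_simps)
  moreover have "(s j / 2) *\<^sub>R component j (v - z) = (s j / 2) *\<^sub>R component j (v + z) - s j *\<^sub>R component j z"
  proof -
    have "v - z = (v + z) - 2 *\<^sub>R z"
      by (simp add: scaleR_2)
    then show ?thesis
      by (simp only: component_simps(2,5) scaleR_diff_right) simp
  qed
  moreover have "s j *\<^sub>R component j z = ?y + ?y'"
    by (simp add: z_def component_insert)
  ultimately have "(s j / 2) *\<^sub>R component j (v - z) = - ?y"
    by simp
  then have "inner ?y (- ?y) = inner ?y ?y"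
    using no_boundary_term[OF v adj k] by (simp add: component_insert)
  then have "?y = 0"
    by simp
  then show ?thesis
    by (rule tensor_decay_eq_0)
qed

lemma B_trivial: "(f, 0) \<in> B j"
  using selfadjoint_trivial[OF B] range_domain_trivial by blast

text \<open>
  With \<open>B = 0\<close> the symmetric part of \<open>N\<close> vanishes.
\<close>

lemma adj_eq_uminus:
  assumes v: "(u, v) \<in> N" and w: "(u, w) \<in> adj"
  shows "w = - v"
proof (rule component_eqI)
  fix j
  have "fibrewise (B j) (component j u) 0"
    unfolding fibrewise_def using rep_zero_L2[where 'a = 'h] by eventually_elim (simp add: B_trivial)
  then have "(s j / 2) *\<^sub>R component j (v + w) = 0"
    using N_components(1)[OF v w] fibrewise_unique[OF B] by blast
  moreover have "s j \<noteq> 0"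
    using s[of j] by auto
  ultimately have "component j v + component j w = 0"
    by simp
  then show "component j w = component j (- v)"
    by (simp add: eq_neg_iff_add_eq_0 add.commute)
qed

lemma N_skew: "(u, v) \<in> N \<Longrightarrow> (u, - v) \<in> adj" "(u, w) \<in> adj \<Longrightarrow> (u, - w) \<in> N"
proof -
  show "(u, - v) \<in> adj" if v: "(u, v) \<in> N"
  proof -
    obtain w where "(u, w) \<in> adj"
      using v N_facts(5) by blast
    then show ?thesis
      using adj_eq_uminus[OF v] by blast
  qed
  show "(u, - w) \<in> N" if w: "(u, w) \<in> adj"
  proof -
    obtain v where "(u, v) \<in> N"
      using w N_facts(5) by blast
    then show ?thesis
      using adj_eq_uminus[OF _ w] by fastforce
  qed
qed

lemma N_weak_deriv:
  assumes v: "(u, v) \<in> N"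
  shows "weak_deriv (s j) (b j) UNIV (component j u) (s j *\<^sub>R component j v)"
proof -
  have "v - - v = 2 *\<^sub>R v"
    by (simp add: scaleR_2)
  then have "(s j / 2) *\<^sub>R component j (v - - v) = s j *\<^sub>R component j v"
    by (simp only: component_simps(5)) simp
  moreover have "Domain (B j) = UNIV"
    using B_trivial by auto
  ultimately show ?thesis
    using N_components(2)[OF v N_skew(1)[OF v], of j] by (simp only:)
qed

end

section \<open>The spectrum\<close>

lemma inner_scaleC_self: "inner (c *\<^sub>C x) x = Re c * (norm x)\<^sup>2"
proof -
  have "Im (cinner x x) = 0"
    using cinner_commute[of x x] by (metis Reals_cnj_iff complex_is_Real_iff)
  then show ?thesis
    by (simp add: inner_eq_Re_cinner cinner_scaleC_left power2_norm_eq_inner)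
qed

lemma inner_cis_scaleC: "inner x (cis (- \<theta>) *\<^sub>C y) = cos \<theta> * inner x y - sin \<theta> * inner x (\<i> *\<^sub>C y)"
proof -
  have "cis (- \<theta>) = complex_of_real (cos \<theta>) + complex_of_real (- sin \<theta>) * \<i>"
    by (simp add: complex_eq_iff)
  then have "cis (- \<theta>) *\<^sub>C y = cos \<theta> *\<^sub>R y + (- sin \<theta>) *\<^sub>R (\<i> *\<^sub>C y)"
    by (simp only: scaleC_add_left scaleC_of_real flip: scaleC_scaleC)
  then show ?thesis
    by (simp add: inner_diff_right)
qed

lemma integral_bump_pos:
  assumes e: "0 < e" and cd: "c < d"
  shows "0 < (\<integral>t. bump e c d t \<partial>lborel)" "integrable lborel (bump e c d)"
proof -
  have "integrable lborel (\<lambda>t. bump e c d t * indicator {c..d} t)"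
    by (rule integrable_mult_square_integrable[OF square_integrable_bump(1)[OF e] square_integrable_indicator_Icc])
  moreover have "(\<lambda>t. bump e c d t * indicator {c..d} t) = bump e c d"
  proof
    show "bump e c d t * indicator {c..d} t = bump e c d t" for t
      by (cases "t \<in> {c<..<d}") (auto simp: bump_eq_0)
  qed
  ultimately show int: "integrable lborel (bump e c d)"
    by simp
  have "(\<integral>t. bump e c d t \<partial>lborel) \<noteq> 0"
  proof
    assume "(\<integral>t. bump e c d t \<partial>lborel) = 0"
    then have "AE t in lborel. bump e c d t = 0"
      using integral_nonneg_eq_0_iff_AE[OF int] bump_nonneg by simp
    then have "AE t in lborel. t \<notin> {c<..<d}"
    proof eventually_elim
      case (elim t)
      then show ?case
        using bump_pos[of t c d e] by auto
    qed
    then have "{c<..<d} \<in> null_sets lborel"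
      by (subst AE_iff_null_sets) auto
    then have "emeasure lborel {c<..<d} = 0"
      by (simp only: null_sets_def) simp
    then show False
      using cd by simp
  qed
  moreover have "0 \<le> (\<integral>t. bump e c d t \<partial>lborel)"
    by (simp add: bump_nonneg)
  ultimately show "0 < (\<integral>t. bump e c d t \<partial>lborel)"
    by linarith
qed

lemma norm_restrict_ray_tendsto_0:
  fixes u :: "'h::{real_inner, second_countable_topology} L2"
  shows "(\<lambda>n. norm (restrict_L2 (ray s (b + real n)) u)) \<longlonglongrightarrow> 0"
proof -
  have "(\<lambda>n. \<integral>t. indicator (ray s (b + real n)) t * (norm (rep_L2 u t))\<^sup>2 \<partial>lborel) \<longlonglongrightarrow> (\<integral>t. 0 \<partial>(lborel :: real measure))"
  proof (rule integral_dominated_convergence[OF _ _ integrable_norm_rep[of u]])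
    show "AE t in lborel. (\<lambda>n. indicator (ray s (b + real n)) t * (norm (rep_L2 u t))\<^sup>2) \<longlonglongrightarrow> 0"
    proof (rule AE_I2, rule tendsto_eventually)
      fix t :: real
      obtain n0 where n0: "s * t - b < real n0"
        using reals_Archimedean2 by blast
      show "\<forall>\<^sub>F n in sequentially. indicator (ray s (b + real n)) t * (norm (rep_L2 u t))\<^sup>2 = 0"
        using eventually_ge_at_top[of n0]
      proof eventually_elim
        case (elim n)
        then have "t \<notin> ray s (b + real n)"
          using n0 by (simp add: ray_def)
        then show ?case
          by simp
      qed
    qed
    show "AE t in lborel. norm (indicator (ray s (b + real n)) t * (norm (rep_L2 u t))\<^sup>2) \<le> (norm (rep_L2 u t))\<^sup>2" for n
      by (rule AE_I2) (auto simp: indicator_def)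
  qed auto
  then have "(\<lambda>n. sqrt ((norm (restrict_L2 (ray s (b + real n)) u))\<^sup>2)) \<longlonglongrightarrow> sqrt 0"
    by (intro tendsto_real_sqrt) (simp add: norm_restrict_L2[OF ray_borel])
  then show ?thesis
    by simp
qed

text \<open>
  Square integrable on the ray, but not integrable.
\<close>

definition slow :: "real \<Rightarrow> real \<Rightarrow> real" where
  "slow b t = indicator {b<..} t / (t - b + 1)"

lemma slow_measurable [measurable]: "slow b \<in> borel_measurable borel"
  unfolding slow_def[abs_def] by measurable

lemma integrable_slow_squared: "integrable lborel (\<lambda>t. (slow b t)\<^sup>2)"
proof -
  have "(\<integral>\<^sup>+t. ennreal (1 / (t - b + 1)\<^sup>2) * indicator {b..} t \<partial>lborel) = ennreal (0 - (- 1 / (b - b + 1)))"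
  proof (rule nn_integral_FTC_atLeast[where F = "\<lambda>t. - 1 / (t - b + 1)"])
    show "((\<lambda>t. - 1 / (t - b + 1)) \<longlongrightarrow> 0) at_top"
      by real_asymp
    show "((\<lambda>t. - 1 / (t - b + 1)) has_real_derivative 1 / (t - b + 1)\<^sup>2) (at t)" if "b \<le> t" for t
      using that by (auto intro!: derivative_eq_intros simp: power2_eq_square)
  qed auto
  then have "(\<integral>\<^sup>+t. ennreal (1 / (t - b + 1)\<^sup>2) * indicator {b..} t \<partial>lborel) < \<infinity>"
    by simp
  moreover have "(\<integral>\<^sup>+t. ennreal ((slow b t)\<^sup>2) \<partial>lborel) \<le> (\<integral>\<^sup>+t. ennreal (1 / (t - b + 1)\<^sup>2) * indicator {b..} t \<partial>lborel)"
    by (intro nn_integral_mono) (auto simp: slow_def indicator_def power_divide)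
  ultimately show ?thesis
    by (intro integrableI_bounded) (auto intro: le_less_trans)
qed

lemma square_integrable_slow_mult:
  assumes [measurable]: "f \<in> borel_measurable borel" and f: "\<And>t. \<bar>f t\<bar> \<le> 1"
  shows "square_integrable (\<lambda>t. slow b t * f t)"
  unfolding square_integrable_def
proof
  show "integrable lborel (\<lambda>t. (norm (slow b t * f t))\<^sup>2)"
  proof (rule Bochner_Integration.integrable_bound[OF integrable_slow_squared[of b]])
    show "AE t in lborel. norm ((norm (slow b t * f t))\<^sup>2) \<le> norm ((slow b t)\<^sup>2)"
    proof (rule AE_I2)
      fix t
      have "(f t)\<^sup>2 \<le> 1"
        using f[of t] by (simp add: abs_square_le_1)
      then show "norm ((norm (slow b t * f t))\<^sup>2) \<le> norm ((slow b t)\<^sup>2)"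
        by (simp add: power_mult_distrib mult_left_le)
    qed
  qed measurable
qed measurable

lemma shift_in_L2_on:
  assumes s: "s * s = 1" and x: "x \<in> L2_on (ray s b)"
  shows "shift_L2 (- (s * h)) x \<in> L2_on (ray s (b + h))"
  unfolding mem_L2_on
  using rep_shift_L2[of "- (s * h)" x] AE_translate[OF x[unfolded mem_L2_on], of "- (s * h)"]
proof eventually_elim
  case (elim t)
  have "s * (t - s * h) = s * t - h"
    using s by (simp add: right_diff_distrib flip: mult.assoc)
  then show ?case
    using elim by (auto simp: ray_def)
qed

lemma Range_shift_op: "Range (shift_op T c) = {v - c *\<^sub>C u | u v. (u, v) \<in> T}"
  unfolding shift_op_def by blast

context two_ray_normal
begin

lemma inner_N: "(u, v) \<in> N \<Longrightarrow> inner v u = 0"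
  using N_skew(1)[of u v] by (fastforce simp: adj_iff inner_commute)

text \<open>
  Along the characteristics of \<open>u' = \<i> \<omega> u + g\<close> the function \<open>u\<close>, rotated back by
  \<open>exp (- \<i> s \<omega> h)\<close>, changes at the rate \<open>s g\<close>, rotated likewise.
\<close>

lemma DERIV_rotated:
  assumes v: "(u, v) \<in> N" and g: "component j v = (\<i> * complex_of_real \<omega>) *\<^sub>C component j u + g"
    and h: "0 \<le> h" and x: "x \<in> span (bump_tensors (ray (s j) (b j)) UNIV)"
  shows "((\<lambda>h. inner (shift_L2 (- (s j * h)) x) (cis (- (s j * \<omega> * h)) *\<^sub>C component j u)) has_real_derivative
    s j * inner (shift_L2 (- (s j * h)) x) (cis (- (s j * \<omega> * h)) *\<^sub>C g)) (at h)"
proof -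
  let ?X = "\<lambda>h. shift_L2 (- (s j * h)) x" and ?u = "component j u"
  have iv: "(\<i> *\<^sub>C u, \<i> *\<^sub>C v) \<in> N"
    by (rule graph_scaleC[OF N_facts(1) v])
  have D1: "((\<lambda>h. inner (?X h) ?u) has_real_derivative s j * (\<omega> * inner (?X h) (\<i> *\<^sub>C ?u) + inner (?X h) g)) (at h)"
  proof (rule DERIV_cong[OF DERIV_inner_shift[OF s_sq(1) N_weak_deriv[OF v] h x]])
    have "component j v = \<omega> *\<^sub>R (\<i> *\<^sub>C ?u) + g"
      by (simp add: g scaleR_scaleC scaleC_scaleC mult.commute)
    then show "inner (?X h) (s j *\<^sub>R component j v) = s j * (\<omega> * inner (?X h) (\<i> *\<^sub>C ?u) + inner (?X h) g)"
      by (simp add: inner_add_right)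
  qed
  have D2: "((\<lambda>h. inner (?X h) (\<i> *\<^sub>C ?u)) has_real_derivative s j * (- \<omega> * inner (?X h) ?u + inner (?X h) (\<i> *\<^sub>C g))) (at h)"
  proof (rule DERIV_cong[OF DERIV_inner_shift[OF s_sq(1) N_weak_deriv[OF iv, of j, unfolded component_scaleC] h x]])
    have "\<i> *\<^sub>C component j v = (- \<omega>) *\<^sub>R ?u + \<i> *\<^sub>C g"
      by (simp add: g scaleR_scaleC scaleC_scaleC scaleC_add_right)
    then show "inner (?X h) (s j *\<^sub>R (\<i> *\<^sub>C component j v)) = s j * (- \<omega> * inner (?X h) ?u + inner (?X h) (\<i> *\<^sub>C g))"
      by (simp add: inner_add_right inner_diff_right)
  qed
  have C: "((\<lambda>h. cos (s j * \<omega> * h)) has_real_derivative - sin (s j * \<omega> * h) * (s j * \<omega>)) (at h)"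
    and S: "((\<lambda>h. sin (s j * \<omega> * h)) has_real_derivative cos (s j * \<omega> * h) * (s j * \<omega>)) (at h)"
    by (auto intro!: derivative_eq_intros)
  show ?thesis
    unfolding inner_cis_scaleC
    by (rule DERIV_cong[OF DERIV_diff[OF DERIV_mult[OF C D1] DERIV_mult[OF S D2]]]) (simp add: algebra_simps)
qed

text \<open>
  Along the characteristics an eigenfunction has constant modulus, so its product with a bump does
  not change when the bump moves out to infinity, where a square integrable function is small.
\<close>

lemma no_imaginary_eigenvector:
  assumes v: "(u, (\<i> * complex_of_real \<omega>) *\<^sub>C u) \<in> N"
  shows "u = 0"
proof (rule total_K)
  show uK: "u \<in> K"
    using v N_facts(2) by auto
  fix j and e c d :: real and g g' :: 'h
  assume *: "0 < e" "c < d" "{c..d} \<subseteq> ray (s j) (b j)"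
  let ?x = "tensor_L2 (bump e c d) g" and ?u = "component j u"
  let ?n = "\<lambda>h. inner (shift_L2 (- (s j * h)) ?x) (cis (- (s j * \<omega> * h)) *\<^sub>C ?u)"
  have x: "?x \<in> bump_tensors (ray (s j) (b j)) UNIV"
    by (rule bump_tensorsI[OF * UNIV_I])
  have xL: "?x \<in> L2_on (ray (s j) (b j))"
    using x bump_tensors_subset by blast
  have D: "(?n has_real_derivative 0) (at h)" if "0 \<le> h" for h
    using DERIV_rotated[OF v _ that span_base[OF x], of \<omega> 0] by simp
  have const: "?n h = ?n 0" if "0 < h" for h
    using MVT2[of 0 h ?n "\<lambda>_. 0"] D that by auto
  have "(\<lambda>n. norm ?x * norm (restrict_L2 (ray (s j) (b j + real n)) ?u)) \<longlonglongrightarrow> norm ?x * 0"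
    by (intro tendsto_intros norm_restrict_ray_tendsto_0)
  moreover have "\<bar>?n 0\<bar> \<le> norm ?x * norm (restrict_L2 (ray (s j) (b j + real n)) ?u)" for n
  proof -
    let ?c = "cis (- (s j * \<omega> * real n))"
    have "?n 0 = ?n (real n)"
      using const[of "real n"] by (cases "n = 0") auto
    also have "\<dots> = inner (cnj ?c *\<^sub>C shift_L2 (- (s j * real n)) ?x) ?u"
      by (simp add: inner_scaleC_left)
    also have "\<dots> = inner (cnj ?c *\<^sub>C shift_L2 (- (s j * real n)) ?x) (restrict_L2 (ray (s j) (b j + real n)) ?u)"
    proof -
      have "cnj ?c *\<^sub>C shift_L2 (- (s j * real n)) ?x \<in> L2_on (ray (s j) (b j + real n))"
        using shift_in_L2_on[OF s_sq(1) xL] csubspace_L2_on unfolding csubspace_def by blast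
      from restrict_id_L2[OF ray_borel this] show ?thesis
        using inner_restrict_L2[OF ray_borel] by metis
    qed
    finally show ?thesis
      using Cauchy_Schwarz_ineq2[of "cnj ?c *\<^sub>C shift_L2 (- (s j * real n)) ?x" "restrict_L2 (ray (s j) (b j + real n)) ?u"]
      by (simp add: norm_scaleC)
  qed
  ultimately have "\<bar>?n 0\<bar> \<le> norm ?x * 0"
    by (intro tendsto_lowerbound[of _ _ sequentially]) auto
  then show "inner ?x ?u = 0"
    by simp
qed

text \<open>
  The right-hand side \<open>exp (\<i> \<omega> t) / t\<close> is square integrable near infinity, but its primitive along
  the characteristics grows like \<open>ln t\<close>.
\<close>

lemma imaginary_not_surjective:
  fixes f :: 'h
  assumes f: "f \<noteq> 0" and sj: "s j = 1"
  shows "\<exists>y\<in>K. y \<notin> Range (shift_op N (\<i> * complex_of_real \<omega>))"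
proof -
  define c where "c = b j + 1"
  have "isCont (\<lambda>t. cos (\<omega> * (t - c))) c"
    by (intro continuous_intros)
  then have "((\<lambda>t. cos (\<omega> * (t - c))) \<longlongrightarrow> 1) (at c)"
    by (simp add: isCont_def)
  then have "\<forall>\<^sub>F t in at c. 1 / 2 < cos (\<omega> * (t - c))"
    by (rule order_tendstoD) simp
  then obtain \<delta> where \<delta>: "0 < \<delta>" "\<And>t. t \<noteq> c \<Longrightarrow> dist t c < \<delta> \<Longrightarrow> 1 / 2 < cos (\<omega> * (t - c))"
    unfolding eventually_at by auto
  define d where "d = c + \<delta> / 2"
  have cd: "c < d" "{c..d} \<subseteq> ray (s j) (b j)"
    using \<delta>(1) sj by (auto simp: d_def c_def ray_def)
  \<comment> \<open>The interval is short enough that the phase of the right-hand side hardly turns on it.\<close>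
  have cos: "1 / 2 \<le> cos (\<omega> * (t - c))" if "t \<in> {c..d}" for t
    using that \<delta>(2)[of t] \<delta>(1) by (cases "t = c") (auto simp: d_def dist_real_def less_imp_le)
  define \<psi> \<phi> where "\<psi> t = slow (b j) t * cos (\<omega> * (t - c))" and "\<phi> t = slow (b j) t * sin (\<omega> * (t - c))" for t
  have sq: "square_integrable \<psi>" "square_integrable \<phi>"
    unfolding \<psi>_def[abs_def] \<phi>_def[abs_def] by (intro square_integrable_slow_mult; simp)+
  define g where "g = tensor_L2 \<psi> f + tensor_L2 \<phi> (\<i> *\<^sub>C f)"
  have "tensor_L2 \<psi> f \<in> L2_on (ray (s j) (b j))" "tensor_L2 \<phi> (\<i> *\<^sub>C f) \<in> L2_on (ray (s j) (b j))"
    unfolding mem_L2_on using rep_tensor_L2[OF sq(1), of f] rep_tensor_L2[OF sq(2), of "\<i> *\<^sub>C f"]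
    by (eventually_elim, simp add: \<psi>_def \<phi>_def slow_def ray_def sj)+
  then have gK: "insert_component j g \<in> K"
    unfolding g_def by (intro insert_component_in_K subspace_add subspace_L2_on)
  have ig: "\<i> *\<^sub>C g = tensor_L2 \<psi> (\<i> *\<^sub>C f) + tensor_L2 \<phi> (- f)"
    by (simp add: g_def scaleC_add_right scaleC_tensor_L2 sq scaleC_scaleC scaleC_minus1)
  have False if range: "insert_component j g \<in> Range (shift_op N (\<i> * complex_of_real \<omega>))"
  proof -
    obtain u v where v: "(u, v) \<in> N" and uv: "insert_component j g = v - (\<i> * complex_of_real \<omega>) *\<^sub>C u"
      using range unfolding Range_shift_op mem_Collect_eq by metis
    have vj: "component j v = (\<i> * complex_of_real \<omega>) *\<^sub>C component j u + g"
    proof -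
      have "component j (v - (\<i> * complex_of_real \<omega>) *\<^sub>C u) = g"
        by (simp only: uv[symmetric] component_insert) simp
      then show ?thesis
        by (simp add: diff_eq_eq add.commute)
    qed
    let ?x = "tensor_L2 (bump 1 c d) f" and ?u = "component j u"
    let ?n = "\<lambda>h. inner (shift_L2 (- (s j * h)) ?x) (cis (- (s j * \<omega> * h)) *\<^sub>C ?u)"
    let ?G = "\<lambda>h. inner (shift_L2 (- (s j * h)) ?x) (cis (- (s j * \<omega> * h)) *\<^sub>C g)"
    have x: "?x \<in> span (bump_tensors (ray (s j) (b j)) UNIV)"
      by (intro span_base bump_tensorsI cd) auto
    define M \<kappa> where "M = d - b j + 1" and "\<kappa> = inner f f * ((\<integral>t. bump 1 c d t \<partial>lborel) / 2)"
    have M: "0 < M" and \<kappa>: "0 < \<kappa>"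
      using cd(1) f integral_bump_pos(1)[of 1 c d] by (auto simp: M_def \<kappa>_def c_def)
    have G: "\<kappa> / (h + M) \<le> ?G h" if h: "0 \<le> h" for h
    proof -
      let ?b = "bump 1 (c + h) (d + h)"
      have sqb: "square_integrable ?b"
        by (rule square_integrable_bump(1)) simp
      have orth: "inner f (\<i> *\<^sub>C f) = 0" "inner f (- f) = - inner f f"
        by (simp_all add: inner_i_scaleC_self)
      have X: "shift_L2 (- (s j * h)) ?x = tensor_L2 ?b f"
        using shift_bump_tensor(1)[of 1 h c d f] sj by simp
      have "?G h = cos (\<omega> * h) * ((\<integral>t. ?b t * \<psi> t \<partial>lborel) * inner f f)
          + sin (\<omega> * h) * ((\<integral>t. ?b t * \<phi> t \<partial>lborel) * inner f f)"
        unfolding inner_cis_scaleC X ig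
        by (simp add: sj g_def inner_add_right inner_tensor_tensor_L2 sqb sq orth)
      also have "\<dots> = inner f f * ((\<integral>t. cos (\<omega> * h) * (?b t * \<psi> t) \<partial>lborel) + (\<integral>t. sin (\<omega> * h) * (?b t * \<phi> t) \<partial>lborel))"
        by (simp add: distrib_left mult.left_commute mult.commute[of _ "inner f f"])
      also have "\<dots> = inner f f * (\<integral>t. cos (\<omega> * h) * (?b t * \<psi> t) + sin (\<omega> * h) * (?b t * \<phi> t) \<partial>lborel)"
        by (subst Bochner_Integration.integral_add)
          (auto intro: integrable_mult_square_integrable sqb sq)
      also have "\<dots> = inner f f * (\<integral>t. ?b t * slow (b j) t * cos (\<omega> * ((t - h) - c)) \<partial>lborel)"
      proof -
        have "cos (\<omega> * h) * (?b t * \<psi> t) + sin (\<omega> * h) * (?b t * \<phi> t)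
            = ?b t * slow (b j) t * cos (\<omega> * ((t - h) - c))" for t
        proof -
          have "\<omega> * ((t - h) - c) = \<omega> * (t - c) - \<omega> * h"
            by (simp add: algebra_simps)
          then show ?thesis
            by (simp only: cos_diff \<psi>_def \<phi>_def) (simp add: algebra_simps)
        qed
        then show ?thesis
          by (simp only:)
      qed
      also have "\<dots> \<ge> inner f f * (\<integral>t. ?b t * (1 / (2 * (h + M))) \<partial>lborel)"
      proof (intro mult_left_mono integral_mono)
        show "integrable lborel (\<lambda>t. ?b t * (1 / (2 * (h + M))))"
          by (intro integrable_mult_left integral_bump_pos(2)) (use cd(1) in auto)
        have "square_integrable (\<lambda>t. slow (b j) t * cos (\<omega> * ((t - h) - c)))"
          by (intro square_integrable_slow_mult) auto
        from integrable_mult_square_integrable[OF sqb this]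
        show "integrable lborel (\<lambda>t. ?b t * slow (b j) t * cos (\<omega> * ((t - h) - c)))"
          by (simp add: mult.assoc)
        fix t
        show "?b t * (1 / (2 * (h + M))) \<le> ?b t * slow (b j) t * cos (\<omega> * ((t - h) - c))"
        proof (cases "t \<in> {c + h<..<d + h}")
          case True
          then have "1 / (h + M) \<le> slow (b j) t" "b j < t"
            using h unfolding slow_def M_def c_def by (auto intro!: divide_left_mono mult_pos_pos)
          moreover have "1 / 2 \<le> cos (\<omega> * ((t - h) - c))"
            using True by (intro cos) auto
          ultimately have "1 / (h + M) * (1 / 2) \<le> slow (b j) t * cos (\<omega> * ((t - h) - c))"
            using h M by (intro mult_mono) (auto intro: order_trans[of 0 "1 / (h + M)"])
          then have "?b t * (1 / (h + M) * (1 / 2)) \<le> ?b t * (slow (b j) t * cos (\<omega> * ((t - h) - c)))"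
            by (rule mult_left_mono[OF _ bump_nonneg])
          then show ?thesis
            by (simp add: mult.assoc mult.commute[of 2])
        qed (simp add: bump_eq_0)
      qed simp
      also have "inner f f * (\<integral>t. ?b t * (1 / (2 * (h + M))) \<partial>lborel) = \<kappa> / (h + M)"
      proof -
        have "(\<integral>t. ?b t \<partial>lborel) = (\<integral>t. bump 1 c d t \<partial>lborel)"
          using integral_translate[of "bump 1 c d" "- h"] bump_translate[of 1 c d _ "- h"] by simp
        then show ?thesis
          by (simp add: \<kappa>_def)
      qed
      finally show ?thesis
        by simp
    qed
    \<comment> \<open>The product with the translated bump grows logarithmically, but it is bounded by the norms.\<close>
    have mono: "?n 0 - \<kappa> * ln (0 + M) \<le> ?n h - \<kappa> * ln (h + M)" if h: "0 \<le> h" for h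
    proof (rule DERIV_nonneg_imp_nondecreasing[OF h])
      fix h :: real
      assume h: "0 \<le> h"
      have "((\<lambda>h. ?n h - \<kappa> * ln (h + M)) has_real_derivative s j * ?G h - \<kappa> / (h + M)) (at h)"
        by (rule DERIV_diff[OF DERIV_rotated[OF v vj h x]]) (use h M in \<open>auto intro!: derivative_eq_intros\<close>)
      then show "\<exists>y. ((\<lambda>h. ?n h - \<kappa> * ln (h + M)) has_real_derivative y) (at h) \<and> 0 \<le> y"
        using G[OF h] sj by (intro exI conjI) auto
    qed
    have bound: "\<bar>?n h\<bar> \<le> norm ?x * norm ?u" for h
      using Cauchy_Schwarz_ineq2[of "shift_L2 (- (s j * h)) ?x" "cis (- (s j * \<omega> * h)) *\<^sub>C ?u"]
      by (simp add: norm_scaleC)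
    have "filterlim (\<lambda>h. \<kappa> * ln (h + M)) at_top at_top"
      using \<kappa> by real_asymp
    then have "\<forall>\<^sub>F h in at_top. 2 * (norm ?x * norm ?u) + \<kappa> * ln (0 + M) < \<kappa> * ln (h + M)"
      by (simp add: filterlim_at_top_dense)
    from eventually_conj[OF this eventually_ge_at_top[of 0]]
    obtain h where "2 * (norm ?x * norm ?u) + \<kappa> * ln (0 + M) < \<kappa> * ln (h + M)" "0 \<le> h"
      using eventually_happens'[OF trivial_limit_at_top_linorder] by blast
    then show False
      using mono[of h] bound[of h] bound[of 0] by linarith
  qed
  then show ?thesis
    using gK by blast
qed

lemma subspace_Range_shift_op: "subspace (Range (shift_op N c))" "Range (shift_op N c) \<subseteq> K"
proof -
  show "Range (shift_op N c) \<subseteq> K"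
  proof
    fix y
    assume "y \<in> Range (shift_op N c)"
    then obtain u v where "(u, v) \<in> N" "y = v - c *\<^sub>C u"
      by (auto simp: Range_shift_op)
    moreover from this have "u \<in> K" "v \<in> K"
      using N_facts(2) by auto
    ultimately show "y \<in> K"
      using csubspace_K subspace_diff[OF csubspace_imp_subspace[OF csubspace_K]] unfolding csubspace_def by blast
  qed
  show "subspace (Range (shift_op N c))"
    unfolding Range_shift_op
  proof (rule subspaceI)
    have "(0, 0) \<in> N"
      using N_facts(1) unfolding csubspace_def zero_prod_def by blast
    then show "0 \<in> {v - c *\<^sub>C u | u v. (u, v) \<in> N}"
      by (intro CollectI exI[of _ 0]) simp
  next
    fix x y
    assume "x \<in> {v - c *\<^sub>C u | u v. (u, v) \<in> N}" "y \<in> {v - c *\<^sub>C u | u v. (u, v) \<in> N}"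
    then obtain u v u' v' where *: "(u, v) \<in> N" "(u', v') \<in> N" "x = v - c *\<^sub>C u" "y = v' - c *\<^sub>C u'"
      by blast
    then have "x + y = (v + v') - c *\<^sub>C (u + u')"
      by (simp add: scaleC_add_right)
    then show "x + y \<in> {v - c *\<^sub>C u | u v. (u, v) \<in> N}"
      using graph_add[OF N_facts(1) *(1,2)] by blast
  next
    fix r x
    assume "x \<in> {v - c *\<^sub>C u | u v. (u, v) \<in> N}"
    then obtain u v where *: "(u, v) \<in> N" "x = v - c *\<^sub>C u"
      by blast
    then have "r *\<^sub>R x = r *\<^sub>R v - c *\<^sub>C (r *\<^sub>R u)"
      by (simp add: scaleR_diff_right scaleC_scaleR_commute)
    then show "r *\<^sub>R x \<in> {v - c *\<^sub>C u | u v. (u, v) \<in> N}"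
      using graph_scaleR[OF N_facts(1) *(1)] by blast
  qed
qed

text \<open>
  Density of the range is injectivity again: a vector orthogonal to the range of \<open>N - \<i> \<omega>\<close> is an
  eigenvector of the adjoint \<open>- N\<close>, hence of \<open>N\<close> for the eigenvalue \<open>\<i> \<omega>\<close>.
\<close>

lemma imaginary_continuous_spectrum:
  fixes f :: 'h
  assumes "f \<noteq> 0" "s j = 1"
  shows "\<i> * complex_of_real \<omega> \<in> continuous_spectrum K N"
proof -
  let ?c = "\<i> * complex_of_real \<omega>"
  have "single_valued ((shift_op N ?c)\<inverse>)"
  proof (rule single_valuedI)
    fix y u u'
    assume "(y, u) \<in> (shift_op N ?c)\<inverse>" "(y, u') \<in> (shift_op N ?c)\<inverse>"
    then obtain v v' where *: "(u, v) \<in> N" "(u', v') \<in> N" "y = v - ?c *\<^sub>C u" "y = v' - ?c *\<^sub>C u'"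
      by (auto simp: shift_op_def)
    then have "v - v' = ?c *\<^sub>C (u - u')"
      by (simp add: scaleC_diff_right) (simp add: algebra_simps)
    then have "(u - u', ?c *\<^sub>C (u - u')) \<in> N"
      using graph_diff[OF N_facts(1) *(1,2)] by simp
    then show "u = u'"
      using no_imaginary_eigenvector by fastforce
  qed
  moreover have "K \<subseteq> closure (Range (shift_op N ?c))"
  proof (rule dense_if_total[OF complete_K csubspace_imp_subspace[OF csubspace_K] subspace_Range_shift_op])
    fix z
    assume z: "z \<in> K" and orth: "\<And>x. x \<in> Range (shift_op N ?c) \<Longrightarrow> inner x z = 0"
    have "(z, - (?c *\<^sub>C z)) \<in> adj"
      unfolding adj_iff
    proof (intro conjI z ballI)
      show "- (?c *\<^sub>C z) \<in> K"
        using z csubspace_K csubspace_minus[OF csubspace_K] unfolding csubspace_def by blast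
      show "case p of (u, v) \<Rightarrow> inner v z = inner u (- (?c *\<^sub>C z))" if p: "p \<in> N" for p
      proof -
        obtain u v where Pair: "p = (u, v)"
          by (metis surj_pair)
        then have "inner (v - ?c *\<^sub>C u) z = 0"
          using orth[of "v - ?c *\<^sub>C u"] p unfolding Range_shift_op mem_Collect_eq by metis
        then show ?thesis
          using Pair by (simp add: inner_diff_left inner_scaleC_left scaleC_minus_left)
      qed
    qed
    then have "(z, ?c *\<^sub>C z) \<in> N"
      using N_skew(2) by fastforce
    then show "z = 0"
      by (rule no_imaginary_eigenvector)
  qed
  moreover have "Range (shift_op N ?c) \<noteq> K"
    using imaginary_not_surjective[OF assms] by blast
  ultimately show ?thesis
    by (simp add: continuous_spectrum_def)
qed

text \<open>
  Since \<open>\<langle>N u, u\<rangle>\<close> is imaginary, \<open>\<parallel>(N - c) u\<parallel> \<ge> \<bar>Re c\<bar> \<parallel>u\<parallel>\<close>. Off the imaginary axis the range is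
  therefore closed, and if it is dense it is everything.
\<close>

lemma continuous_spectrum_imaginary:
  assumes c: "c \<in> continuous_spectrum K N"
  shows "Re c = 0"
proof (rule ccontr)
  assume re: "Re c \<noteq> 0"
  let ?R = "Range (shift_op N c)"
  have lower: "\<bar>Re c\<bar> * norm u \<le> norm (v - c *\<^sub>C u)" if "(u, v) \<in> N" for u v
  proof -
    have "inner (v - c *\<^sub>C u) u = - (Re c * (norm u)\<^sup>2)"
      using inner_N[OF that] by (simp add: inner_diff_left inner_scaleC_self)
    then have "(\<bar>Re c\<bar> * norm u) * norm u \<le> norm (v - c *\<^sub>C u) * norm u"
      using Cauchy_Schwarz_ineq2[of "v - c *\<^sub>C u" u] by (simp add: abs_mult power2_eq_square mult.assoc)
    then show ?thesis
      by (cases "norm u = 0") auto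
  qed
  have "closed ?R"
    unfolding closed_sequential_limits
  proof (intro allI impI, elim conjE)
    fix Y y
    assume Y: "\<forall>n. Y n \<in> ?R" "Y \<longlonglongrightarrow> y"
    have "\<exists>u v. (u, v) \<in> N \<and> Y n = v - c *\<^sub>C u" for n
      using Y(1) unfolding Range_shift_op by blast
    then obtain U V where UV: "\<And>n. (U n, V n) \<in> N" "\<And>n. Y n = V n - c *\<^sub>C U n"
      by metis
    have le: "\<bar>Re c\<bar> * norm (U m - U n) \<le> norm (Y m - Y n)" for m n
    proof -
      have "Y m - Y n = (V m - V n) - c *\<^sub>C (U m - U n)"
        by (simp add: UV(2) scaleC_diff_right)
      then show ?thesis
        using lower[OF graph_diff[OF N_facts(1) UV(1) UV(1)], of m n] by simp
    qed
    have "Cauchy U"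
      unfolding Cauchy_def
    proof (intro allI impI)
      fix e :: real
      assume "e > 0"
      then have "0 < \<bar>Re c\<bar> * e"
        using re by simp
      then obtain n0 where n0: "\<forall>m\<ge>n0. \<forall>n\<ge>n0. dist (Y m) (Y n) < \<bar>Re c\<bar> * e"
        using LIMSEQ_imp_Cauchy[OF Y(2)] unfolding Cauchy_def by blast
      have "dist (U m) (U n) < e" if "m \<ge> n0" "n \<ge> n0" for m n
      proof -
        have "\<bar>Re c\<bar> * norm (U m - U n) < \<bar>Re c\<bar> * e"
          using le[of m n] n0 that by (simp add: dist_norm le_less_trans)
        then show ?thesis
          using re by (simp add: dist_norm)
      qed
      then show "\<exists>M. \<forall>m\<ge>M. \<forall>n\<ge>M. dist (U m) (U n) < e"
        by blast
    qed
    then obtain u where u: "U \<longlonglongrightarrow> u"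
      using Cauchy_convergent convergent_def by blast
    have "(\<lambda>n. Y n + c *\<^sub>C U n) \<longlonglongrightarrow> y + c *\<^sub>C u"
      by (intro tendsto_add Y(2) bounded_linear.tendsto[OF bounded_linear_scaleC u])
    then have "(\<lambda>n. (U n, V n)) \<longlonglongrightarrow> (u, y + c *\<^sub>C u)"
      by (intro tendsto_Pair u) (simp add: UV(2))
    then have "(u, y + c *\<^sub>C u) \<in> N"
      by (rule closed_sequentially[OF N_facts(3) UV(1)])
    then show "y \<in> ?R"
      unfolding Range_shift_op mem_Collect_eq by (metis add_diff_cancel_right')
  qed
  then have "K \<subseteq> ?R"
    using c by (simp add: continuous_spectrum_def)
  then show False
    using c subspace_Range_shift_op(2)[of c] by (auto simp: continuous_spectrum_def)
qed

end

section \<open>The minimal operators\<close>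

lemma bump_in_minimal_op:
  fixes A :: "'h::{complex_inner, second_countable_topology} rel"
  assumes A: "csubspace A" and e: "0 < e" and cd: "{c..d} \<subseteq> S" and g: "(g, g') \<in> A"
  shows "(tensor_L2 (bump e c d) g, tensor_L2 (bump' e c d) g + tensor_L2 (bump e c d) g') \<in> minimal_op S A"
proof -
  note sq = square_integrable_bump[OF e, of c d]
  define u where "u t = bump e c d t *\<^sub>R g" for t
  define v where "v t = bump' e c d t *\<^sub>R g + bump e c d t *\<^sub>R g'" for t
  have "u = (\<lambda>t. \<Sum>j<(1::nat). complex_of_real (bump e c d t) *\<^sub>C g)"
    by (simp add: u_def[abs_def] scaleC_of_real)
  then have test: "u \<in> test_sums S (Domain A)"
    unfolding test_sums_def using bump_test_function[OF e cd] g
    by (intro CollectI exI[of _ "1::nat"] exI[of _ "\<lambda>_ t. complex_of_real (bump e c d t)"] exI[of _ "\<lambda>_. g"]) auto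
  have "(u has_vector_derivative bump' e c d t *\<^sub>R g) (at t)" for t
    unfolding u_def[abs_def] using DERIV_bump[OF e, of c d t]
    by (auto intro!: derivative_eq_intros simp: has_real_derivative_iff_has_vector_derivative)
  then have der: "vector_derivative u (at t) = bump' e c d t *\<^sub>R g" for t
    by (rule vector_derivative_at)
  have "\<exists>w. (u t, w) \<in> A \<and> v t = vector_derivative u (at t) + w" for t
    using graph_scaleR[OF A g, of "bump e c d t"] by (auto simp: der u_def v_def)
  then have "(abs_L2 u, abs_L2 v) \<in> minimal_op S A"
    unfolding minimal_op_def
    by (intro subsetD[OF closure_subset] CollectI exI[of _ u] exI[of _ v] conjI refl test allI)
  moreover have "abs_L2 u = tensor_L2 (bump e c d) g"
    by (simp add: tensor_L2_def u_def[abs_def])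
  moreover have "abs_L2 v = tensor_L2 (bump' e c d) g + tensor_L2 (bump e c d) g'"
  proof (rule L2_eqI)
    have "square_integrable v"
      unfolding v_def[abs_def]
      by (intro square_integrable_add square_integrable_bounded_linear[OF bounded_linear_scaleR_left] sq)
    from rep_abs_L2[OF this] rep_add_L2[of "tensor_L2 (bump' e c d) g" "tensor_L2 (bump e c d) g'"]
      rep_tensor_L2[OF sq(2), of g] rep_tensor_L2[OF sq(1), of g']
    show "AE t in lborel. rep_L2 (abs_L2 v) t = rep_L2 (tensor_L2 (bump' e c d) g + tensor_L2 (bump e c d) g') t"
      by eventually_elim (simp add: v_def)
  qed
  ultimately show ?thesis
    by simp
qed

lemma zero_in_minimal_op:
  fixes A :: "'h::{complex_inner, second_countable_topology} rel"
  assumes "csubspace A"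
  shows "(0, 0) \<in> minimal_op S A"
proof -
  have "(\<lambda>t. 0) \<in> test_sums S (Domain A)"
    unfolding test_sums_def by (intro CollectI exI[of _ 0]) simp
  moreover have "(0, 0) \<in> A"
    using assms unfolding csubspace_def zero_prod_def by blast
  ultimately have "(abs_L2 (\<lambda>t. 0), abs_L2 (\<lambda>t. 0)) \<in> minimal_op S A"
    unfolding minimal_op_def by (intro subsetD[OF closure_subset] CollectI exI[of _ "\<lambda>t. 0"]) auto
  then show ?thesis
    by (simp add: zero_L2_def)
qed

lemma uminus_op_iff: "(f, g) \<in> uminus_op T \<longleftrightarrow> (f, - g) \<in> T"
proof
  assume "(f, - g) \<in> T"
  then have "(f, - (- g)) \<in> uminus_op T"
    unfolding uminus_op_def by blast
  then show "(f, g) \<in> uminus_op T"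
    by simp
qed (auto simp: uminus_op_def)

lemma selfadjoint_uminus_op:
  fixes T :: "'h::complex_inner rel"
  assumes T: "selfadjoint_op UNIV T"
  shows "selfadjoint_op UNIV (uminus_op T)"
proof -
  note cs = selfadjoint_csubspace[OF T]
  have cs': "csubspace (uminus_op T)"
    unfolding csubspace_def
  proof (intro conjI ballI allI)
    show "0 \<in> uminus_op T"
      using cs unfolding csubspace_def zero_prod_def uminus_op_iff by simp
    show "x + y \<in> uminus_op T" if "x \<in> uminus_op T" "y \<in> uminus_op T" for x y
      using that graph_add[OF cs, of "fst x" "- snd x" "fst y" "- snd y"]
      by (cases x; cases y) (simp add: uminus_op_iff)
    show "c *\<^sub>C x \<in> uminus_op T" if "x \<in> uminus_op T" for c x
      using that graph_scaleC[OF cs, of "fst x" "- snd x" c]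
      by (cases x) (simp add: uminus_op_iff scaleC_prod_def scaleC_minus_right)
  qed
  have "single_valued (uminus_op T)"
    using T unfolding selfadjoint_op_def linear_op_def single_valued_def uminus_op_iff by (metis neg_equal_iff_equal)
  moreover have "Domain (uminus_op T) = Domain T"
    unfolding uminus_op_def by blast
  moreover have "adjoint_op UNIV (uminus_op T) = uminus_op T"
  proof (intro set_eqI, clarify)
    fix g h
    have "(\<forall>(f, Tf) \<in> uminus_op T. inner Tf g = inner f h) \<longleftrightarrow> (\<forall>(f, Tf) \<in> T. inner Tf g = inner f (- h))"
    proof -
      have "(\<forall>(f, Tf) \<in> uminus_op T. inner Tf g = inner f h) \<longleftrightarrow> (\<forall>(f, Tf) \<in> T. inner (- Tf) g = inner f h)"
        unfolding uminus_op_def by blast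
      also have "\<dots> \<longleftrightarrow> (\<forall>(f, Tf) \<in> T. inner Tf g = inner f (- h))"
        by (auto simp: minus_equation_iff[of "inner _ g"])
      finally show ?thesis .
    qed
    then have "(g, h) \<in> adjoint_op UNIV (uminus_op T) \<longleftrightarrow> (g, - h) \<in> adjoint_op UNIV T"
      unfolding adjoint_op_iff[OF cs] adjoint_op_iff[OF cs'] by simp
    then show "(g, h) \<in> adjoint_op UNIV (uminus_op T) \<longleftrightarrow> (g, h) \<in> uminus_op T"
      using T by (simp add: selfadjoint_op_def uminus_op_iff)
  qed
  ultimately show ?thesis
    using T cs' by (simp add: selfadjoint_op_def linear_op_def densely_defined_def)
qed

theorem theorem3p2:
  fixes a b :: real
    and A1 A2 :: "'h::{chilbert_space, second_countable_topology} rel"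
    and L\<^sub>W :: "('h L2 \<times> 'h L2) rel"
  assumes "a < b"
    and "selfadjoint_op UNIV A1" and "selfadjoint_op UNIV A2"
    and "nonpos_op A1" and "nonneg_op A2"
    and "0 \<in> point_spectrum (sqrt_op UNIV (uminus_op A1)) \<inter> point_spectrum (sqrt_op UNIV A2)"
    and "normal_extension (L2_on {..<a} \<times> L2_on {b<..})
           (direct_sum_op (minimal_op {..<a} A1) (minimal_op {b<..} A2)) L\<^sub>W"
  shows "continuous_spectrum (L2_on {..<a} \<times> L2_on {b<..}) L\<^sub>W
           = range (\<lambda>s::real. \<i> * complex_of_real s)"
proof -
  let ?K = "L2_on {..<a} \<times> L2_on {b<..} :: ('h L2 \<times> 'h L2) set"
  let ?s = "\<lambda>j. if j then - 1 else 1 :: real" and ?b = "\<lambda>j. if j then - a else b"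
  let ?B = "\<lambda>j. if j then uminus_op A1 else A2"
  have rays: "ray (- 1) (- a) = {..<a}" "ray 1 b = {b<..}"
    by (auto simp: ray_def)
  interpret two_ray_normal ?B ?s ?b ?K L\<^sub>W
  proof
    show "selfadjoint_op UNIV (?B j)" for j
      using assms(2,3) selfadjoint_uminus_op by auto
    show "nonneg_op (?B j)" for j
      using assms(4,5) by (auto simp: nonneg_op_def nonpos_op_def uminus_op_def inner_eq_Re_cinner[symmetric])
    show "?K = {z. \<forall>j. component j z \<in> L2_on (ray (?s j) (?b j))}"
      by (auto simp: component_def rays all_bool_eq)
    show "normal_op ?K L\<^sub>W"
      using assms(7) by (simp add: normal_extension_def)
    fix j and e c d :: real and g g' :: 'h
    assume *: "0 < e" "c < d" "{c..d} \<subseteq> ray (?s j) (?b j)" "(g, g') \<in> ?B j"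
    note cs = selfadjoint_csubspace[OF assms(2)] selfadjoint_csubspace[OF assms(3)]
    have "(insert_component j (tensor_L2 (bump e c d) g),
        insert_component j (tensor_L2 (bump' e c d) g + ?s j *\<^sub>R tensor_L2 (bump e c d) g'))
      \<in> direct_sum_op (minimal_op {..<a} A1) (minimal_op {b<..} A2)"
    proof (cases j)
      case True
      then have "(tensor_L2 (bump e c d) g, tensor_L2 (bump' e c d) g + tensor_L2 (bump e c d) (- g')) \<in> minimal_op {..<a} A1"
        using * by (intro bump_in_minimal_op cs) (auto simp: rays uminus_op_iff)
      then show ?thesis
        using True zero_in_minimal_op[OF cs(2)] scaleR_tensor_L2[OF square_integrable_bump(1)[OF *(1)], of "- 1" c d g']
        by (simp add: direct_sum_op_def insert_component_def)
    next
      case False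
      then have "(tensor_L2 (bump e c d) g, tensor_L2 (bump' e c d) g + tensor_L2 (bump e c d) g') \<in> minimal_op {b<..} A2"
        using * by (intro bump_in_minimal_op cs) (auto simp: rays)
      then show ?thesis
        using False zero_in_minimal_op[OF cs(1)] by (simp add: direct_sum_op_def insert_component_def)
    qed
    then show "(insert_component j (tensor_L2 (bump e c d) g),
        insert_component j (tensor_L2 (bump' e c d) g + ?s j *\<^sub>R tensor_L2 (bump e c d) g')) \<in> L\<^sub>W"
      using assms(7) unfolding normal_extension_def by blast
  qed auto
  obtain f :: 'h where f: "f \<noteq> 0"
    using assms(6) by (auto simp: point_spectrum_def)
  show ?thesis
  proof (intro equalityI subsetI)
    fix c
    assume "c \<in> continuous_spectrum ?K L\<^sub>W"
    then have "c = \<i> * complex_of_real (Im c)"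
      using continuous_spectrum_imaginary[of c] by (simp add: complex_eq_iff)
    then show "c \<in> range (\<lambda>s::real. \<i> * complex_of_real s)"
      by blast
  next
    fix c
    assume "c \<in> range (\<lambda>s::real. \<i> * complex_of_real s)"
    then show "c \<in> continuous_spectrum ?K L\<^sub>W"
      using imaginary_continuous_spectrum[OF f, of False] by auto
  qed
qed

end
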